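(* Let $(X_k)_{k\in\mathbf{Z}}$ be a stationary causal process $X_k=G(\ldots,\varepsilon_{k-1},\varepsilon_k)$ with $\mathbf{E}(X_k)=0$ and $X_k\in\mathcal{L}^2$. Assume $\sum_{k=0}^\infty\|\mathcal{P}_0X_k\|<\infty$ and $\min_{\theta\in\mathbf{R}}f(\theta)>0$. Let $q\in\mathbf{N}$ and let $1\le l_1<l_2<\cdots<l_q\le m$ be integers, which may depend on $n$. Then, as $n\to\infty$, $$\left\{\frac{S_n(\theta_{l_j})}{\sqrt{n\pi f(\theta_{l_j})}},\ 1\le j\le q\right\}\Rightarrow\{Y_{2j-1}+iY_{2j},\ 1\le j\le q\},$$ where $Y_k$, $1\le k\le2q$, are i.i.d. standard normal random variables. Consequently, for $\tilde I_n(\theta):=I_n(\theta)/f(\theta)$, $$\{\tilde I_n(\theta_{l_j}),\ 1\le j\le q\}\Rightarrow\{E_j,\ 1\le j\le q\},$$ where $E_j$ are i.i.d. standard exponential ($\exp(1)$) random variables.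
   Context: $(\varepsilon_k)_{k\in\mathbf{Z}}$ are i.i.d. random variables, $G$ is a measurable function such that $X_k=G(\ldots,\varepsilon_{k-1},\varepsilon_k)$ is a proper random variable, $\mathcal{F}_k=(\ldots,\varepsilon_{k-1},\varepsilon_k)$. $\|\xi\|=[\mathbf{E}(|\xi|^2)]^{1/2}$, $\xi\in\mathcal{L}^2$ means $\|\xi\|<\infty$, and $\mathcal{P}_k\xi=\mathbf{E}(\xi|\mathcal{F}_k)-\mathbf{E}(\xi|\mathcal{F}_{k-1})$. $r(k)=\mathbf{E}(X_0X_k)$ and $f(\lambda)=\frac1{2\pi}\sum_{k\in\mathbf{Z}}r(k)e^{ik\lambda}$ is the spectral density. $S_n(\theta)=\sum_{k=1}^nX_ke^{ik\theta}$, $I_n(\theta)=\frac1{2\pi n}|S_n(\theta)|^2$, $\theta_j=2\pi j/n$, $m=\lfloor(n-1)/2\rfloor$. $\Rightarrow$ denotes convergence in distribution. *)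

theory Defs
  imports "HOL-Probability.Probability"
begin

text \<open>
  The left-infinite sequence $(\ldots, \varepsilon_{k-1}, \varepsilon_k)$ is encoded as a function
  on the naturals, entry \<open>j\<close> being $\varepsilon_{k-j}$.
\<close>

definition past :: "(int \<Rightarrow> 'a \<Rightarrow> real) \<Rightarrow> int \<Rightarrow> 'a \<Rightarrow> nat \<Rightarrow> real" where
  "past \<epsilon> k \<omega> = (\<lambda>j. \<epsilon> (k - int j) \<omega>)"

definition causal_process ::
  "((nat \<Rightarrow> real) \<Rightarrow> real) \<Rightarrow> (int \<Rightarrow> 'a \<Rightarrow> real) \<Rightarrow> int \<Rightarrow> 'a \<Rightarrow> real" where
  "causal_process G \<epsilon> k \<omega> = G (past \<epsilon> k \<omega>)"

definition past_algebra :: "'a measure \<Rightarrow> (int \<Rightarrow> 'a \<Rightarrow> real) \<Rightarrow> int \<Rightarrow> 'a measure" where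
  "past_algebra M \<epsilon> k = vimage_algebra (space M) (past \<epsilon> k) (PiM UNIV (\<lambda>_. borel))"

definition proj_op ::
  "'a measure \<Rightarrow> (int \<Rightarrow> 'a \<Rightarrow> real) \<Rightarrow> int \<Rightarrow> ('a \<Rightarrow> real) \<Rightarrow> 'a \<Rightarrow> real" where
  "proj_op M \<epsilon> k \<xi> \<omega> =
     real_cond_exp M (past_algebra M \<epsilon> k) \<xi> \<omega> - real_cond_exp M (past_algebra M \<epsilon> (k - 1)) \<xi> \<omega>"

definition norm_L2 :: "'a measure \<Rightarrow> ('a \<Rightarrow> real) \<Rightarrow> real" where
  "norm_L2 M \<xi> = sqrt (\<integral>\<omega>. \<bar>\<xi> \<omega>\<bar>\<^sup>2 \<partial>M)"

definition iid :: "'a measure \<Rightarrow> ('i \<Rightarrow> 'a \<Rightarrow> real) \<Rightarrow> 'i set \<Rightarrow> bool" where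
  "iid M Z I \<longleftrightarrow> prob_space.indep_vars M (\<lambda>_. borel) Z I \<and>
     (\<forall>i\<in>I. \<forall>j\<in>I. distr M borel (Z i) = distr M borel (Z j))"

definition autocov :: "'a measure \<Rightarrow> (int \<Rightarrow> 'a \<Rightarrow> real) \<Rightarrow> int \<Rightarrow> real" where
  "autocov M X k = (\<integral>\<omega>. X 0 \<omega> * X k \<omega> \<partial>M)"

text \<open>
  For a stationary process the autocovariances are even, so the sum below is real and the real
  part only serves to obtain a value of type \<^typ>\<open>real\<close>. The sum is unconditional, and is 0 by
  convention if the autocovariances are not absolutely summable.
\<close>

definition spectral_density :: "'a measure \<Rightarrow> (int \<Rightarrow> 'a \<Rightarrow> real) \<Rightarrow> real \<Rightarrow> real" where
  "spectral_density M X \<theta> =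
     1 / (2 * pi) * Re (\<Sum>\<^sub>\<infinity>k\<in>(UNIV :: int set). complex_of_real (autocov M X k) * cis (of_int k * \<theta>))"

definition fourier_sum :: "(int \<Rightarrow> 'a \<Rightarrow> real) \<Rightarrow> nat \<Rightarrow> real \<Rightarrow> 'a \<Rightarrow> complex" where
  "fourier_sum X n \<theta> \<omega> = (\<Sum>k=1..n. complex_of_real (X (int k) \<omega>) * cis (real k * \<theta>))"

definition periodogram :: "(int \<Rightarrow> 'a \<Rightarrow> real) \<Rightarrow> nat \<Rightarrow> real \<Rightarrow> 'a \<Rightarrow> real" where
  "periodogram X n \<theta> \<omega> = 1 / (2 * pi * real n) * (cmod (fourier_sum X n \<theta> \<omega>))\<^sup>2"

definition fourier_freq :: "nat \<Rightarrow> nat \<Rightarrow> real" where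
  "fourier_freq n j = 2 * pi * real j / real n"

text \<open>
  Convergence in distribution of random elements of a topological space \<open>T\<close>: convergence of the
  expectations of all bounded continuous real functions on \<open>T\<close>.
\<close>

definition conv_in_distribution ::
  "'b topology \<Rightarrow> 'a measure \<Rightarrow> (nat \<Rightarrow> 'a \<Rightarrow> 'b) \<Rightarrow> 'c measure \<Rightarrow> ('c \<Rightarrow> 'b) \<Rightarrow> bool" where
  "conv_in_distribution T M Z N Y \<longleftrightarrow>
     (\<forall>h. continuous_map T euclideanreal h \<and> bounded (h ` topspace T) \<longrightarrow>
        (\<lambda>n. \<integral>\<omega>. h (Z n \<omega>) \<partial>M) \<longlonglongrightarrow> (\<integral>\<omega>. h (Y \<omega>) \<partial>N))"

text \<open>
  The \<open>q\<close>-dimensional space over \<^typ>\<open>real\<close> or \<^typ>\<open>complex\<close>; its points are the functions on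
  \<^term>\<open>{1..q}\<close>, extended by \<^const>\<open>undefined\<close>.
\<close>

abbreviation vec_space :: "nat \<Rightarrow> (nat \<Rightarrow> 'b::topological_space) topology" where
  "vec_space q \<equiv> product_topology (\<lambda>_. euclidean) {1..q}"

end

theory Submission
  imports Defs
begin

text \<open>
  Read backwards in time, the noise is a point of the one-sided shift, and
  $X_k = G(\mathrm{past}_k)$. Writing $G_j$ for the conditional expectation of $X_j$ given the past up
  to time 0, the functions $g_j = G_j - G_{j+1} \circ \mathrm{tail}$ represent the projections
  ${\mathcal P}_0 X_j$; they are martingale differences and $X_k$ is the sum of the
  $g_j(\mathrm{past}_{k-j})$. For weights of size $O(n^{-1/2})$ orthogonality gives
  $\|\sum_k a_k g_j(\mathrm{past}_{k-j})\| \le C \|g_j\|$ uniformly in $n$, so up to a small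
  $L^2$ error a weighted sum of the $X_k$ involves finitely many $j$, and by density $G$ may be
  replaced by a bounded function of finitely many coordinates. What remains is a weighted sum of bounded,
  finitely dependent martingale differences $\xi_r$, and McLeish's argument applies:
  $\prod_r (1 + i \xi_r)$ has expectation 1, and $\sum_r \xi_r^2$ concentrates around its mean.

  Orthogonality of the discrete Fourier basis and absolute summability of the autocovariances (which the
  positivity of $f$ entails) identify the limit variances. Joint convergence follows from that of the
  characteristic functions.
\<close>

section \<open>Square integrable functions\<close>

text \<open>The frequencies move with \<open>n\<close>, so neither the weights nor the normalising
  densities need have a limit. Hence the weights enter the limit theorem only through a bound
  \<open>C / sqrt n\<close>, and the characteristic function of a sum is compared with that of the
  centred normal law of the same second moment; convergence of the second moments is a separate,
  purely trigonometric matter. There division by \<open>f\<close> cancels the dependence on the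
  frequency.

  Boundedness of the differences matters because the modulus of the product is at most
  \<open>exp (N * c^2 / 2)\<close>, which stays bounded when \<open>c\<close> has order
  \<open>n^(-1/2)\<close>. The positive minimum of \<open>f\<close> also supplies the bound on the
  normalised weights.

  In the last stage second moments take the role of tightness, and Stone-Weierstrass on a cube turns
  convergence of characteristic functions into convergence of expectations. The exponential limit
  arises because the normalised periodogram is half the squared modulus of the normalised transform,
  so its limit is half the squared norm of a standard normal pair.\<close>

definition sqint :: "'a measure \<Rightarrow> ('a \<Rightarrow> real) \<Rightarrow> bool" where
  "sqint M f \<longleftrightarrow> f \<in> borel_measurable M \<and> integrable M (\<lambda>x. (f x)\<^sup>2)"

lemma sqint_measurable: "sqint M f \<Longrightarrow> f \<in> borel_measurable M"
  by (simp add: sqint_def)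

lemma sqint_integrable_mult:
  assumes "sqint M f" "sqint M g"
  shows "integrable M (\<lambda>x. f x * g x)"
proof (rule Bochner_Integration.integrable_bound)
  show "integrable M (\<lambda>x. (f x)\<^sup>2 + (g x)\<^sup>2)" using assms by (auto simp: sqint_def)
  show "AE x in M. norm (f x * g x) \<le> norm ((f x)\<^sup>2 + (g x)\<^sup>2)"
  proof (intro AE_I2)
    fix x
    have "2 * (\<bar>f x\<bar> * \<bar>g x\<bar>) \<le> (f x)\<^sup>2 + (g x)\<^sup>2"
      using sum_squares_bound[of "\<bar>f x\<bar>" "\<bar>g x\<bar>"] by simp
    moreover have "0 \<le> \<bar>f x\<bar> * \<bar>g x\<bar>" by (rule mult_nonneg_nonneg) auto
    ultimately have "\<bar>f x\<bar> * \<bar>g x\<bar> \<le> (f x)\<^sup>2 + (g x)\<^sup>2" by linarith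
    then show "norm (f x * g x) \<le> norm ((f x)\<^sup>2 + (g x)\<^sup>2)" by (simp add: abs_mult)
  qed
  show "(\<lambda>x. f x * g x) \<in> borel_measurable M" using assms by (auto simp: sqint_def)
qed

lemma sqint_add:
  assumes "sqint M f" "sqint M g"
  shows "sqint M (\<lambda>x. f x + g x)"
  using assms sqint_integrable_mult[OF assms]
  by (auto simp: sqint_def power2_sum mult.assoc)

lemma sqint_scale: "sqint M f \<Longrightarrow> sqint M (\<lambda>x. c * f x)"
  by (auto simp: sqint_def power_mult_distrib)

lemma sqint_diff:
  assumes "sqint M f" "sqint M g"
  shows "sqint M (\<lambda>x. f x - g x)"
  using sqint_add[OF assms(1) sqint_scale[OF assms(2), of "-1"]] by simp

lemma sqint_sum: "(\<And>i. i \<in> I \<Longrightarrow> sqint M (f i)) \<Longrightarrow> sqint M (\<lambda>x. \<Sum>i\<in>I. f i x)"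
proof (induction I rule: infinite_finite_induct)
  case (insert i I)
  then show ?case by (simp add: sqint_add)
qed (auto simp: sqint_def)

lemma sqint_bounded:
  assumes "finite_measure M" "f \<in> borel_measurable M" "\<And>x. \<bar>f x\<bar> \<le> B"
  shows "sqint M f"
proof -
  interpret finite_measure M by fact
  have "integrable M (\<lambda>x. (f x)\<^sup>2)"
  proof (rule integrable_const_bound[where B="B\<^sup>2"])
    show "AE x in M. norm ((f x)\<^sup>2) \<le> B\<^sup>2"
      using assms(3) by (auto intro!: AE_I2 abs_le_square_iff[THEN iffD1] order_trans[OF assms(3) abs_ge_self])
  qed (use assms in auto)
  then show ?thesis using assms by (simp add: sqint_def)
qed

lemma sqint_integrable:
  assumes "finite_measure M" "sqint M f"
  shows "integrable M f"
proof -
  interpret finite_measure M by fact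
  have "sqint M (\<lambda>_. 1)" by (rule sqint_bounded[where B=1]) (auto intro: assms)
  from sqint_integrable_mult[OF assms(2) this] show ?thesis by simp
qed

section \<open>The L2 seminorm and its inequalities\<close>

lemma norm_L2_nonneg: "0 \<le> norm_L2 M f"
  by (simp add: norm_L2_def)

lemma norm_L2_sq: "(norm_L2 M f)\<^sup>2 = (\<integral>x. (f x)\<^sup>2 \<partial>M)"
  by (simp add: norm_L2_def)

lemma norm_L2_scale: "norm_L2 M (\<lambda>x. c * f x) = \<bar>c\<bar> * norm_L2 M f"
  by (simp add: norm_L2_def power_mult_distrib real_sqrt_mult)

lemma Cauchy_Schwarz_L2:
  assumes "sqint M f" "sqint M g"
  shows "\<bar>\<integral>x. f x * g x \<partial>M\<bar> \<le> norm_L2 M f * norm_L2 M g"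
proof -
  define a b c where "a = (\<integral>x. (f x)\<^sup>2 \<partial>M)" and "b = (\<integral>x. f x * g x \<partial>M)" and "c = (\<integral>x. (g x)\<^sup>2 \<partial>M)"
  have int: "integrable M (\<lambda>x. (f x)\<^sup>2)" "integrable M (\<lambda>x. (g x)\<^sup>2)" "integrable M (\<lambda>x. f x * g x)"
    using assms sqint_integrable_mult[OF assms] by (auto simp: sqint_def)
  have nn: "0 \<le> a" "0 \<le> c" unfolding a_def c_def by auto
  have q: "0 \<le> a * t\<^sup>2 + 2 * t * b * s + c * s\<^sup>2" for t s
  proof -
    have "0 \<le> (\<integral>x. (t * f x + s * g x)\<^sup>2 \<partial>M)" by simp
    also have "\<dots> = (\<integral>x. t\<^sup>2 * (f x)\<^sup>2 + (2 * t * s) * (f x * g x) + s\<^sup>2 * (g x)\<^sup>2 \<partial>M)"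
      by (intro Bochner_Integration.integral_cong) (auto simp: power2_eq_square algebra_simps)
    also have "\<dots> = t\<^sup>2 * a + (2 * t * s) * b + s\<^sup>2 * c"
      unfolding a_def b_def c_def using int by simp
    finally show ?thesis by (simp add: algebra_simps)
  qed
  have "b\<^sup>2 \<le> a * c"
  proof (cases "c = 0")
    case True
    have "b = 0"
    proof (rule ccontr)
      assume "b \<noteq> 0"
      \<comment> \<open>With \<open>c = 0\<close> the form is affine in \<open>s\<close>; this
        choice of \<open>s\<close> drives it below zero.\<close>
      have "0 \<le> a * 1\<^sup>2 + 2 * 1 * b * (- (a+1) / b) + c * (- (a+1) / b)\<^sup>2" by (rule q)
      also have "\<dots> = - a - 2" using \<open>b \<noteq> 0\<close> True by (simp add: field_simps)
      finally show False using nn by simp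
    qed
    then show ?thesis using True by simp
  next
    case False
    then have "c > 0" using nn by simp
    \<comment> \<open>The minimising direction, scaled by \<open>c\<close> to avoid a
      division.\<close>
    have "0 \<le> a * c\<^sup>2 + 2 * c * b * (-b) + c * (-b)\<^sup>2" by (rule q)
    also have "\<dots> = c * (a * c - b\<^sup>2)" by (simp add: power2_eq_square algebra_simps)
    finally show ?thesis using \<open>c > 0\<close> by (simp add: zero_le_mult_iff)
  qed
  then have "\<bar>b\<bar> \<le> sqrt (a * c)" by (simp add: real_le_rsqrt)
  then show ?thesis unfolding norm_L2_def a_def b_def c_def by (simp add: real_sqrt_mult)
qed

lemma norm_L2_triangle:
  assumes "sqint M f" "sqint M g"
  shows "norm_L2 M (\<lambda>x. f x + g x) \<le> norm_L2 M f + norm_L2 M g"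
proof (rule power2_le_imp_le)
  have int: "integrable M (\<lambda>x. (f x)\<^sup>2)" "integrable M (\<lambda>x. (g x)\<^sup>2)" "integrable M (\<lambda>x. f x * g x)"
    using assms sqint_integrable_mult[OF assms] by (auto simp: sqint_def)
  have "(norm_L2 M (\<lambda>x. f x + g x))\<^sup>2 = (\<integral>x. (f x)\<^sup>2 + (g x)\<^sup>2 + 2 * (f x * g x) \<partial>M)"
    unfolding norm_L2_sq by (intro Bochner_Integration.integral_cong) (auto simp: power2_sum)
  also have "\<dots> = (norm_L2 M f)\<^sup>2 + (norm_L2 M g)\<^sup>2 + 2 * (\<integral>x. f x * g x \<partial>M)"
    using int by (simp add: norm_L2_sq)
  also have "\<dots> \<le> (norm_L2 M f + norm_L2 M g)\<^sup>2"
    using Cauchy_Schwarz_L2[OF assms] by (simp add: power2_sum)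
  finally show "(norm_L2 M (\<lambda>x. f x + g x))\<^sup>2 \<le> (norm_L2 M f + norm_L2 M g)\<^sup>2" .
qed (simp add: norm_L2_nonneg)

lemma norm_L2_diff_triangle:
  assumes "sqint M f" "sqint M g"
  shows "norm_L2 M (\<lambda>x. f x - g x) \<le> norm_L2 M f + norm_L2 M g"
  using norm_L2_triangle[OF assms(1) sqint_scale[OF assms(2), of "-1"]] norm_L2_scale[of M "-1" g]
  by simp

lemma norm_L2_abs_diff:
  assumes "sqint M f" "sqint M g"
  shows "\<bar>norm_L2 M f - norm_L2 M g\<bar> \<le> norm_L2 M (\<lambda>x. f x - g x)"
proof -
  have "norm_L2 M (\<lambda>x. g x + (f x - g x)) \<le> norm_L2 M g + norm_L2 M (\<lambda>x. f x - g x)"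
    by (rule norm_L2_triangle[OF assms(2) sqint_diff[OF assms]])
  moreover have "norm_L2 M (\<lambda>x. f x - (f x - g x)) \<le> norm_L2 M f + norm_L2 M (\<lambda>x. f x - g x)"
    by (rule norm_L2_diff_triangle[OF assms(1) sqint_diff[OF assms]])
  ultimately show ?thesis by simp
qed

lemma norm_L2_sum_le:
  assumes "\<And>i. i \<in> I \<Longrightarrow> sqint M (f i)"
  shows "norm_L2 M (\<lambda>x. \<Sum>i\<in>I. f i x) \<le> (\<Sum>i\<in>I. norm_L2 M (f i))"
  using assms
proof (induction I rule: infinite_finite_induct)
  case (insert i I)
  have "norm_L2 M (\<lambda>x. \<Sum>i\<in>insert i I. f i x) = norm_L2 M (\<lambda>x. f i x + (\<Sum>i\<in>I. f i x))"
    using insert by simp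
  also have "\<dots> \<le> norm_L2 M (f i) + norm_L2 M (\<lambda>x. \<Sum>i\<in>I. f i x)"
    using insert by (intro norm_L2_triangle sqint_sum) auto
  finally show ?case using insert by simp
qed (auto simp: norm_L2_def)

lemma (in prob_space) integral_abs_le_norm_L2:
  assumes "sqint M f"
  shows "(\<integral>x. \<bar>f x\<bar> \<partial>M) \<le> norm_L2 M f"
proof -
  have "sqint M (\<lambda>x. \<bar>f x\<bar>)" using assms by (auto simp: sqint_def)
  moreover have "sqint M (\<lambda>x. 1)" by (rule sqint_bounded[where B=1]) (auto intro: finite_measure_axioms)
  ultimately have "\<bar>\<integral>x. \<bar>f x\<bar> * 1 \<partial>M\<bar> \<le> norm_L2 M (\<lambda>x. \<bar>f x\<bar>) * norm_L2 M (\<lambda>x. 1)"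
    by (rule Cauchy_Schwarz_L2)
  moreover have "norm_L2 M (\<lambda>x. 1) = 1" by (simp add: norm_L2_def prob_space)
  moreover have "norm_L2 M (\<lambda>x. \<bar>f x\<bar>) = norm_L2 M f" by (simp add: norm_L2_def)
  ultimately show ?thesis by simp
qed

section \<open>The one-sided shift\<close>

text \<open>With \<open>space M = UNIV\<close> every function on the naturals is a point of
  \<open>S\<close>, so dropping and prefixing coordinates need no side conditions.\<close>

locale one_sided_shift = sequence_space M for M :: "'b measure" +
  assumes space_UNIV: "space M = UNIV"
begin

definition tail :: "(nat \<Rightarrow> 'b) \<Rightarrow> nat \<Rightarrow> 'b" where
  "tail s = (\<lambda>i. s (Suc i))"

text \<open>
  If \<open>s\<close> is the past of the noise up to time \<open>k - 1\<close>, then \<open>avg g s\<close> integrates out the noise at time \<open>k\<close>: it is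
  the conditional expectation, given the past up to \<open>k - 1\<close>, of \<open>g\<close> applied to the past up to \<open>k\<close>.
\<close>

definition avg :: "((nat \<Rightarrow> 'b) \<Rightarrow> 'c) \<Rightarrow> (nat \<Rightarrow> 'b) \<Rightarrow> 'c::{banach, second_countable_topology}" where
  "avg g s = (\<integral>y. g (case_nat y s) \<partial>M)"

section \<open>Measurability, Fubini and stationarity for the shift\<close>

lemma space_S [simp]: "space S = UNIV"
  by (simp add: space_PiM space_UNIV)

lemma prob_S_UNIV [simp]: "measure S UNIV = 1"
  using P.prob_space by simp

lemma finite_measure_S: "finite_measure S"
  by (rule P.finite_measure_axioms)

lemma tail_measurable [measurable]: "tail \<in> S \<rightarrow>\<^sub>M S"
  unfolding tail_def by (rule measurable_PiM_single') (auto simp: space_UNIV)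

lemma funpow_tail: "(tail ^^ k) s = (\<lambda>i. s (i + k))"
  by (induction k arbitrary: s) (auto simp: tail_def)

lemma funpow_tail_measurable [measurable]: "(tail ^^ k) \<in> S \<rightarrow>\<^sub>M S"
  by (induction k) (auto intro: measurable_comp[OF _ tail_measurable] simp: id_def)

lemma tail_case_nat [simp]: "tail (case_nat y s) = s"
  by (simp add: tail_def)

lemma case_nat_S [measurable]: "(\<lambda>p. case_nat (fst p) (snd p)) \<in> M \<Otimes>\<^sub>M S \<rightarrow>\<^sub>M S"
  by measurable

lemma case_nat_S' [measurable]: "(\<lambda>p. case_nat (snd p) (fst p)) \<in> S \<Otimes>\<^sub>M M \<rightarrow>\<^sub>M S"
  by measurable

lemma case_nat_left_measurable [measurable]: "(\<lambda>y. case_nat y s) \<in> M \<rightarrow>\<^sub>M S"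
  by (rule measurable_PiM_single') (auto simp: space_UNIV split: nat.split)

lemma avg_measurable [measurable]:
  assumes [measurable]: "g \<in> borel_measurable S"
  shows "avg g \<in> borel_measurable S"
proof -
  have "(\<lambda>p. g (case_nat (snd p) (fst p))) \<in> borel_measurable (S \<Otimes>\<^sub>M M)"
    by measurable
  then have "case_prod (\<lambda>s y. g (case_nat y s)) \<in> borel_measurable (S \<Otimes>\<^sub>M M)"
    by (simp add: case_prod_beta')
  from M.borel_measurable_lebesgue_integral[OF this] show ?thesis
    by (simp add: avg_def[abs_def])
qed

text \<open>Prefixing a fresh coordinate carries the product of \<open>M\<close> and
  \<open>S\<close> to \<open>S\<close> (\<open>PiM_iter\<close>); all three claims are then Fubini's
  theorem.\<close>

lemma
  fixes g :: "(nat \<Rightarrow> 'b) \<Rightarrow> 'c::{banach, second_countable_topology}"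
  assumes g: "integrable S g"
  shows avg_integrable: "integrable S (avg g)"
    and integral_avg: "(\<integral>s. avg g s \<partial>S) = (\<integral>s. g s \<partial>S)"
    and AE_integrable_avg: "AE s in S. integrable M (\<lambda>y. g (case_nat y s))"
proof -
  have [measurable]: "g \<in> borel_measurable S" using g by simp
  interpret SM: pair_sigma_finite S M ..
  interpret MS: pair_sigma_finite M S ..
  have d: "distr (M \<Otimes>\<^sub>M S) S (\<lambda>p. case_nat (fst p) (snd p)) = S"
    using PiM_iter by (simp add: case_prod_beta')
  have "integrable (distr (M \<Otimes>\<^sub>M S) S (\<lambda>p. case_nat (fst p) (snd p))) g"
    using g by (simp add: d)
  then have i1: "integrable (M \<Otimes>\<^sub>M S) (\<lambda>p. g (case_nat (fst p) (snd p)))"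
    by (subst (asm) integrable_distr_eq) simp_all
  then have i2: "integrable (S \<Otimes>\<^sub>M M) (\<lambda>p. g (case_nat (snd p) (fst p)))"
    using MS.integrable_product_swap[OF i1] by (simp add: case_prod_beta')
  show "integrable S (avg g)"
    using SM.integrable_fst'[OF i2] by (simp add: avg_def[abs_def])
  show "AE s in S. integrable M (\<lambda>y. g (case_nat y s))"
    using SM.AE_integrable_fst'[OF i2] by simp
  have "(\<integral>s. avg g s \<partial>S) = (\<integral>p. g (case_nat (snd p) (fst p)) \<partial>(S \<Otimes>\<^sub>M M))"
    using SM.integral_fst'[OF i2] by (simp add: avg_def[abs_def])
  also have "\<dots> = (\<integral>p. g (case_nat (fst p) (snd p)) \<partial>(M \<Otimes>\<^sub>M S))"
    using MS.integral_product_swap[of "\<lambda>p. g (case_nat (fst p) (snd p))"] by (simp add: case_prod_beta')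
  also have "\<dots> = (\<integral>s. g s \<partial>(distr (M \<Otimes>\<^sub>M S) S (\<lambda>p. case_nat (fst p) (snd p))))"
    by (subst integral_distr) simp_all
  finally show "(\<integral>s. avg g s \<partial>S) = (\<integral>s. g s \<partial>S)" by (simp add: d)
qed

text \<open>Stationarity: \<open>tail\<close> undoes the prefixing and leaves the second projection
  of the product of \<open>M\<close> and \<open>S\<close>.\<close>

lemma distr_tail: "distr S S tail = S"
proof -
  have d: "distr (M \<Otimes>\<^sub>M S) S (\<lambda>p. case_nat (fst p) (snd p)) = S"
    using PiM_iter by (simp add: case_prod_beta')
  have "distr S S tail = distr (distr (M \<Otimes>\<^sub>M S) S (\<lambda>p. case_nat (fst p) (snd p))) S tail"
    by (simp add: d)
  also have "\<dots> = distr (M \<Otimes>\<^sub>M S) S snd"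
    by (subst distr_distr) (auto simp: comp_def)
  also have "\<dots> = S"
  proof (rule measure_eqI)
    fix A assume "A \<in> sets (distr (M \<Otimes>\<^sub>M S) S snd)"
    then have A: "A \<in> sets S" by simp
    have "snd -` A \<inter> space (M \<Otimes>\<^sub>M S) = space M \<times> A"
      using sets.sets_into_space[OF A] by (auto simp: space_pair_measure space_UNIV)
    then show "emeasure (distr (M \<Otimes>\<^sub>M S) S snd) A = emeasure S A"
      using A by (simp add: emeasure_distr P.emeasure_pair_measure_Times M.emeasure_space_1)
  qed simp
  finally show ?thesis .
qed

lemma distr_funpow_tail: "distr S S (tail ^^ k) = S"
proof (induction k)
  case (Suc k)
  have "distr S S (tail ^^ Suc k) = distr (distr S S (tail ^^ k)) S tail"
    by (subst distr_distr) simp_all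
  then show ?case using Suc distr_tail by (simp add: comp_def)
qed (simp add: distr_id2)

lemma integral_funpow_tail:
  fixes g :: "(nat \<Rightarrow> 'b) \<Rightarrow> 'c::{banach, second_countable_topology}"
  assumes "g \<in> borel_measurable S"
  shows "(\<integral>s. g ((tail ^^ k) s) \<partial>S) = (\<integral>s. g s \<partial>S)"
  using integral_distr[of "tail ^^ k" S S g] assms distr_funpow_tail[of k] by simp

lemma integrable_funpow_tail:
  fixes g :: "(nat \<Rightarrow> 'b) \<Rightarrow> 'c::{banach, second_countable_topology}"
  assumes "integrable S g"
  shows "integrable S (\<lambda>s. g ((tail ^^ k) s))"
  using integrable_distr_eq[of "tail ^^ k" S S g] assms distr_funpow_tail[of k] by simp

lemma sqint_funpow_tail:
  assumes "sqint S g"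
  shows "sqint S (\<lambda>s. g ((tail ^^ k) s))"
  using assms integrable_funpow_tail[of "\<lambda>s. (g s)\<^sup>2" k] measurable_compose[OF funpow_tail_measurable, of g borel k]
  by (auto simp: sqint_def)

lemma norm_L2_funpow_tail:
  assumes "g \<in> borel_measurable S"
  shows "norm_L2 S (\<lambda>s. g ((tail ^^ k) s)) = norm_L2 S g"
proof -
  have [measurable]: "g \<in> borel_measurable S" by fact
  show ?thesis
    unfolding norm_L2_def by (subst integral_funpow_tail[of "\<lambda>s. \<bar>g s\<bar>\<^sup>2"]) simp_all
qed

text \<open>The factor \<open>h (tail s)\<close> does not see the coordinate that is integrated.
  Scalars leave the Bochner integral even when it is 0 by convention, so this pull-out rule holds
  everywhere and without integrability.\<close>

lemma avg_mult_tail: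
  fixes g h :: "(nat \<Rightarrow> 'b) \<Rightarrow> 'c::{real_normed_field, banach, second_countable_topology}"
  shows "avg (\<lambda>s. g s * h (tail s)) s = avg g s * h s"
  by (simp add: avg_def)

text \<open>For almost every \<open>s\<close> the section is square integrable and its variance is
  nonnegative, which is Jensen's inequality for the square.\<close>

lemma sqint_avg:
  assumes "sqint S g"
  shows "sqint S (avg g)" and "norm_L2 S (avg g) \<le> norm_L2 S g"
proof -
  have [measurable]: "g \<in> borel_measurable S" using assms by (simp add: sqint_def)
  have i2: "integrable S (\<lambda>s. (g s)\<^sup>2)" using assms by (simp add: sqint_def)
  have i1: "integrable S g" by (rule sqint_integrable[OF finite_measure_S assms])
  have le: "AE s in S. (avg g s)\<^sup>2 \<le> avg (\<lambda>s. (g s)\<^sup>2) s"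
    using AE_integrable_avg[OF i1] AE_integrable_avg[OF i2]
  proof eventually_elim
    case (elim s)
    then have "0 \<le> M.variance (\<lambda>y. g (case_nat y s))" by (intro M.variance_positive)
    also have "\<dots> = avg (\<lambda>s. (g s)\<^sup>2) s - (avg g s)\<^sup>2"
      using elim by (subst M.variance_eq) (simp_all add: avg_def)
    finally show ?case by simp
  qed
  have "integrable S (\<lambda>s. (avg g s)\<^sup>2)"
    by (rule Bochner_Integration.integrable_bound[OF avg_integrable[OF i2]]) (use le in \<open>auto elim: eventually_mono\<close>)
  then show *: "sqint S (avg g)" by (simp add: sqint_def)
  have "(\<integral>s. (avg g s)\<^sup>2 \<partial>S) \<le> (\<integral>s. avg (\<lambda>s. (g s)\<^sup>2) s \<partial>S)"
    using * by (intro integral_mono_AE avg_integrable i2 le) (auto simp: sqint_def)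
  then show "norm_L2 S (avg g) \<le> norm_L2 S g"
    by (simp add: norm_L2_def integral_avg[OF i2])
qed

lemma sqint_funpow_avg:
  assumes "sqint S g"
  shows "sqint S ((avg ^^ k) g)" and "norm_L2 S ((avg ^^ k) g) \<le> norm_L2 S g"
  using assms
proof (induction k)
  case (Suc k)
  { case 1 then show ?case using Suc sqint_avg(1) by simp }
  { case 2 then show ?case using Suc sqint_avg(2)[OF Suc.IH(1)] by force }
qed auto

lemma integral_funpow_avg:
  fixes g :: "(nat \<Rightarrow> 'b) \<Rightarrow> 'c::{banach, second_countable_topology}"
  assumes "integrable S g"
  shows "integrable S ((avg ^^ k) g) \<and> (\<integral>s. (avg ^^ k) g s \<partial>S) = (\<integral>s. g s \<partial>S)"
  by (induction k) (auto simp: assms avg_integrable integral_avg)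

lemma funpow_avg_mult_tail:
  fixes g h :: "(nat \<Rightarrow> 'b) \<Rightarrow> 'c::{real_normed_field, banach, second_countable_topology}"
  shows "(avg ^^ k) (\<lambda>s. g s * h ((tail ^^ k) s)) = (\<lambda>s. (avg ^^ k) g s * h s)"
proof (induction k arbitrary: g h)
  case (Suc k)
  have "(avg ^^ Suc k) (\<lambda>s. g s * h ((tail ^^ Suc k) s)) = avg ((avg ^^ k) (\<lambda>s. g s * h (tail ((tail ^^ k) s))))"
    by simp
  also have "(avg ^^ k) (\<lambda>s. g s * h (tail ((tail ^^ k) s))) = (\<lambda>s. (avg ^^ k) g s * h (tail s))"
    using Suc[of g "\<lambda>s. h (tail s)"] by simp
  also have "avg \<dots> = (\<lambda>s. (avg ^^ Suc k) g s * h s)"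
    by (simp add: avg_mult_tail fun_eq_iff)
  finally show ?case .
qed simp

text \<open>On L2 the operator \<open>avg ^^ k\<close> is the adjoint of composition with
  \<open>tail ^^ k\<close>: pull out the shifted factor, then use that averaging preserves the
  integral.\<close>

lemma integral_mult_funpow_tail:
  assumes "sqint S g" "sqint S h"
  shows "(\<integral>s. g s * h ((tail ^^ k) s) \<partial>S) = (\<integral>s. (avg ^^ k) g s * h s \<partial>S)"
proof -
  have "integrable S (\<lambda>s. g s * h ((tail ^^ k) s))"
    by (rule sqint_integrable_mult[OF assms(1) sqint_funpow_tail[OF assms(2)]])
  from integral_funpow_avg[OF this, of k] show ?thesis
    by (simp add: funpow_avg_mult_tail)
qed


section \<open>Functions of finitely many coordinates\<close>

definition depends_upto :: "nat \<Rightarrow> ((nat \<Rightarrow> 'b) \<Rightarrow> 'c) \<Rightarrow> bool" where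
  "depends_upto m f \<longleftrightarrow> (\<forall>s s'. (\<forall>i<m. s i = s' i) \<longrightarrow> f s = f s')"

lemma depends_uptoD: "depends_upto m f \<Longrightarrow> (\<And>i. i < m \<Longrightarrow> s i = s' i) \<Longrightarrow> f s = f s'"
  by (auto simp: depends_upto_def)

lemma depends_upto_mono: "depends_upto m f \<Longrightarrow> m \<le> n \<Longrightarrow> depends_upto n f"
  by (auto simp: depends_upto_def)

lemma depends_upto_const: "depends_upto m (\<lambda>_. c)"
  by (simp add: depends_upto_def)

lemma depends_upto_comp2:
  assumes "depends_upto m f" "depends_upto n g"
  shows "depends_upto (max m n) (\<lambda>s. h (f s) (g s))"
  using depends_uptoD[OF assms(1)] depends_uptoD[OF assms(2)] unfolding depends_upto_def
  by (metis less_max_iff_disj)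

lemma depends_upto_comp: "depends_upto m f \<Longrightarrow> depends_upto m (\<lambda>s. h (f s))"
  unfolding depends_upto_def by metis

lemma depends_upto_sum:
  "(\<And>i. i \<in> I \<Longrightarrow> depends_upto m (f i)) \<Longrightarrow> depends_upto m (\<lambda>s. \<Sum>i\<in>I. f i s)"
  unfolding depends_upto_def by (auto intro!: sum.cong)

lemma depends_upto_tail:
  assumes "depends_upto m f"
  shows "depends_upto (Suc m) (\<lambda>s. f (tail s))"
  unfolding depends_upto_def by (auto simp: tail_def intro!: depends_uptoD[OF assms])

text \<open>Averaging integrates out coordinate 0 and moves the others down by one; truncated
  subtraction covers \<open>m = 0\<close>.\<close>

lemma depends_upto_avg:
  assumes "depends_upto m f"
  shows "depends_upto (m - 1) (avg f)"
  unfolding depends_upto_def avg_def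
proof (intro allI impI Bochner_Integration.integral_cong refl)
  fix s s' y assume "\<forall>i<m - 1. s i = (s' i :: 'b)"
  then show "f (case_nat y s) = f (case_nat y s')"
    by (intro depends_uptoD[OF assms]) (auto split: nat.split)
qed

lemma depends_upto_funpow_avg:
  assumes "depends_upto m f"
  shows "depends_upto (m - k) ((avg ^^ k) f)"
proof (induction k)
  case (Suc k)
  from depends_upto_avg[OF this] show ?case by simp
qed (use assms in auto)

text \<open>After \<open>m\<close> averagings no coordinate is left, and a constant equals its
  integral, which averaging preserves. In this form independence of distant noise enters the decay
  of conditional expectations and the variance bound.\<close>

lemma funpow_avg_eq_integral:
  fixes f :: "(nat \<Rightarrow> 'b) \<Rightarrow> 'c::{banach, second_countable_topology}"
  assumes "depends_upto m f" "m \<le> k" "integrable S f"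
  shows "(avg ^^ k) f s = (\<integral>s. f s \<partial>S)"
proof -
  have "depends_upto 0 ((avg ^^ k) f)"
    using depends_upto_funpow_avg[OF assms(1), of k] assms(2) by simp
  then have c: "(avg ^^ k) f s' = (avg ^^ k) f s" for s'
    by (auto simp: depends_upto_def)
  have "(\<integral>s. f s \<partial>S) = (\<integral>s'. (avg ^^ k) f s' \<partial>S)"
    using integral_funpow_avg[OF assms(3)] by simp
  also have "\<dots> = (\<integral>s'. (avg ^^ k) f s \<partial>S)"
    using c by (intro Bochner_Integration.integral_cong) auto
  finally show ?thesis using P.prob_space by simp
qed

lemma bounded_avg:
  assumes g: "g \<in> borel_measurable S" and "\<And>s. \<bar>g s\<bar> \<le> (B::real)"
  shows "\<bar>avg g s\<bar> \<le> B"
proof -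
  have [measurable]: "g \<in> borel_measurable S" by fact
  have i: "integrable M (\<lambda>y. g (case_nat y s))"
    by (rule M.integrable_const_bound[where B=B]) (use assms(2) in auto)
  have "\<bar>avg g s\<bar> \<le> (\<integral>y. \<bar>g (case_nat y s)\<bar> \<partial>M)"
    unfolding avg_def by (rule integral_abs_bound)
  also have "\<dots> \<le> (\<integral>y. B \<partial>M)"
    using i assms(2) by (intro integral_mono) auto
  finally show ?thesis by (simp add: M.prob_space)
qed

section \<open>Density of bounded cylinder functions in L2\<close>

abbreviation cylinder_within :: "real \<Rightarrow> ((nat \<Rightarrow> 'b) \<Rightarrow> real) \<Rightarrow> bool" where
  "cylinder_within \<delta> g \<equiv> \<exists>g' m B. g' \<in> borel_measurable S \<and> (\<forall>s. \<bar>g' s\<bar> \<le> B) \<and>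
     depends_upto m g' \<and> norm_L2 S (\<lambda>s. g s - g' s) < \<delta>"

text \<open>Membership in the L2 closure of the bounded functions of finitely many
  coordinates.\<close>

definition cylinder_approx :: "((nat \<Rightarrow> 'b) \<Rightarrow> real) \<Rightarrow> bool" where
  "cylinder_approx g \<longleftrightarrow> sqint S g \<and> (\<forall>\<delta>>0. cylinder_within \<delta> g)"

lemma cylinder_approxI:
  assumes "sqint S g"
  assumes "\<And>\<delta>. \<delta> > 0 \<Longrightarrow> cylinder_within \<delta> g"
  shows "cylinder_approx g"
  unfolding cylinder_approx_def by (intro conjI allI impI assms)

lemma cylinder_approxE:
  assumes "cylinder_approx g" "\<delta> > 0"
  obtains g' B m where "g' \<in> borel_measurable S" "\<forall>s. \<bar>g' s\<bar> \<le> B" "depends_upto m g'"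
    "norm_L2 S (\<lambda>s. g s - g' s) < \<delta>"
proof -
  have "cylinder_within \<delta> g"
    using assms unfolding cylinder_approx_def by simp
  then show thesis by (elim exE conjE) (rule that)
qed

lemma cylinder_approx_depends:
  assumes "g \<in> borel_measurable S" "\<And>s. \<bar>g s\<bar> \<le> B" "depends_upto m g"
  shows "cylinder_approx g"
proof (rule cylinder_approxI)
  show "sqint S g" by (rule sqint_bounded[OF finite_measure_S assms(1,2)])
  fix \<delta> :: real assume "\<delta> > 0"
  then have "g \<in> borel_measurable S \<and> (\<forall>s. \<bar>g s\<bar> \<le> B) \<and>
     depends_upto m g \<and> norm_L2 S (\<lambda>s. g s - g s) < \<delta>" using assms by (simp add: norm_L2_def)
  then show "cylinder_within \<delta> g" by (intro exI)
qed

lemma cylinder_approx_scale: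
  assumes "cylinder_approx g"
  shows "cylinder_approx (\<lambda>s. c * g s)"
proof (rule cylinder_approxI)
  show "sqint S (\<lambda>s. c * g s)" using assms by (auto simp: cylinder_approx_def sqint_scale)
  fix \<delta> :: real assume "\<delta> > 0"
  then have "\<delta> / (\<bar>c\<bar> + 1) > 0" by simp
  then obtain g' m B where g': "g' \<in> borel_measurable S" "\<forall>s. \<bar>g' s\<bar> \<le> B" "depends_upto m g'"
    "norm_L2 S (\<lambda>s. g s - g' s) < \<delta> / (\<bar>c\<bar> + 1)"
    by (rule cylinder_approxE[OF assms])
  note g' = g'(1) g'(2)[rule_format] g'(3,4)
  have "norm_L2 S (\<lambda>s. c * g s - c * g' s) = \<bar>c\<bar> * norm_L2 S (\<lambda>s. g s - g' s)"
    using norm_L2_scale[of S c "\<lambda>s. g s - g' s"] by (simp add: right_diff_distrib)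
  also have "\<dots> \<le> (\<bar>c\<bar> + 1) * norm_L2 S (\<lambda>s. g s - g' s)"
    by (intro mult_right_mono) (auto simp: norm_L2_nonneg)
  also have "\<dots> < \<delta>" using g'(4) by (simp add: field_simps)
  finally have "norm_L2 S (\<lambda>s. c * g s - c * g' s) < \<delta>" .
  moreover have "\<bar>c * g' s\<bar> \<le> \<bar>c\<bar> * B" for s
    unfolding abs_mult by (rule mult_left_mono) (simp_all add: g'(2))
  moreover have "depends_upto m (\<lambda>s. c * g' s)" by (rule depends_upto_comp[OF g'(3)])
  moreover have "(\<lambda>s. c * g' s) \<in> borel_measurable S" using g'(1) by measurable
  ultimately show "cylinder_within \<delta> (\<lambda>s. c * g s)"
    by (intro exI[of _ "\<lambda>s. c * g' s"] exI[of _ m] exI[of _ "\<bar>c\<bar> * B"] conjI allI)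
qed

text \<open>Lipschitz operations carry approximations of the arguments to an approximation of the
  result. The instances are \<open>+\<close>, for linear combinations, and \<open>max\<close>, for
  unions of sets.\<close>

lemma cylinder_approx_lipschitz:
  fixes h :: "real \<Rightarrow> real \<Rightarrow> real"
  assumes "cylinder_approx f" "cylinder_approx g"
    and h: "\<And>a b a' b'. \<bar>h a b - h a' b'\<bar> \<le> \<bar>a - a'\<bar> + \<bar>b - b'\<bar>"
    and meas: "\<And>a b. a \<in> borel_measurable S \<Longrightarrow> b \<in> borel_measurable S \<Longrightarrow> (\<lambda>s. h (a s) (b s)) \<in> borel_measurable S"
    and h0: "h 0 0 = 0"
  shows "cylinder_approx (\<lambda>s. h (f s) (g s))"
proof (rule cylinder_approxI)
  have fg: "sqint S f" "sqint S g" using assms by (auto simp: cylinder_approx_def)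
  note [measurable] = fg[THEN sqint_measurable]
  \<comment> \<open>Used twice: with \<open>h 0 0 = 0\<close> for square integrability of the
    combination, and for the error of the approximants.\<close>
  have *: "sqint S u \<and> norm_L2 S u \<le> norm_L2 S a + norm_L2 S b"
    if ab: "sqint S a" "sqint S b" and le: "\<And>s. \<bar>u s\<bar> \<le> \<bar>a s\<bar> + \<bar>b s\<bar>" and u[measurable]: "u \<in> borel_measurable S" for a b u
  proof -
    have ab': "sqint S (\<lambda>s. \<bar>a s\<bar>)" "sqint S (\<lambda>s. \<bar>b s\<bar>)" using ab by (auto simp: sqint_def)
    have sq: "(u s)\<^sup>2 \<le> (\<bar>a s\<bar> + \<bar>b s\<bar>)\<^sup>2" for s
      using le[of s] by (intro abs_le_square_iff[THEN iffD1]) simp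
    have i: "integrable S (\<lambda>s. (\<bar>a s\<bar> + \<bar>b s\<bar>)\<^sup>2)" using sqint_add[OF ab'] by (simp add: sqint_def)
    have "integrable S (\<lambda>s. (u s)\<^sup>2)"
      by (rule Bochner_Integration.integrable_bound[OF i]) (use sq in auto)
    then have u2: "sqint S u" by (simp add: sqint_def)
    have "norm_L2 S u \<le> norm_L2 S (\<lambda>s. \<bar>a s\<bar> + \<bar>b s\<bar>)"
      unfolding norm_L2_def using u2 i sq
      by (intro real_sqrt_le_mono integral_mono) (simp_all add: sqint_def)
    also have "\<dots> \<le> norm_L2 S (\<lambda>s. \<bar>a s\<bar>) + norm_L2 S (\<lambda>s. \<bar>b s\<bar>)" by (rule norm_L2_triangle[OF ab'])
    finally show ?thesis using u2 by (simp add: norm_L2_def)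
  qed
  have le0: "\<bar>h a b\<bar> \<le> \<bar>a\<bar> + \<bar>b\<bar>" for a b using h[of a b 0 0] h0 by simp
  show "sqint S (\<lambda>s. h (f s) (g s))"
    by (rule *[OF fg le0, THEN conjunct1]) (rule meas, simp_all)
  fix \<delta> :: real assume "\<delta> > 0"
  then have d: "\<delta> / 2 > 0" by simp
  obtain f' m B where f': "f' \<in> borel_measurable S" "\<forall>s. \<bar>f' s\<bar> \<le> B" "depends_upto m f'"
    "norm_L2 S (\<lambda>s. f s - f' s) < \<delta> / 2" by (rule cylinder_approxE[OF assms(1) d])
  note f' = f'(1) f'(2)[rule_format] f'(3,4)
  obtain g' n B' where g': "g' \<in> borel_measurable S" "\<forall>s. \<bar>g' s\<bar> \<le> B'" "depends_upto n g'"
    "norm_L2 S (\<lambda>s. g s - g' s) < \<delta> / 2" by (rule cylinder_approxE[OF assms(2) d])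
  note g' = g'(1) g'(2)[rule_format] g'(3,4)
  have [measurable]: "(\<lambda>s. h (f s) (g s)) \<in> borel_measurable S" "(\<lambda>s. h (f' s) (g' s)) \<in> borel_measurable S"
    using f' g' by (auto intro!: meas)
  have "norm_L2 S (\<lambda>s. h (f s) (g s) - h (f' s) (g' s)) \<le> norm_L2 S (\<lambda>s. f s - f' s) + norm_L2 S (\<lambda>s. g s - g' s)"
    by (intro *[THEN conjunct2] sqint_diff fg h sqint_bounded[OF finite_measure_S f'(1,2)]
        sqint_bounded[OF finite_measure_S g'(1,2)]) simp
  also have "\<dots> < \<delta>" using f' g' by simp
  finally have "norm_L2 S (\<lambda>s. h (f s) (g s) - h (f' s) (g' s)) < \<delta>" .
  moreover have "\<bar>h (f' s) (g' s)\<bar> \<le> B + B'" for s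
    using le0[of "f' s" "g' s"] f'(2)[of s] g'(2)[of s] by linarith
  ultimately show "cylinder_within \<delta> (\<lambda>s. h (f s) (g s))"
    using depends_upto_comp2[OF f'(3) g'(3), of h] \<open>(\<lambda>s. h (f' s) (g' s)) \<in> borel_measurable S\<close>
    by (intro exI[of _ "\<lambda>s. h (f' s) (g' s)"] exI[of _ "max m n"] exI[of _ "B + B'"] conjI allI)
qed

lemma cylinder_approx_add:
  assumes "cylinder_approx f" "cylinder_approx g"
  shows "cylinder_approx (\<lambda>s. f s + g s)"
  by (rule cylinder_approx_lipschitz[OF assms, of "(+)"]) auto

lemma cylinder_approx_max:
  assumes "cylinder_approx f" "cylinder_approx g"
  shows "cylinder_approx (\<lambda>s. max (f s) (g s))"
  by (rule cylinder_approx_lipschitz[OF assms, of max]) auto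

lemma cylinder_approx_sum:
  assumes "finite I" "\<And>i. i \<in> I \<Longrightarrow> cylinder_approx (f i)"
  shows "cylinder_approx (\<lambda>s. \<Sum>i\<in>I. f i s)"
  using assms
proof (induction I)
  case empty
  then show ?case by (auto intro: cylinder_approx_depends[of _ 0 0] depends_upto_const)
next
  case (insert i I)
  then show ?case by (auto intro: cylinder_approx_add)
qed

text \<open>Dominated convergence turns the pointwise limit into an L2 limit, and a closure is
  closed. The factor 2 is the one that \<open>borel_measurable_implies_sequence_metric\<close>
  supplies for simple functions.\<close>

lemma cylinder_approx_limit:
  assumes g: "sqint S g" and u: "\<And>n. cylinder_approx (u n)"
    and lim: "\<And>s. (\<lambda>n. u n s) \<longlonglongrightarrow> g s" and bd: "\<And>n s. \<bar>u n s\<bar> \<le> 2 * \<bar>g s\<bar>"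
  shows "cylinder_approx g"
proof (rule cylinder_approxI[OF g])
  have us: "sqint S (u n)" for n using u by (auto simp: cylinder_approx_def)
  have [measurable]: "g \<in> borel_measurable S" "\<And>n. u n \<in> borel_measurable S"
    using g us by (auto simp: sqint_def)
  \<comment> \<open>The constant 9 is \<open>(1 + 2)^2\<close>, from
    \<open>\<bar>u n s\<bar> \<le> 2 * \<bar>g s\<bar>\<close>.\<close>
  have "(\<lambda>n. \<integral>s. (g s - u n s)\<^sup>2 \<partial>S) \<longlonglongrightarrow> (\<integral>s. 0 \<partial>S)"
  proof (rule integral_dominated_convergence[where w="\<lambda>s. 9 * (g s)\<^sup>2"])
    show "integrable S (\<lambda>s. 9 * (g s)\<^sup>2)" using g by (simp add: sqint_def)
    show "AE s in S. (\<lambda>n. (g s - u n s)\<^sup>2) \<longlonglongrightarrow> 0"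
    proof (intro AE_I2)
      fix s
      have "(\<lambda>n. (g s - u n s)\<^sup>2) \<longlonglongrightarrow> (g s - g s)\<^sup>2" by (intro tendsto_intros lim)
      then show "(\<lambda>n. (g s - u n s)\<^sup>2) \<longlonglongrightarrow> 0" by simp
    qed
    show "AE s in S. norm ((g s - u n s)\<^sup>2) \<le> 9 * (g s)\<^sup>2" for n
    proof (intro AE_I2)
      fix s
      have "\<bar>g s - u n s\<bar> \<le> \<bar>3 * g s\<bar>" using bd[of n s] by (auto simp: abs_mult)
      then show "norm ((g s - u n s)\<^sup>2) \<le> 9 * (g s)\<^sup>2" unfolding abs_le_square_iff by (simp add: power_mult_distrib)
    qed
  qed auto
  then have "(\<lambda>n. norm_L2 S (\<lambda>s. g s - u n s)) \<longlonglongrightarrow> 0"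
    unfolding norm_L2_def using tendsto_real_sqrt by fastforce
  fix \<delta> :: real assume "\<delta> > 0"
  then have d: "\<delta> / 2 > 0" by simp
  obtain n where n: "norm_L2 S (\<lambda>s. g s - u n s) < \<delta> / 2"
    using order_tendstoD(2)[OF \<open>(\<lambda>n. norm_L2 S (\<lambda>s. g s - u n s)) \<longlonglongrightarrow> 0\<close> d] by (auto simp: eventually_sequentially)
  obtain f' m B where f': "f' \<in> borel_measurable S" "\<forall>s. \<bar>f' s\<bar> \<le> B" "depends_upto m f'"
    "norm_L2 S (\<lambda>s. u n s - f' s) < \<delta> / 2" by (rule cylinder_approxE[OF u[of n] d])
  note f' = f'(1) f'(2)[rule_format] f'(3,4)
  have "norm_L2 S (\<lambda>s. (g s - u n s) + (u n s - f' s)) \<le> norm_L2 S (\<lambda>s. g s - u n s) + norm_L2 S (\<lambda>s. u n s - f' s)"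
    using f' by (intro norm_L2_triangle sqint_diff us g sqint_bounded[OF finite_measure_S f'(1,2)])
  then have "norm_L2 S (\<lambda>s. g s - f' s) < \<delta>" using n f'(4) by simp
  then show "cylinder_within \<delta> g"
    using f' by (intro exI[of _ f'] exI[of _ m] exI[of _ B] conjI allI)
qed

text \<open>Induction over the generated sigma-algebra: generators look at a single coordinate, a
  complement is \<open>1\<close> minus the indicator, and a countable union is a dominated limit of
  finite unions, whose indicators are maxima.\<close>

lemma cylinder_approx_indicator:
  assumes "A \<in> sets S"
  shows "cylinder_approx (indicator A)"
proof -
  have "A \<in> sigma_sets (\<Pi>\<^sub>E i\<in>UNIV. space M) {{f\<in>\<Pi>\<^sub>E i\<in>UNIV. space M. f i \<in> A} | i A. i \<in> UNIV \<and> A \<in> sets M}"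
    using assms unfolding sets_PiM_single by simp
  then show ?thesis
  proof induction
    case (Basic a)
    then obtain i A where a: "a = {f. f i \<in> A}" "A \<in> sets M" by (auto simp: space_UNIV)
    have [measurable]: "A \<in> sets M" by fact
    have "a = (\<lambda>s. s i) -` A \<inter> space S" using a by auto
    also have "\<dots> \<in> sets S" by measurable
    finally have [measurable]: "a \<in> sets S" .
    show ?case
      by (rule cylinder_approx_depends[of _ 1 "Suc i"])
         (auto simp: depends_upto_def a split: split_indicator)
  next
    case Empty
    then show ?case by (auto intro: cylinder_approx_depends[of _ 0 0] depends_upto_const)
  next
    case (Compl a)
    have "cylinder_approx (\<lambda>s. 1 + (-1) * indicat_real a s)"
      by (intro cylinder_approx_add cylinder_approx_scale Compl) (auto intro: cylinder_approx_depends[of _ 1 0] depends_upto_const)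
    also have "(\<lambda>s. 1 + (-1) * indicat_real a s) = indicator ((\<Pi>\<^sub>E i\<in>UNIV. space M) - a)"
      by (auto simp: fun_eq_iff space_UNIV split: split_indicator)
    finally show ?case .
  next
    case (Union a)
    have fin: "cylinder_approx (indicator (\<Union>i<n. a i))" for n :: nat
    proof (induction n)
      case 0
      then show ?case by (auto intro: cylinder_approx_depends[of _ 0 0] depends_upto_const)
    next
      case (Suc n)
      have "cylinder_approx (\<lambda>s. max (indicator (\<Union>i<n. a i) s) (indicator (a n) s))"
        by (intro cylinder_approx_max Suc Union)
      also have "(\<lambda>s. max (indicator (\<Union>i<n. a i) s) (indicator (a n) s)) = (indicator (\<Union>i<Suc n. a i) :: _ \<Rightarrow> real)"
        by (auto simp: fun_eq_iff less_Suc_eq split: split_indicator)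
      finally show ?case .
    qed
    have [measurable]: "\<And>i. a i \<in> sets S"
      using Union(1) unfolding sets_PiM_single by simp
    show ?case
    proof (rule cylinder_approx_limit)
      show "sqint S (indicator (\<Union> (range a)))" by (rule sqint_bounded[OF finite_measure_S, of _ 1]) auto
      show "(\<lambda>n. indicator (\<Union>i<n. a i) s) \<longlonglongrightarrow> (indicator (\<Union> (range a)) s :: real)" for s
        by (rule LIMSEQ_indicator_UN)
      show "\<bar>indicator (\<Union>i<n. a i) s\<bar> \<le> 2 * \<bar>indicator (\<Union> (range a)) s :: real\<bar>" for n :: nat and s
        by (auto split: split_indicator)
    qed (rule fin)
  qed
qed

theorem sqint_cylinder_approx:
  assumes "sqint S g"
  shows "cylinder_approx g"
proof -
  have "g \<in> borel_measurable S" using assms by (simp add: sqint_def)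
  from borel_measurable_implies_sequence_metric[OF this, of 0] obtain F where
    F: "\<And>i. simple_function S (F i)" "\<And>x. (\<lambda>i. F i x) \<longlonglongrightarrow> g x" "\<And>i x. \<bar>F i x\<bar> \<le> 2 * \<bar>g x\<bar>"
    by (auto simp: dist_real_def)
  have "cylinder_approx (F n)" for n
  proof -
    have "cylinder_approx (\<lambda>s. \<Sum>y\<in>F n ` UNIV. y * indicator (F n -` {y} \<inter> space S) s)"
      using F(1)[of n]
      by (intro cylinder_approx_sum cylinder_approx_scale cylinder_approx_indicator)
         (auto dest: simple_functionD)
    also have "(\<lambda>s. \<Sum>y\<in>F n ` UNIV. y * indicator (F n -` {y} \<inter> space S) s) = F n"
    proof
      fix s
      have fin: "finite (F n ` UNIV)" using simple_functionD(1)[OF F(1)[of n]] by simp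
      have "(\<Sum>y\<in>F n ` UNIV. y * indicator (F n -` {y} \<inter> space S) s) = (\<Sum>y\<in>F n ` UNIV. if y = F n s then y else 0)"
        by (intro sum.cong) (auto split: split_indicator)
      also have "\<dots> = F n s" using fin by simp
      finally show "(\<Sum>y\<in>F n ` UNIV. y * indicator (F n -` {y} \<inter> space S) s) = F n s" .
    qed
    finally show ?thesis .
  qed
  then show ?thesis by (rule cylinder_approx_limit[OF assms _ F(2,3)])
qed

text \<open>Averaging is additive only where both sections are integrable, hence almost everywhere;
  the rest is contraction.\<close>

lemma norm_L2_avg_diff:
  assumes f: "sqint S f" and g: "sqint S g"
  shows "norm_L2 S (\<lambda>s. avg f s - avg g s) \<le> norm_L2 S (\<lambda>s. f s - g s)"
proof -
  have [measurable]: "f \<in> borel_measurable S" "g \<in> borel_measurable S"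
    using assms by (auto simp: sqint_def)
  have int: "integrable S f" "integrable S g"
    using assms by (auto intro: sqint_integrable[OF finite_measure_S])
  have "AE s in S. avg (\<lambda>s. f s - g s) s = avg f s - avg g s"
    using AE_integrable_avg[OF int(1)] AE_integrable_avg[OF int(2)]
    by eventually_elim (simp add: avg_def)
  then have "norm_L2 S (\<lambda>s. avg f s - avg g s) = norm_L2 S (avg (\<lambda>s. f s - g s))"
    unfolding norm_L2_def by (intro arg_cong[where f=sqrt] integral_cong_AE) auto
  also have "\<dots> \<le> norm_L2 S (\<lambda>s. f s - g s)"
    by (rule sqint_avg(2)[OF sqint_diff[OF assms]])
  finally show ?thesis .
qed

lemma norm_L2_funpow_avg_diff:
  assumes "sqint S f" "sqint S g"
  shows "norm_L2 S (\<lambda>s. (avg ^^ k) f s - (avg ^^ k) g s) \<le> norm_L2 S (\<lambda>s. f s - g s)"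
proof (induction k)
  case (Suc k)
  show ?case
    using norm_L2_avg_diff[OF sqint_funpow_avg(1)[OF assms(1), of k] sqint_funpow_avg(1)[OF assms(2), of k]] Suc
    by simp
qed simp

text \<open>The L2 form of triviality of the remote past. A cylinder function \<open>h\<close> near
  \<open>g\<close> is averaged to the constant \<open>\<integral>s. h s \<partial>S\<close> in
  finitely many steps, that constant is small because \<open>g\<close> has mean zero, and averaging
  does not enlarge the distance between \<open>g\<close> and \<open>h\<close>.\<close>

lemma norm_L2_funpow_avg_lim:
  assumes g: "sqint S g" and mean: "(\<integral>s. g s \<partial>S) = 0"
  shows "(\<lambda>k. norm_L2 S ((avg ^^ k) g)) \<longlonglongrightarrow> 0"
proof (rule LIMSEQ_I)
  fix \<delta> :: real assume "\<delta> > 0"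
  then have d: "\<delta> / 2 > 0" by simp
  obtain h m B where h: "h \<in> borel_measurable S" "\<forall>s. \<bar>h s\<bar> \<le> B" "depends_upto m h"
    "norm_L2 S (\<lambda>s. g s - h s) < \<delta> / 2" by (rule cylinder_approxE[OF sqint_cylinder_approx[OF g] d])
  note h = h(1) h(2)[rule_format] h(3,4)
  have hs: "sqint S h" by (rule sqint_bounded[OF finite_measure_S h(1,2)])
  have int: "integrable S g" "integrable S h"
    using g hs by (auto intro: sqint_integrable[OF finite_measure_S])
  have gh: "sqint S (\<lambda>s. g s - h s)" by (rule sqint_diff[OF g hs])
  have "\<bar>\<integral>s. h s \<partial>S\<bar> = \<bar>\<integral>s. g s - h s \<partial>S\<bar>" using int mean by simp
  also have "\<dots> \<le> (\<integral>s. \<bar>g s - h s\<bar> \<partial>S)" by (rule integral_abs_bound)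
  also have "\<dots> \<le> norm_L2 S (\<lambda>s. g s - h s)" by (rule P.integral_abs_le_norm_L2[OF gh])
  finally have mean_h: "\<bar>\<integral>s. h s \<partial>S\<bar> < \<delta> / 2" using h(4) by simp
  have "norm (norm_L2 S ((avg ^^ k) g) - 0) < \<delta>" if "k \<ge> m" for k
  proof -
    have c: "(avg ^^ k) h = (\<lambda>_. \<integral>s. h s \<partial>S)"
      using funpow_avg_eq_integral[OF h(3) that int(2)] by auto
    have "norm_L2 S (\<lambda>s. ((avg ^^ k) g s - (avg ^^ k) h s) + (avg ^^ k) h s)
        \<le> norm_L2 S (\<lambda>s. (avg ^^ k) g s - (avg ^^ k) h s) + norm_L2 S ((avg ^^ k) h)"
      by (intro norm_L2_triangle sqint_diff sqint_funpow_avg g hs)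
    also have "norm_L2 S ((avg ^^ k) h) = \<bar>\<integral>s. h s \<partial>S\<bar>"
      by (simp add: c norm_L2_def P.prob_space)
    also have "norm_L2 S (\<lambda>s. (avg ^^ k) g s - (avg ^^ k) h s) \<le> norm_L2 S (\<lambda>s. g s - h s)"
      by (rule norm_L2_funpow_avg_diff[OF g hs])
    finally show ?thesis using mean_h h(4) by (simp add: norm_L2_nonneg)
  qed
  then show "\<exists>no. \<forall>n\<ge>no. norm (norm_L2 S ((avg ^^ n) g) - 0) < \<delta>" by blast
qed

end

section \<open>Martingale differences\<close>

lemma exp_minus_approx:
  fixes y :: real
  assumes "0 \<le> y"
  shows "\<bar>exp (-y) - (1 - y)\<bar> \<le> y\<^sup>2"
proof -
  \<comment> \<open>This identity bounds \<open>1 / (1 + y)\<close> by \<open>1 - y + y^2\<close>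
    for nonnegative \<open>y\<close>, while \<open>exp (-y)\<close> is at most
    \<open>1 / (1 + y)\<close>.\<close>
  have "(1 - y + y\<^sup>2) * (1 + y) = 1 + y ^ 3" by (simp add: power2_eq_square power3_eq_cube algebra_simps)
  then have "1 \<le> (1 - y + y\<^sup>2) * (1 + y)" using assms by simp
  also have "\<dots> \<le> (1 - y + y\<^sup>2) * exp y"
  proof (rule mult_left_mono)
    have "0 \<le> (1 - y)\<^sup>2 + y" using assms by simp
    also have "\<dots> = 1 - y + y\<^sup>2" by (simp add: power2_eq_square algebra_simps)
    finally show "0 \<le> 1 - y + y\<^sup>2" .
  qed (rule exp_ge_add_one_self)
  finally have "exp (-y) \<le> 1 - y + y\<^sup>2" by (simp add: exp_minus divide_simps mult.commute)
  moreover have "1 - y \<le> exp (-y)" using exp_ge_add_one_self[of "-y"] by simp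
  ultimately show ?thesis by simp
qed

text \<open>In McLeish's argument this quotient is what remains of \<open>iexp x\<close> beside the
  factor \<open>1 + \<i> * x\<close>. The expansions agree to second order; the cubic errors 1/6,
  1/2 and 1/2 are rounded up to 2.\<close>

lemma iexp_quotient_approx:
  assumes "\<bar>x\<bar> \<le> 1"
  shows "cmod (iexp x / (1 + \<i> * x) - of_real (exp (- x\<^sup>2 / 2))) \<le> 2 * \<bar>x\<bar> ^ 3"
proof -
  define w where "w = 1 + \<i> * of_real x"
  define e where "e = exp (- x\<^sup>2 / 2) - (1 - x\<^sup>2 / 2)"
  have w1: "1 \<le> cmod w" unfolding w_def using abs_Re_le_cmod[of "1 + \<i> * of_real x"] by simp
  then have w0: "w \<noteq> 0" by auto
  have w2: "cmod w \<le> 2" unfolding w_def using assms norm_triangle_ineq[of 1 "\<i> * of_real x"] by (simp add: norm_mult)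
  have "\<bar>e\<bar> \<le> (x\<^sup>2 / 2)\<^sup>2" unfolding e_def using exp_minus_approx[of "x\<^sup>2 / 2"] by simp
  also have "\<dots> = \<bar>x\<bar> ^ 3 * \<bar>x\<bar> / 4" by (simp add: power2_eq_square power3_eq_cube)
  also have "\<dots> \<le> \<bar>x\<bar> ^ 3 * 1 / 4" using assms by (intro divide_right_mono mult_left_mono) auto
  finally have e: "\<bar>e\<bar> \<le> \<bar>x\<bar> ^ 3 / 4" by simp
  have i: "cmod (iexp x - (1 + \<i> * x - x\<^sup>2 / 2)) \<le> \<bar>x\<bar> ^ 3 / 6"
    using iexp_approx1[of x 2]
    by (simp add: eval_nat_numeral power_mult_distrib algebra_simps fact_numeral)
  \<comment> \<open>Expanding \<open>w * (1 - x^2 / 2)\<close> reproduces the quadratic Taylor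
    polynomial of \<open>iexp x\<close> up to the last term.\<close>
  have "iexp x - w * exp (- x\<^sup>2 / 2) = (iexp x - (1 + \<i> * x - x\<^sup>2 / 2)) - w * e + \<i> * x ^ 3 / 2"
    unfolding e_def w_def
    by (simp add: field_simps power2_eq_square power3_eq_cube)
  also have "cmod \<dots> \<le> cmod (iexp x - (1 + \<i> * x - x\<^sup>2 / 2)) + cmod (w * e) + cmod (\<i> * x ^ 3 / 2)"
    by (meson norm_triangle_ineq norm_triangle_ineq4 order_trans add_right_mono)
  also have "\<dots> \<le> \<bar>x\<bar> ^ 3 / 6 + 2 * (\<bar>x\<bar> ^ 3 / 4) + \<bar>x\<bar> ^ 3 / 2"
  proof (intro add_mono i)
    show "cmod (w * e) \<le> 2 * (\<bar>x\<bar> ^ 3 / 4)" unfolding norm_mult using e w2 by (intro mult_mono) auto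
  qed (simp add: norm_mult norm_divide norm_power)
  also have "\<dots> \<le> 2 * \<bar>x\<bar> ^ 3" by simp
  finally have *: "cmod (iexp x - w * exp (- x\<^sup>2 / 2)) \<le> 2 * \<bar>x\<bar> ^ 3" .
  have "cmod (iexp x / w - exp (- x\<^sup>2 / 2)) = cmod (iexp x - w * exp (- x\<^sup>2 / 2)) / cmod w"
    using w0 by (simp add: diff_divide_distrib flip: norm_divide)
  also have "\<dots> \<le> cmod (iexp x - w * exp (- x\<^sup>2 / 2)) / 1"
    using w1 by (intro divide_left_mono) auto
  finally show ?thesis using * unfolding w_def by simp
qed

lemma norm_1_plus_i_le: "cmod (1 + \<i> * of_real x) \<le> exp (x\<^sup>2 / 2)"
proof -
  have "cmod (1 + \<i> * of_real x) = sqrt (1 + x\<^sup>2)" by (simp add: cmod_def)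
  also have "\<dots> \<le> sqrt (exp (x\<^sup>2))" using exp_ge_add_one_self[of "x\<^sup>2"] by simp
  also have "\<dots> = exp (x\<^sup>2 / 2)"
    by (rule real_sqrt_unique) (simp_all add: power2_eq_square flip: exp_add)
  finally show ?thesis .
qed

text \<open>Phrased in standard deviations: the L2 triangle inequality controls their difference
  without any bound on the norms themselves.\<close>

lemma exp_half_square_lipschitz:
  fixes a b :: real
  assumes "0 \<le> a" "0 \<le> b"
  shows "\<bar>exp (- a\<^sup>2 / 2) - exp (- b\<^sup>2 / 2)\<bar> \<le> \<bar>a - b\<bar>"
proof -
  have "norm (exp (- a\<^sup>2 / 2) - exp (- b\<^sup>2 / 2)) \<le> 1 * norm (a - b)"
  proof (rule field_differentiable_bound[of UNIV])
    show "((\<lambda>a. exp (- a\<^sup>2 / 2)) has_field_derivative - (x * exp (- x\<^sup>2 / 2))) (at x within UNIV)" for x :: real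
      by (auto intro!: derivative_eq_intros)
    fix x :: real
    have "0 \<le> (\<bar>x\<bar> - 1)\<^sup>2" by simp
    then have "\<bar>x\<bar> \<le> 1 + x\<^sup>2 / 2" by (simp add: power2_diff)
    also have "\<dots> \<le> exp (x\<^sup>2 / 2)" by (rule exp_ge_add_one_self)
    finally show "norm (- (x * exp (- x\<^sup>2 / 2))) \<le> 1"
      by (simp add: abs_mult exp_minus divide_simps)
  qed auto
  then show ?thesis by simp
qed

text \<open>Phrased in variances, for comparing a random sum of squares with its mean.\<close>

lemma exp_minus_half_lipschitz:
  fixes a b :: real
  assumes "0 \<le> a" "0 \<le> b"
  shows "\<bar>exp (- a / 2) - exp (- b / 2)\<bar> \<le> \<bar>a - b\<bar> / 2"
proof -
  have *: "exp (- u / 2) - exp (- v / 2) \<le> (v - u) / 2" if "0 \<le> u" "u \<le> v" for u v :: real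
  proof -
    have "exp (- u / 2) - exp (- v / 2) = exp (- u / 2) * (1 - exp ((u - v) / 2))"
      by (simp add: algebra_simps diff_divide_distrib flip: exp_add)
    also have "\<dots> \<le> 1 * (1 - exp ((u - v) / 2))" using that by (intro mult_right_mono) auto
    also have "\<dots> \<le> (v - u) / 2" using exp_ge_add_one_self[of "(u - v) / 2"] by (simp add: field_simps)
    finally show ?thesis .
  qed
  show ?thesis
  proof (cases "a \<le> b")
    case True
    then have "exp (- b / 2) \<le> exp (- a / 2)" by simp
    then show ?thesis using *[of a b] True assms by simp
  next
    case False
    then have "exp (- a / 2) \<le> exp (- b / 2)" by simp
    then show ?thesis using *[of b a] False assms by simp
  qed
qed

section \<open>Products and squares of martingale differences\<close>

context one_sided_shift begin

lemma integrable_section: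
  fixes g :: "_ \<Rightarrow> 'c::{banach, second_countable_topology}"
  assumes g: "g \<in> borel_measurable S" and b: "\<And>s. norm (g s) \<le> B"
  shows "integrable M (\<lambda>y. g (case_nat y s))"
proof -
  have [measurable]: "g \<in> borel_measurable S" by fact
  show ?thesis by (rule M.integrable_const_bound[where B=B]) (use b in auto)
qed

text \<open>The multiplicative martingale at the heart of McLeish's proof of the martingale central limit theorem.\<close>

lemma integral_prod_mds:
  assumes "\<And>r. x r \<in> borel_measurable S" "\<And>r s. \<bar>x r s\<bar> \<le> (c::real)" "\<And>r s. avg (x r) s = 0"
  shows "(\<integral>s. (\<Prod>r<N. 1 + \<i> * of_real (x r ((tail ^^ r) s))) \<partial>S) = 1"
  using assms
proof (induction N arbitrary: x)
  case 0
  then show ?case by (simp add: P.prob_space)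
next
  case (Suc N)
  note [measurable] = Suc.prems(1)
  \<comment> \<open>Only the factor with \<open>r = 0\<close> sees the newest coordinate. The others
    are a product of the same shape for the family \<open>x (Suc r)\<close>, evaluated at
    \<open>tail s\<close>, so the averaged product is \<open>H\<close>.\<close>
  define H where "H s = (\<Prod>r<N. 1 + \<i> * of_real (x (Suc r) ((tail ^^ r) s)))" for s
  have [measurable]: "H \<in> borel_measurable S" unfolding H_def by measurable
  have eq: "(\<Prod>r<Suc N. 1 + \<i> * of_real (x r ((tail ^^ r) s)))
      = (1 + \<i> * of_real (x 0 s)) * H (tail s)" for s
    unfolding H_def prod.lessThan_Suc_shift by (simp add: funpow_swap1)
  have b: "cmod (1 + \<i> * of_real (x r s)) \<le> 1 + c" for r s
    using Suc.prems(2)[of r s] norm_triangle_ineq[of 1 "\<i> * of_real (x r s)"] by (simp add: norm_mult)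
  have c: "0 \<le> 1 + c" using b[of 0] norm_ge_zero order_trans by blast
  have bH: "cmod (H s) \<le> (1 + c) ^ N" for s
  proof -
    have "cmod (H s) = (\<Prod>r<N. cmod (1 + \<i> * of_real (x (Suc r) ((tail ^^ r) s))))"
      unfolding H_def by (simp add: prod_norm)
    also have "\<dots> \<le> (\<Prod>r<N. 1 + c)" by (intro prod_mono conjI b norm_ge_zero)
    finally show ?thesis by simp
  qed
  define F where "F s = (1 + \<i> * of_real (x 0 s)) * H (tail s)" for s
  have [measurable]: "F \<in> borel_measurable S" unfolding F_def by measurable
  have "cmod (F s) \<le> (1 + c) * (1 + c) ^ N" for s
    unfolding F_def norm_mult by (intro mult_mono b bH c norm_ge_zero)
  then have intF: "integrable S F"
    by (intro P.integrable_const_bound[where B="(1 + c) * (1 + c) ^ N"]) auto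
  have avgF: "avg F s = H s" for s
  proof -
    have "avg (\<lambda>s. 1 + \<i> * of_real (x 0 s)) s = 1 + \<i> * of_real (avg (x 0) s)"
      using integrable_section[OF Suc.prems(1)[of 0], of c s] Suc.prems(2)
      by (simp add: avg_def M.prob_space)
    then show ?thesis
      unfolding F_def using avg_mult_tail[of "\<lambda>s. 1 + \<i> * of_real (x 0 s)" H s] Suc.prems(3) by simp
  qed
  have "(\<integral>s. (\<Prod>r<Suc N. 1 + \<i> * of_real (x r ((tail ^^ r) s))) \<partial>S) = (\<integral>s. F s \<partial>S)"
    by (simp only: eq F_def)
  also have "\<dots> = (\<integral>s. H s \<partial>S)" using integral_avg[OF intF] avgF by simp
  also have "\<dots> = 1" unfolding H_def using Suc.prems by (intro Suc.IH) auto
  finally show ?case .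
qed

text \<open>The condition is almost sure because the difference of two such functions averages to
  zero only where both sections are integrable (\<open>mds_diff\<close>).\<close>

definition mds :: "((nat \<Rightarrow> 'b) \<Rightarrow> real) \<Rightarrow> bool" where
  "mds g \<longleftrightarrow> sqint S g \<and> (AE s in S. avg g s = 0)"

lemma integral_mds_mult_tail:
  assumes "mds g" "sqint S h"
  shows "(\<integral>s. g s * h (tail s) \<partial>S) = 0"
proof -
  have "(\<integral>s. g s * h (tail s) \<partial>S) = (\<integral>s. avg g s * h s \<partial>S)"
    using integral_mult_funpow_tail[of g h 1] assms by (simp add: mds_def)
  also have "\<dots> = (\<integral>s. 0 \<partial>S)"
    using assms by (intro integral_cong_AE) (auto simp: mds_def sqint_def)
  finally show ?thesis by simp
qed

text \<open>Powers of \<open>tail\<close> go back in time, so the factor with exponent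
  \<open>q\<close> is determined by noise strictly older than the newest entry seen by
  \<open>g\<close>. Stationarity removes the common \<open>tail ^^ p\<close>.\<close>

lemma integral_mds_orthogonal:
  assumes "mds g" "sqint S h" "p < q"
  shows "(\<integral>s. g ((tail ^^ p) s) * h ((tail ^^ q) s) \<partial>S) = 0"
proof -
  have [measurable]: "g \<in> borel_measurable S" "h \<in> borel_measurable S" using assms by (auto simp: mds_def sqint_def)
  obtain d where q: "q = d + Suc p" using assms(3) less_imp_Suc_add by (metis add.commute add_Suc_right)
  define k where "k s = h ((tail ^^ d) s)" for s
  have k: "sqint S k" unfolding k_def by (rule sqint_funpow_tail[OF assms(2)])
  then have [measurable]: "k \<in> borel_measurable S" by (simp add: sqint_def)
  have "(\<integral>s. g ((tail ^^ p) s) * h ((tail ^^ q) s) \<partial>S) = (\<integral>s. g ((tail ^^ p) s) * k (tail ((tail ^^ p) s)) \<partial>S)"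
    unfolding k_def q funpow_add by simp
  also have "\<dots> = (\<integral>s. g s * k (tail s) \<partial>S)"
    by (rule integral_funpow_tail[of "\<lambda>s. g s * k (tail s)" p]) measurable
  finally show ?thesis using integral_mds_mult_tail[OF assms(1) k] by simp
qed

lemma integral_square_sum_mds:
  assumes "\<And>r. r < N \<Longrightarrow> mds (x r)"
  shows "(\<integral>s. (\<Sum>r<N. x r ((tail ^^ r) s))\<^sup>2 \<partial>S) = (\<Sum>r<N. \<integral>s. (x r s)\<^sup>2 \<partial>S)"
proof -
  let ?x = "\<lambda>p q s. x p ((tail ^^ p) s) * x q ((tail ^^ q) s)"
  have sq: "sqint S (x r)" if "r < N" for r using assms[OF that] by (simp add: mds_def)
  have int: "integrable S (\<lambda>s. ?x p q s)" if "p < N" "q < N" for p q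
    by (intro sqint_integrable_mult sqint_funpow_tail sq that)
  have "(\<integral>s. (\<Sum>r<N. x r ((tail ^^ r) s))\<^sup>2 \<partial>S) = (\<integral>s. (\<Sum>p<N. \<Sum>q<N. ?x p q s) \<partial>S)"
    by (simp add: power2_eq_square sum_product)
  also have "\<dots> = (\<Sum>p<N. \<Sum>q<N. \<integral>s. ?x p q s \<partial>S)"
    using int by (subst Bochner_Integration.integral_sum; auto intro!: sum.cong Bochner_Integration.integral_sum)
  also have "\<dots> = (\<Sum>p<N. \<Sum>q<N. if q = p then \<integral>s. (x p s)\<^sup>2 \<partial>S else 0)"
  proof (intro sum.cong refl)
    fix p q assume pq: "p \<in> {..<N}" "q \<in> {..<N}"
    consider "p < q" | "q < p" | "q = p" by linarith
    then show "(\<integral>s. ?x p q s \<partial>S) = (if q = p then \<integral>s. (x p s)\<^sup>2 \<partial>S else 0)"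
    proof cases
      case 1
      then show ?thesis using integral_mds_orthogonal[OF assms sq 1] pq by simp
    next
      case 2
      then show ?thesis using integral_mds_orthogonal[OF assms sq 2, of q p] pq by (simp add: mult.commute)
    next
      case 3
      have [measurable]: "x p \<in> borel_measurable S" using sq pq by (auto simp: sqint_def)
      show ?thesis using 3 integral_funpow_tail[of "\<lambda>s. (x p s)\<^sup>2" p] by (simp add: power2_eq_square)
    qed
  qed
  also have "\<dots> = (\<Sum>r<N. \<integral>s. (x r s)\<^sup>2 \<partial>S)" by simp
  finally show ?thesis .
qed

text \<open>Summands at distance at least \<open>m\<close> are uncorrelated.\<close>

lemma variance_sum_depends_upto:
  assumes meas: "\<And>r. y r \<in> borel_measurable S" and bd: "\<And>r s. \<bar>y r s\<bar> \<le> B"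
    and dep: "\<And>r. depends_upto m (y r)" and mean: "\<And>r. (\<integral>s. y r s \<partial>S) = 0"
  shows "(\<integral>s. (\<Sum>r<N. y r ((tail ^^ r) s))\<^sup>2 \<partial>S) \<le> real (N * (2 * m)) * B\<^sup>2"
proof -
  let ?y = "\<lambda>p q s. y p ((tail ^^ p) s) * y q ((tail ^^ q) s)"
  let ?c = "\<lambda>p q. \<integral>s. ?y p q s \<partial>S"
  have B: "0 \<le> B" using bd[of 0] abs_ge_zero order_trans by blast
  note [measurable] = meas
  have sq: "sqint S (y r)" for r by (rule sqint_bounded[OF finite_measure_S meas bd])
  have int: "integrable S (\<lambda>s. ?y p q s)" for p q
    by (intro sqint_integrable_mult sqint_funpow_tail sq)
  \<comment> \<open>At least \<open>m\<close> averagings separate the two summands, and they reduce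
    \<open>y p\<close> to its mean 0.\<close>
  have zero: "?c p q = 0" if "p + m \<le> q" for p q
  proof -
    have q: "q = (q - p) + p" using that by simp
    have "?c p q = (\<integral>s. y p ((tail ^^ p) s) * y q ((tail ^^ (q - p)) ((tail ^^ p) s)) \<partial>S)"
      using q funpow_add[of "q - p" p tail] by simp
    also have "\<dots> = (\<integral>s. y p s * y q ((tail ^^ (q - p)) s) \<partial>S)"
      by (rule integral_funpow_tail[of "\<lambda>s. y p s * y q ((tail ^^ (q - p)) s)" p]) measurable
    also have "\<dots> = (\<integral>s. (avg ^^ (q - p)) (y p) s * y q s \<partial>S)"
      by (rule integral_mult_funpow_tail[OF sq sq])
    also have "\<dots> = (\<integral>s. 0 \<partial>S)"
      using funpow_avg_eq_integral[OF dep[of p], of "q - p"] that mean sqint_integrable[OF finite_measure_S sq]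
      by (intro Bochner_Integration.integral_cong) auto
    finally show ?thesis by simp
  qed
  have le: "?c p q \<le> (if q \<in> {p - m..<p + m} then B\<^sup>2 else 0)" for p q
  proof (cases "q \<in> {p - m..<p + m}")
    case True
    have "?c p q \<le> (\<integral>s. B\<^sup>2 \<partial>S)"
    proof (intro integral_mono int)
      fix s
      have "\<bar>y p ((tail ^^ p) s)\<bar> * \<bar>y q ((tail ^^ q) s)\<bar> \<le> B * B"
        by (intro mult_mono bd B) auto
      then show "?y p q s \<le> B\<^sup>2"
        using abs_ge_self[of "?y p q s"]
        by (simp add: power2_eq_square abs_mult)
    qed auto
    then show ?thesis using True by (simp add: P.prob_space)
  next
    case False
    then consider "p + m \<le> q" | "q + m \<le> p" by (auto simp: not_le not_less)
    then show ?thesis using zero[of p q] zero[of q p] False by cases (auto simp: mult.commute)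
  qed
  have "(\<integral>s. (\<Sum>r<N. y r ((tail ^^ r) s))\<^sup>2 \<partial>S) = (\<integral>s. (\<Sum>p<N. \<Sum>q<N. ?y p q s) \<partial>S)"
    by (simp add: power2_eq_square sum_product)
  also have "\<dots> = (\<Sum>p<N. \<Sum>q<N. ?c p q)"
    using int by (subst Bochner_Integration.integral_sum; auto intro!: sum.cong Bochner_Integration.integral_sum)
  also have "\<dots> \<le> (\<Sum>p<N. \<Sum>q<N. if q \<in> {p - m..<p + m} then B\<^sup>2 else 0)"
    by (intro sum_mono le)
  \<comment> \<open>Each \<open>p\<close> has at most \<open>2 * m\<close> neighbours; truncated
    subtraction at the lower end only shrinks the interval.\<close>
  also have "\<dots> \<le> (\<Sum>p<N. real (2 * m) * B\<^sup>2)"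
  proof (rule sum_mono)
    fix p
    have "(\<Sum>q<N. if q \<in> {p - m..<p + m} then B\<^sup>2 else 0) = real (card ({..<N} \<inter> {p - m..<p + m})) * B\<^sup>2"
      by (simp add: sum.If_cases Int_def)
    also have "\<dots> \<le> real (card {p - m..<p + m}) * B\<^sup>2"
      by (intro mult_right_mono of_nat_mono card_mono) auto
    also have "\<dots> \<le> real (2 * m) * B\<^sup>2" by (intro mult_right_mono) auto
    finally show "(\<Sum>q<N. if q \<in> {p - m..<p + m} then B\<^sup>2 else 0) \<le> real (2 * m) * B\<^sup>2" .
  qed
  also have "\<dots> = real (N * (2 * m)) * B\<^sup>2" by simp
  finally show ?thesis .
qed

text \<open>McLeish's argument with an explicit error. For \<open>N\<close> of order
  \<open>n\<close>, \<open>c\<close> of order \<open>n^(-1/2)\<close> and fixed \<open>m\<close>,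
  the exponential stays bounded and the bracket tends to zero.\<close>

theorem char_mds_sum_bound:
  fixes x :: "nat \<Rightarrow> (nat \<Rightarrow> 'b) \<Rightarrow> real" and N :: nat
  assumes meas: "\<And>r. x r \<in> borel_measurable S" and bd: "\<And>r s. \<bar>x r s\<bar> \<le> c" and c: "c \<le> 1"
    and avg: "\<And>r s. avg (x r) s = 0" and dep: "\<And>r. depends_upto m (x r)"
  defines "T \<equiv> \<lambda>s. \<Sum>r<N. x r ((tail ^^ r) s)"
  shows "cmod ((\<integral>s. iexp (T s) \<partial>S) - exp (- (\<integral>s. (T s)\<^sup>2 \<partial>S) / 2))
    \<le> exp (real N * c\<^sup>2 / 2) * (2 * real N * c ^ 3 + c\<^sup>2 * sqrt (real (N * (2 * m))) / 2)"
proof -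
  let ?x = "\<lambda>r s. x r ((tail ^^ r) s)"
  note [measurable] = meas
  have c0: "0 \<le> c" using bd[of 0] abs_ge_zero order_trans by blast
  have sq: "sqint S (x r)" for r by (rule sqint_bounded[OF finite_measure_S meas bd])
  have "(x r s)\<^sup>2 \<le> c\<^sup>2" for r s
    using power_mono[OF bd[of r s], of 2] by simp
  note sqb = this
  \<comment> \<open>\<open>V\<close> is the realised sum of squares and \<open>v\<close> its mean.
    \<open>Q\<close> is the product of expectation 1, and \<open>R\<close> collects the quotients,
    so that \<open>iexp (T s) = Q s * R s\<close> with \<open>R\<close> close to
    \<open>exp (- V / 2)\<close>.\<close>
  define V where "V s = (\<Sum>r<N. (?x r s)\<^sup>2)" for s
  define v where "v = (\<Sum>r<N. \<integral>s. (x r s)\<^sup>2 \<partial>S)"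
  define Q where "Q s = (\<Prod>r<N. 1 + \<i> * of_real (?x r s))" for s
  define R where "R s = (\<Prod>r<N. iexp (?x r s) / (1 + \<i> * of_real (?x r s)))" for s
  have [measurable]: "T \<in> borel_measurable S" "V \<in> borel_measurable S" "Q \<in> borel_measurable S"
    unfolding T_def V_def Q_def by measurable
  have [measurable]: "R \<in> borel_measurable S" unfolding R_def by measurable
  have v: "(\<integral>s. (T s)\<^sup>2 \<partial>S) = v"
    unfolding T_def v_def by (rule integral_square_sum_mds) (simp add: mds_def sq avg)
  have v0: "0 \<le> v" unfolding v_def by (intro sum_nonneg) simp
  have w: "1 \<le> cmod (1 + \<i> * of_real t)" for t
    using abs_Re_le_cmod[of "1 + \<i> * of_real t"] by simp
  then have w0: "1 + \<i> * of_real t \<noteq> 0" for t by (metis norm_zero not_one_le_zero)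
  have split: "iexp (T s) = Q s * R s" for s
    unfolding Q_def R_def T_def prod.distrib[symmetric]
    using w0 by (simp add: sum_distrib_left exp_sum)
  have Qb: "cmod (Q s) \<le> exp (real N * c\<^sup>2 / 2)" for s
  proof -
    have "cmod (Q s) = (\<Prod>r<N. cmod (1 + \<i> * of_real (?x r s)))"
      unfolding Q_def by (simp add: prod_norm)
    also have "\<dots> \<le> (\<Prod>r<N. exp (c\<^sup>2 / 2))"
      using norm_1_plus_i_le sqb
      by (intro prod_mono conjI norm_ge_zero) (meson divide_right_mono exp_le_cancel_iff order_trans zero_le_numeral)
    also have "\<dots> = exp (real N * c\<^sup>2 / 2)" by (simp flip: exp_of_nat_mult)
    finally show ?thesis .
  qed
  have R1: "cmod (iexp t / (1 + \<i> * of_real t)) \<le> 1" for t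
    using w[of t] w0[of t] by (simp add: norm_divide divide_simps)
  \<comment> \<open>Two errors: each of the \<open>N\<close> quotients differs from its Gaussian
    factor by at most \<open>2 * c ^ 3\<close>, and replacing \<open>V\<close> by \<open>v\<close>
    costs half their distance.\<close>
  have Rb: "cmod (R s - exp (- v / 2)) \<le> 2 * real N * c ^ 3 + \<bar>V s - v\<bar> / 2" for s
  proof -
    define E where "E = (\<Prod>r<N. complex_of_real (exp (- (?x r s)\<^sup>2 / 2)))"
    have E: "E = exp (- V s / 2)"
      unfolding E_def V_def by (simp add: exp_sum sum_divide_distrib flip: of_real_prod sum_negf)
    have "cmod (R s - E) \<le> (\<Sum>r<N. cmod (iexp (?x r s) / (1 + \<i> * of_real (?x r s))
         - of_real (exp (- (?x r s)\<^sup>2 / 2))))"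
      unfolding R_def E_def by (intro norm_prod_diff R1) (simp del: of_real_exp)
    also have "\<dots> \<le> (\<Sum>r<N. 2 * c ^ 3)"
    proof (rule sum_mono)
      fix r
      have "2 * \<bar>?x r s\<bar> ^ 3 \<le> 2 * c ^ 3"
        by (intro mult_left_mono power_mono bd) auto
      then show "cmod (iexp (?x r s) / (1 + \<i> * of_real (?x r s))
         - of_real (exp (- (?x r s)\<^sup>2 / 2))) \<le> 2 * c ^ 3"
        using iexp_quotient_approx[of "?x r s"] bd[of r "(tail ^^ r) s"] c by linarith
    qed
    finally have 1: "cmod (R s - E) \<le> 2 * real N * c ^ 3" by simp
    have "cmod (E - exp (- v / 2)) = \<bar>exp (- V s / 2) - exp (- v / 2)\<bar>"
      unfolding E by (simp only: norm_of_real flip: of_real_diff)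
    also have "\<dots> \<le> \<bar>V s - v\<bar> / 2"
      by (rule exp_minus_half_lipschitz) (auto simp: V_def v0 intro!: sum_nonneg)
    finally have 2: "cmod (E - exp (- v / 2)) \<le> \<bar>V s - v\<bar> / 2" .
    have "cmod ((R s - E) + (E - exp (- v / 2))) \<le> cmod (R s - E) + cmod (E - exp (- v / 2))"
      by (rule norm_triangle_ineq)
    then show ?thesis using 1 2 by simp
  qed
  \<comment> \<open>The centred squares are bounded by \<open>c^2\<close>, because a square and its
    mean both lie between 0 and \<open>c^2\<close>, and they depend on the same \<open>m\<close>
    coordinates.\<close>
  define y where "y r s = (x r s)\<^sup>2 - (\<integral>s. (x r s)\<^sup>2 \<partial>S)" for r s
  have [measurable]: "y r \<in> borel_measurable S" for r unfolding y_def by measurable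
  have Vv: "V s - v = (\<Sum>r<N. y r ((tail ^^ r) s))" for s
    unfolding V_def v_def y_def by (simp add: sum_subtractf)
  have intx: "integrable S (\<lambda>s. (x r s)\<^sup>2)" for r using sq[of r] by (simp add: sqint_def)
  have m0: "0 \<le> (\<integral>s. (x r s)\<^sup>2 \<partial>S)" "(\<integral>s. (x r s)\<^sup>2 \<partial>S) \<le> c\<^sup>2" for r
  proof -
    have "(\<integral>s. (x r s)\<^sup>2 \<partial>S) \<le> (\<integral>s. c\<^sup>2 \<partial>S)" by (intro integral_mono intx sqb) auto
    then show "(\<integral>s. (x r s)\<^sup>2 \<partial>S) \<le> c\<^sup>2" by (simp add: P.prob_space)
  qed simp
  have yb: "\<bar>y r s\<bar> \<le> c\<^sup>2" for r s
    using m0[of r] sqb[of r s] zero_le_power2[of "x r s"] unfolding y_def abs_le_iff by linarith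
  have var: "(\<integral>s. (V s - v)\<^sup>2 \<partial>S) \<le> real (N * (2 * m)) * (c\<^sup>2)\<^sup>2"
    unfolding Vv
  proof (rule variance_sum_depends_upto)
    show "\<bar>y r s\<bar> \<le> c\<^sup>2" for r s by (rule yb)
    show "depends_upto m (y r)" for r unfolding y_def by (rule depends_upto_comp[OF dep])
    show "(\<integral>s. y r s \<partial>S) = 0" for r unfolding y_def using intx by (simp add: P.prob_space)
  qed measurable
  have sqV: "sqint S (\<lambda>s. V s - v)"
    unfolding Vv by (intro sqint_sum sqint_funpow_tail sqint_bounded[OF finite_measure_S _ yb]) measurable
  have "(\<integral>s. \<bar>V s - v\<bar> \<partial>S) \<le> norm_L2 S (\<lambda>s. V s - v)"
    by (rule P.integral_abs_le_norm_L2[OF sqV])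
  also have "\<dots> \<le> sqrt (real (N * (2 * m)) * (c\<^sup>2)\<^sup>2)"
    unfolding norm_L2_def using var by simp
  also have "\<dots> = c\<^sup>2 * sqrt (real (N * (2 * m)))" by (simp only: real_sqrt_mult real_sqrt_abs abs_power2 mult.commute)
  finally have absV: "(\<integral>s. \<bar>V s - v\<bar> \<partial>S) \<le> c\<^sup>2 * sqrt (real (N * (2 * m)))" .
  have intV: "integrable S (\<lambda>s. \<bar>V s - v\<bar>)"
    using sqint_integrable[OF finite_measure_S sqV] by simp
  have intQ: "integrable S Q"
    by (rule P.integrable_const_bound[where B="exp (real N * c\<^sup>2 / 2)"]) (use Qb in auto)
  have intT: "integrable S (\<lambda>s. iexp (T s))"
    by (rule P.integrable_const_bound[where B=1]) auto
  let ?B = "\<lambda>s. exp (real N * c\<^sup>2 / 2) * (2 * real N * c ^ 3 + \<bar>V s - v\<bar> / 2)"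
  have QR: "cmod (Q s * (R s - exp (- v / 2))) \<le> ?B s" for s
    unfolding norm_mult by (intro mult_mono Qb Rb) auto
  have intB: "integrable S ?B"
    using intV by simp
  have intQR: "integrable S (\<lambda>s. Q s * (R s - exp (- v / 2)))"
  proof (rule Bochner_Integration.integrable_bound[OF intB])
    show "AE s in S. norm (Q s * (R s - exp (- v / 2))) \<le> norm (?B s)"
      unfolding real_norm_def by (intro AE_I2 order_trans[OF QR abs_ge_self])
  qed measurable
  \<comment> \<open>Since \<open>Q\<close> has expectation 1, the constant
    \<open>exp (- v / 2)\<close> may be moved under the integral as a multiple of
    \<open>Q\<close>.\<close>
  have "(\<integral>s. Q s \<partial>S) = 1"
    unfolding Q_def by (rule integral_prod_mds[OF meas bd avg])
  then have "(\<integral>s. iexp (T s) \<partial>S) - exp (- v / 2) = (\<integral>s. iexp (T s) - Q s * exp (- v / 2) \<partial>S)"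
    using intT intQ by simp
  also have "\<dots> = (\<integral>s. Q s * (R s - exp (- v / 2)) \<partial>S)"
    by (simp add: split right_diff_distrib)
  also have "cmod \<dots> \<le> (\<integral>s. ?B s \<partial>S)"
    by (rule order_trans[OF integral_norm_bound integral_mono]) (intro integrable_norm intQR intB QR)+
  also have "\<dots> = exp (real N * c\<^sup>2 / 2) * (2 * real N * c ^ 3 + (\<integral>s. \<bar>V s - v\<bar> \<partial>S) / 2)"
    using intV by (simp add: P.prob_space)
  also have "\<dots> \<le> exp (real N * c\<^sup>2 / 2) * (2 * real N * c ^ 3 + c\<^sup>2 * sqrt (real (N * (2 * m))) / 2)"
    using absV by (intro mult_left_mono add_left_mono divide_right_mono) auto
  finally show ?thesis unfolding v .
qed

end

section \<open>A central limit theorem for weighted sums along the shift\<close>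

context one_sided_shift begin

text \<open>\<open>mdiff G j\<close> of the past up to time 0 is the projection \<^term>\<open>proj_op\<close> of the process at time \<open>j\<close>.\<close>

definition mdiff :: "((nat \<Rightarrow> 'b) \<Rightarrow> real) \<Rightarrow> nat \<Rightarrow> (nat \<Rightarrow> 'b) \<Rightarrow> real" where
  "mdiff g j s = (avg ^^ j) g s - (avg ^^ Suc j) g (tail s)"

section \<open>Martingale decomposition and its L2 estimates\<close>

lemma sqint_tail: "sqint S g \<Longrightarrow> sqint S (\<lambda>s. g (tail s))"
  using sqint_funpow_tail[of g 1] by simp

lemma norm_L2_tail: "g \<in> borel_measurable S \<Longrightarrow> norm_L2 S (\<lambda>s. g (tail s)) = norm_L2 S g"
  using norm_L2_funpow_tail[of g 1] by simp

lemma sqint_mdiff: "sqint S g \<Longrightarrow> sqint S (mdiff g j)"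
  unfolding mdiff_def by (intro sqint_diff sqint_tail sqint_funpow_avg)

text \<open>If the section is not integrable, then neither is its difference with a constant, and
  both integrals are 0 by convention. Hence \<open>avg_mdiff\<close> holds at every point, as
  \<open>char_mds_sum_bound\<close> requires.\<close>

lemma avg_minus_avg_tail: "avg (\<lambda>s. g s - avg g (tail s)) s = (0::real)"
proof (cases "integrable M (\<lambda>y. g (case_nat y s))")
  case True
  then show ?thesis by (simp add: avg_def M.prob_space)
next
  case False
  have "\<not> integrable M (\<lambda>y. g (case_nat y s) - avg g s)"
  proof
    assume "integrable M (\<lambda>y. g (case_nat y s) - avg g s)"
    then have "integrable M (\<lambda>y. (g (case_nat y s) - avg g s) + avg g s)" by (rule Bochner_Integration.integrable_add) simp
    with False show False by simp
  qed
  then have "(\<integral>y. g (case_nat y s) - avg g s \<partial>M) = 0" by (rule not_integrable_integral_eq)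
  then show ?thesis by (simp add: avg_def)
qed

lemma avg_mdiff: "avg (mdiff g j) s = 0"
  using avg_minus_avg_tail[of "(avg ^^ j) g"] by (simp add: mdiff_def[abs_def])

lemma mds_mdiff: "sqint S g \<Longrightarrow> mds (mdiff g j)"
  by (simp add: mds_def sqint_mdiff avg_mdiff)

lemma mds_diff:
  assumes "mds g" "mds h"
  shows "mds (\<lambda>s. g s - h s)"
proof -
  have int: "integrable S g" "integrable S h"
    using assms by (auto simp: mds_def intro: sqint_integrable[OF finite_measure_S])
  have "AE s in S. avg g s = 0" "AE s in S. avg h s = 0" using assms by (auto simp: mds_def)
  with AE_integrable_avg[OF int(1)] AE_integrable_avg[OF int(2)]
  have "AE s in S. avg (\<lambda>s. g s - h s) s = 0"
    by eventually_elim (simp add: avg_def)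
  then show ?thesis using assms by (simp add: mds_def sqint_diff)
qed

lemma mds_scale:
  assumes "mds g"
  shows "mds (\<lambda>s. c * g s)"
proof -
  have "avg (\<lambda>s. c * g s) s = c * avg g s" for s by (simp add: avg_def)
  then show ?thesis using assms by (simp add: mds_def sqint_scale)
qed

text \<open>Conditional expectations given older and older pasts telescope. For mean zero the last
  term vanishes in L2 as \<open>J\<close> grows, by \<open>norm_L2_funpow_avg_lim\<close>.\<close>

lemma mdiff_telescope:
  "g s = (\<Sum>j<J. mdiff g j ((tail ^^ j) s)) + (avg ^^ J) g ((tail ^^ J) s)"
  by (induction J) (simp_all add: mdiff_def)

lemma norm_L2_mdiff_diff:
  assumes g: "sqint S g" and h: "sqint S h"
  shows "norm_L2 S (\<lambda>s. mdiff g j s - mdiff h j s) \<le> 2 * norm_L2 S (\<lambda>s. g s - h s)"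
proof -
  let ?d = "\<lambda>j s. (avg ^^ j) g s - (avg ^^ j) h s"
  have sq: "sqint S (?d j)" for j by (intro sqint_diff sqint_funpow_avg g h)
  have "norm_L2 S (\<lambda>s. mdiff g j s - mdiff h j s) = norm_L2 S (\<lambda>s. ?d j s - ?d (Suc j) (tail s))"
    by (simp add: mdiff_def algebra_simps)
  also have "\<dots> \<le> norm_L2 S (?d j) + norm_L2 S (\<lambda>s. ?d (Suc j) (tail s))"
    by (rule norm_L2_diff_triangle[OF sq sqint_tail[OF sq]])
  also have "norm_L2 S (\<lambda>s. ?d (Suc j) (tail s)) = norm_L2 S (?d (Suc j))"
    by (rule norm_L2_tail[OF sqint_measurable[OF sq]])
  also have "norm_L2 S (?d j) + norm_L2 S (?d (Suc j)) \<le> norm_L2 S (\<lambda>s. g s - h s) + norm_L2 S (\<lambda>s. g s - h s)"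
    by (intro add_mono norm_L2_funpow_avg_diff g h)
  finally show ?thesis by simp
qed

text \<open>By orthogonality only the sum of the squared weights counts, and it is at most
  \<open>C^2\<close>. The common lag \<open>j\<close> is removed by stationarity, so the bound is
  uniform in \<open>n\<close> and \<open>j\<close>.\<close>

lemma norm_L2_weighted_mds_sum:
  assumes h: "mds h" and b: "\<And>p. p < n \<Longrightarrow> \<bar>b p\<bar> \<le> C / sqrt (real n)" and C: "0 \<le> C"
  shows "norm_L2 S (\<lambda>s. \<Sum>p<n. b p * h ((tail ^^ (p + j)) s)) \<le> C * norm_L2 S h"
proof -
  have sq: "sqint S h" using h by (simp add: mds_def)
  have [measurable]: "h \<in> borel_measurable S" using sq by (simp add: sqint_def)
  have "(\<lambda>s. \<Sum>p<n. b p * h ((tail ^^ (p + j)) s)) = (\<lambda>s. (\<lambda>s. \<Sum>p<n. b p * h ((tail ^^ p) s)) ((tail ^^ j) s))"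
    by (simp add: funpow_add)
  then have "norm_L2 S (\<lambda>s. \<Sum>p<n. b p * h ((tail ^^ (p + j)) s)) = norm_L2 S (\<lambda>s. \<Sum>p<n. b p * h ((tail ^^ p) s))"
    by (simp only:) (rule norm_L2_funpow_tail, measurable)
  also have "\<dots> \<le> C * norm_L2 S h"
  proof (rule power2_le_imp_le)
    have "(norm_L2 S (\<lambda>s. \<Sum>p<n. b p * h ((tail ^^ p) s)))\<^sup>2 = (\<Sum>p<n. \<integral>s. (b p * h s)\<^sup>2 \<partial>S)"
      unfolding norm_L2_sq by (rule integral_square_sum_mds[of n "\<lambda>p s. b p * h s"]) (rule mds_scale[OF h])
    also have "\<dots> = (\<Sum>p<n. (b p)\<^sup>2 * (norm_L2 S h)\<^sup>2)"
      by (simp add: power_mult_distrib norm_L2_sq)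
    also have "\<dots> \<le> (\<Sum>p<n. (C / sqrt (real n))\<^sup>2 * (norm_L2 S h)\<^sup>2)"
    proof (intro sum_mono mult_right_mono)
      fix p assume "p \<in> {..<n}"
      then have "\<bar>b p\<bar> \<le> \<bar>C / sqrt (real n)\<bar>" using b[of p] C by simp
      then show "(b p)\<^sup>2 \<le> (C / sqrt (real n))\<^sup>2" by (simp only: abs_le_square_iff)
    qed simp
    also have "\<dots> \<le> (C * norm_L2 S h)\<^sup>2"
      by (cases "n = 0") (simp_all add: power_mult_distrib power_divide)
    finally show "(norm_L2 S (\<lambda>s. \<Sum>p<n. b p * h ((tail ^^ p) s)))\<^sup>2 \<le> (C * norm_L2 S h)\<^sup>2" .
  qed (simp add: C norm_L2_nonneg)
  finally show ?thesis .
qed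

text \<open>Telescoping to depth \<open>k + J\<close> leaves the lags beyond \<open>J\<close>, each
  bounded by \<open>norm_L2_weighted_mds_sum\<close>, and a remainder that disappears as
  \<open>k\<close> grows. The result is the tail of the summable series, uniformly in
  \<open>n\<close>.\<close>

lemma norm_L2_weighted_sum_truncate:
  assumes G: "sqint S G" "(\<integral>s. G s \<partial>S) = 0" and sm: "summable (\<lambda>j. norm_L2 S (mdiff G j))"
    and b: "\<And>p. p < n \<Longrightarrow> \<bar>b p\<bar> \<le> C / sqrt (real n)" and C: "0 \<le> C"
  shows "norm_L2 S (\<lambda>s. (\<Sum>p<n. b p * G ((tail ^^ p) s)) - (\<Sum>j<J. \<Sum>p<n. b p * mdiff G j ((tail ^^ (p + j)) s)))
     \<le> C * (\<Sum>j. norm_L2 S (mdiff G (j + J)))"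
proof -
  let ?m = "\<lambda>j s. \<Sum>p<n. b p * mdiff G j ((tail ^^ (p + j)) s)"
  let ?D = "\<lambda>s. (\<Sum>p<n. b p * G ((tail ^^ p) s)) - (\<Sum>j<J. ?m j s)"
  let ?B = "\<Sum>p<n. \<bar>b p\<bar>"
  have sqm: "sqint S (?m j)" for j
    by (intro sqint_sum sqint_scale sqint_funpow_tail sqint_mdiff G)
  have sqa: "sqint S (\<lambda>s. b p * (avg ^^ K) G ((tail ^^ (p + K)) s))" for K p
    by (intro sqint_scale sqint_funpow_tail sqint_funpow_avg G)
  have le: "norm_L2 S ?D \<le> (\<Sum>j<k. C * norm_L2 S (mdiff G (j + J))) + ?B * norm_L2 S ((avg ^^ (k + J)) G)" for k
  proof -
    let ?K = "k + J"
    let ?r = "\<lambda>s. \<Sum>p<n. b p * (avg ^^ ?K) G ((tail ^^ (p + ?K)) s)"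
    have "(\<Sum>p<n. b p * G ((tail ^^ p) s)) = (\<Sum>p<n. \<Sum>j<?K. b p * mdiff G j ((tail ^^ (p + j)) s))
        + ?r s" for s
    proof -
      have "b p * G ((tail ^^ p) s) = (\<Sum>j<?K. b p * mdiff G j ((tail ^^ (p + j)) s)) + b p * (avg ^^ ?K) G ((tail ^^ (p + ?K)) s)" for p
        by (subst mdiff_telescope[of G _ ?K]) (simp add: distrib_left sum_distrib_left add.commute[of p] funpow_add)
      then show ?thesis by (simp add: sum.distrib)
    qed
    moreover have "(\<Sum>p<n. \<Sum>j<?K. b p * mdiff G j ((tail ^^ (p + j)) s)) = (\<Sum>j<?K. ?m j s)" for s
      by (rule sum.swap)
    moreover have "(\<Sum>j<?K. a j) = (\<Sum>j<J. a j) + (\<Sum>j<k. a (j + J))" for a :: "nat \<Rightarrow> real"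
      by (subst add.commute[of k J]) (simp add: sum.nat_group lessThan_atLeast0 sum.atLeastLessThan_concat[of 0 J "J + k" a, symmetric] sum.shift_bounds_nat_ivl[of a 0 J k, simplified, symmetric] add.commute)
    ultimately have D: "?D = (\<lambda>s. (\<Sum>j<k. ?m (j + J) s)
        + ?r s)"
      by (simp add: fun_eq_iff)
    have "norm_L2 S ?D \<le> norm_L2 S (\<lambda>s. \<Sum>j<k. ?m (j + J) s)
        + norm_L2 S ?r"
      unfolding D by (intro norm_L2_triangle sqint_sum sqm sqa)
    also have "norm_L2 S (\<lambda>s. \<Sum>j<k. ?m (j + J) s)
        \<le> (\<Sum>j<k. C * norm_L2 S (mdiff G (j + J)))"
      by (intro order_trans[OF norm_L2_sum_le] sum_mono norm_L2_weighted_mds_sum mds_mdiff G b C sqm)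
    also have "norm_L2 S ?r
        \<le> (\<Sum>p<n. norm_L2 S (\<lambda>s. b p * (avg ^^ ?K) G ((tail ^^ (p + ?K)) s)))"
      by (rule norm_L2_sum_le[OF sqa])
    also have "\<dots> = (\<Sum>p<n. \<bar>b p\<bar> * norm_L2 S ((avg ^^ ?K) G))"
      using norm_L2_funpow_tail[OF sqint_measurable[OF sqint_funpow_avg(1)[OF G(1)]]]
      by (simp add: norm_L2_scale)
    also have "\<dots> = ?B * norm_L2 S ((avg ^^ ?K) G)" by (simp add: sum_distrib_right)
    finally show ?thesis by simp
  qed
  \<comment> \<open>Here \<open>n\<close> is fixed and only \<open>k\<close> grows, so the crude
    factor \<open>?B\<close> in front of the vanishing remainder is harmless.\<close>
  have "(\<lambda>k. (\<Sum>j<k. C * norm_L2 S (mdiff G (j + J))) + ?B * norm_L2 S ((avg ^^ (k + J)) G))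
      \<longlonglongrightarrow> C * (\<Sum>j. norm_L2 S (mdiff G (j + J))) + ?B * 0"
    by (intro tendsto_add tendsto_mult tendsto_const LIMSEQ_ignore_initial_segment norm_L2_funpow_avg_lim G)
       (simp add: sum_distrib_left[symmetric], intro tendsto_mult tendsto_const summable_LIMSEQ summable_ignore_initial_segment sm)
  then show ?thesis
    by (intro LIMSEQ_le_const[where X="\<lambda>k. (\<Sum>j<k. C * norm_L2 S (mdiff G (j + J))) + ?B * norm_L2 S ((avg ^^ (k + J)) G)"]) (use le in auto)
qed

text \<open>The normal law of comparison has the second moment of \<open>f\<close> itself, so the
  limit theorem can be stated without convergence of the variances.\<close>

abbreviation char_gap :: "((nat \<Rightarrow> 'b) \<Rightarrow> real) \<Rightarrow> complex" where
  "char_gap f \<equiv> (\<integral>s. iexp (f s) \<partial>S) - exp (- (\<integral>s. (f s)\<^sup>2 \<partial>S) / 2)"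

text \<open>Each half of \<open>char_gap\<close> moves by at most the L2 distance:
  \<open>iexp\<close> is 1-Lipschitz, and the Gaussian half is 1-Lipschitz in the standard
  deviation.\<close>

lemma char_L2_perturbation:
  assumes "sqint S f" "sqint S g"
  shows "cmod (char_gap f)
    \<le> cmod (char_gap g) + 2 * norm_L2 S (\<lambda>s. f s - g s)"
proof -
  note [measurable] = assms[THEN sqint_measurable]
  have sq: "sqint S (\<lambda>s. f s - g s)" by (rule sqint_diff[OF assms])
  have int: "integrable S (\<lambda>s. iexp (f s))" "integrable S (\<lambda>s. iexp (g s))"
    by (auto intro!: P.integrable_const_bound[where B=1])
  have lip: "cmod (iexp a - iexp b) \<le> \<bar>a - b\<bar>" for a b :: real
  proof -
    have "iexp a - iexp b = iexp b * (iexp (a - b) - 1)" by (simp add: algebra_simps exp_diff exp_minus field_simps)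
    then have "cmod (iexp a - iexp b) = cmod (iexp (a - b) - 1)" by (simp add: norm_mult)
    also have "\<dots> \<le> \<bar>a - b\<bar>" using iexp_approx1[of "a - b" 0] by simp
    finally show ?thesis .
  qed
  have "cmod ((\<integral>s. iexp (f s) \<partial>S) - (\<integral>s. iexp (g s) \<partial>S)) = cmod (\<integral>s. iexp (f s) - iexp (g s) \<partial>S)"
    using int by simp
  also have "\<dots> \<le> (\<integral>s. \<bar>f s - g s\<bar> \<partial>S)"
    using int sqint_integrable[OF finite_measure_S sq]
    by (intro order_trans[OF integral_norm_bound integral_mono] lip) auto
  also have "\<dots> \<le> norm_L2 S (\<lambda>s. f s - g s)" by (rule P.integral_abs_le_norm_L2[OF sq])
  finally have 1: "cmod ((\<integral>s. iexp (f s) \<partial>S) - (\<integral>s. iexp (g s) \<partial>S)) \<le> norm_L2 S (\<lambda>s. f s - g s)" .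
  have "\<bar>exp (- (norm_L2 S f)\<^sup>2 / 2) - exp (- (norm_L2 S g)\<^sup>2 / 2)\<bar> \<le> \<bar>norm_L2 S f - norm_L2 S g\<bar>"
    by (intro exp_half_square_lipschitz norm_L2_nonneg)
  also have "\<dots> \<le> norm_L2 S (\<lambda>s. f s - g s)" by (rule norm_L2_abs_diff[OF assms])
  finally have 2: "cmod (complex_of_real (exp (- (\<integral>s. (g s)\<^sup>2 \<partial>S) / 2)) - exp (- (\<integral>s. (f s)\<^sup>2 \<partial>S) / 2)) \<le> norm_L2 S (\<lambda>s. f s - g s)"
    unfolding norm_L2_sq of_real_diff[symmetric] norm_of_real by (simp add: abs_minus_commute)
  have tri: "cmod (a - b) \<le> cmod (a' - b') + (cmod (a - a') + cmod (b' - b))" for a b a' b' :: complex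
    using norm_triangle_ineq[of "a - a'" "b' - b"] norm_triangle_ineq[of "a' - b'" "(a - a') + (b' - b)"] by simp
  show ?thesis
    using tri[of "\<integral>s. iexp (f s) \<partial>S" "exp (- (\<integral>s. (f s)\<^sup>2 \<partial>S) / 2)" "\<integral>s. iexp (g s) \<partial>S" "exp (- (\<integral>s. (g s)\<^sup>2 \<partial>S) / 2)"] 1 2
    by linarith
qed

lemma bounded_funpow_avg:
  assumes g: "g \<in> borel_measurable S" and B: "\<And>s. \<bar>g s\<bar> \<le> (B::real)"
  shows "(avg ^^ k) g \<in> borel_measurable S" "\<bar>(avg ^^ k) g s\<bar> \<le> B"
proof -
  have "(avg ^^ k) g \<in> borel_measurable S \<and> (\<forall>s. \<bar>(avg ^^ k) g s\<bar> \<le> B)"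
    by (induction k) (auto simp: g B avg_measurable bounded_avg)
  then show "(avg ^^ k) g \<in> borel_measurable S" "\<bar>(avg ^^ k) g s\<bar> \<le> B" by auto
qed

text \<open>Grouping the double sum by the total lag \<open>r = p + j\<close> leaves one bounded
  martingale difference per time, a cylinder function of fixed depth, so
  \<open>char_mds_sum_bound\<close> applies.\<close>

lemma char_weighted_mdiff_lim:
  fixes J :: nat
  assumes h: "h \<in> borel_measurable S" "\<And>s. \<bar>h s\<bar> \<le> B" "depends_upto m h"
    and b: "\<And>n p. p < n \<Longrightarrow> \<bar>b n p\<bar> \<le> C / sqrt (real n)"
  defines "\<Psi> \<equiv> \<lambda>n s. \<Sum>j<J. \<Sum>p<n. b n p * mdiff h j ((tail ^^ (p + j)) s)"
  shows "(\<lambda>n. cmod (char_gap (\<Psi> n))) \<longlonglongrightarrow> 0"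
proof -
  have B0: "0 \<le> B" using h(2)[of undefined] abs_ge_zero order_trans by blast
  have C0: "0 \<le> C" using b[of 0 1] by simp
  \<comment> \<open>There are \<open>J\<close> terms per time, each with weight at most
    \<open>C / sqrt n\<close> and a difference bounded by \<open>2 * B\<close>.\<close>
  define D where "D = real J * (C * (2 * B))"
  have D0: "0 \<le> D" unfolding D_def using B0 C0 by simp
  define c where "c n = D / sqrt (real n)" for n :: nat
  define N where "N n = n + J" for n
  \<comment> \<open>The weight of lag \<open>j\<close> at total lag \<open>r\<close> is
    \<open>b n (r - j)\<close>, or zero outside the window; \<open>N n = n + J\<close> covers every
    \<open>p + j\<close>.\<close>
  define w where "w n r j = (if j \<le> r \<and> r - j < n then b n (r - j) else 0)" for n r j
  define x where "x n r s = (\<Sum>j<J. w n r j * mdiff h j s)" for n r s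
  have w: "\<bar>w n r j\<bar> \<le> C / sqrt (real n)" for n r j
    using b[of "r - j" n] C0 by (simp add: w_def)
  have mb: "\<bar>mdiff h j s\<bar> \<le> 2 * B" for j s
    using bounded_funpow_avg(2)[OF h(1,2), of j s] bounded_funpow_avg(2)[OF h(1,2), of "Suc j" "tail s"]
    unfolding mdiff_def by linarith
  have mmeas [measurable]: "mdiff h j \<in> borel_measurable S" for j
    using bounded_funpow_avg(1)[OF h(1,2)] unfolding mdiff_def by measurable
  have md: "depends_upto (Suc m) (mdiff h j)" for j
  proof -
    \<comment> \<open>The composition with \<open>tail\<close> adds one coordinate even after
      averaging has removed all; \<open>Suc m\<close> is a depth valid for every
      \<open>j\<close>.\<close>
    have "depends_upto (max (m - j) (Suc (m - Suc j))) (mdiff h j)"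
      unfolding mdiff_def by (intro depends_upto_comp2[where h="(-)"] depends_upto_tail depends_upto_funpow_avg h)
    then show ?thesis by (rule depends_upto_mono) auto
  qed
  have xb: "\<bar>x n r s\<bar> \<le> c n" for n r s
  proof -
    have "\<bar>x n r s\<bar> \<le> (\<Sum>j<J. \<bar>w n r j * mdiff h j s\<bar>)" unfolding x_def by (rule sum_abs)
    also have "\<dots> \<le> (\<Sum>j<J. C / sqrt (real n) * (2 * B))"
      unfolding abs_mult using C0 by (intro sum_mono mult_mono w mb) auto
    finally show ?thesis by (simp add: c_def D_def)
  qed
  have xm: "x n r \<in> borel_measurable S" for n r unfolding x_def by measurable
  have xd: "depends_upto (Suc m) (x n r)" for n r
    unfolding x_def by (rule depends_upto_sum) (rule depends_upto_comp[OF md])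
  have intm: "integrable M (\<lambda>y. mdiff h j (case_nat y s))" for j s
    using integrable_section[OF mmeas, of j "2 * B" s] mb by simp
  have xa: "avg (x n r) s = 0" for n r s
  proof -
    have "avg (x n r) s = (\<Sum>j<J. w n r j * avg (mdiff h j) s)"
      unfolding avg_def x_def
      by (subst Bochner_Integration.integral_sum) (simp_all add: intm)
    then show ?thesis by (simp add: avg_mdiff)
  qed
  have eq: "\<Psi> n s = (\<Sum>r<N n. x n r ((tail ^^ r) s))" for n s
  proof -
    have "(\<Sum>r<N n. x n r ((tail ^^ r) s)) = (\<Sum>j<J. \<Sum>r<N n. w n r j * mdiff h j ((tail ^^ r) s))"
      unfolding x_def by (rule sum.swap)
    also have "\<dots> = (\<Sum>j<J. \<Sum>p<n. b n p * mdiff h j ((tail ^^ (p + j)) s))"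
    proof (rule sum.cong[OF refl])
      fix j assume "j \<in> {..<J}"
      then have "(\<Sum>r<N n. w n r j * mdiff h j ((tail ^^ r) s)) = (\<Sum>r\<in>{0+j..<n+j}. w n r j * mdiff h j ((tail ^^ r) s))"
        by (intro sum.mono_neutral_right) (auto simp: w_def N_def)
      also have "\<dots> = (\<Sum>p<n. w n (p + j) j * mdiff h j ((tail ^^ (p + j)) s))"
        unfolding sum.shift_bounds_nat_ivl lessThan_atLeast0 ..
      finally show "(\<Sum>r<N n. w n r j * mdiff h j ((tail ^^ r) s)) = (\<Sum>p<n. b n p * mdiff h j ((tail ^^ (p + j)) s))"
        by (simp add: w_def)
    qed
    finally show ?thesis by (simp add: \<Psi>_def)
  qed
  have c_lim: "c \<longlonglongrightarrow> 0" unfolding c_def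
    by (intro tendsto_divide_0[OF tendsto_const] filterlim_at_top_imp_at_infinity
        filterlim_compose[OF sqrt_at_top filterlim_real_sequentially])
  have Nc_lim: "(\<lambda>n. real (N n) * (c n)\<^sup>2) \<longlonglongrightarrow> D\<^sup>2"
  proof -
    have "(\<lambda>n. (1 + real J / real n) * D\<^sup>2) \<longlonglongrightarrow> (1 + 0) * D\<^sup>2"
      by (intro tendsto_intros lim_const_over_n)
    then have 1: "(\<lambda>n. (1 + real J / real n) * D\<^sup>2) \<longlonglongrightarrow> D\<^sup>2" by (simp only: add_0_right mult_1)
    have 2: "\<forall>\<^sub>F n in sequentially. (1 + real J / real n) * D\<^sup>2 = real (N n) * (c n)\<^sup>2"
      using eventually_gt_at_top[of 0] by eventually_elim (simp add: c_def N_def power_divide field_simps)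
    from 1 2 show ?thesis by (rule Lim_transform_eventually)
  qed
  \<comment> \<open>The error of \<open>char_mds_sum_bound\<close>, regrouped into powers of
    \<open>N * c^2\<close>, which tends to \<open>D^2\<close>, and spare factors \<open>c\<close>,
    which tend to 0.\<close>
  define u where "u n = exp (real (N n) * (c n)\<^sup>2 / 2) * (2 * (real (N n) * (c n)\<^sup>2) * c n
     + sqrt (2 * real (Suc m)) * (sqrt (real (N n) * (c n)\<^sup>2) * c n) / 2)" for n
  have "u \<longlonglongrightarrow> exp (D\<^sup>2 / 2) * (2 * D\<^sup>2 * 0 + sqrt (2 * real (Suc m)) * (sqrt (D\<^sup>2) * 0) / 2)"
    unfolding u_def by (intro tendsto_intros Nc_lim c_lim) simp_all
  then have u_lim: "u \<longlonglongrightarrow> 0" by simp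
  show ?thesis
  proof (rule tendsto_sandwich[OF _ _ tendsto_const u_lim])
    show "\<forall>\<^sub>F n in sequentially. cmod (char_gap (\<Psi> n)) \<le> u n"
      using order_tendstoD(2)[OF c_lim zero_less_one]
    proof eventually_elim
      case (elim n)
      have c0: "0 \<le> c n" using D0 by (simp add: c_def)
      have "cmod (char_gap (\<Psi> n))
        \<le> exp (real (N n) * (c n)\<^sup>2 / 2) * (2 * real (N n) * (c n) ^ 3 + (c n)\<^sup>2 * sqrt (real (N n * (2 * Suc m))) / 2)"
        unfolding eq using elim by (intro char_mds_sum_bound xm xb xa xd) simp
      also have "\<dots> = u n"
      proof -
        have gen: "e * (2 * k * a ^ 3 + a\<^sup>2 * (q * r) / 2) = e * (2 * (k * a\<^sup>2) * a + q * (r * a * a) / 2)" for e k a q r :: real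
          by (simp add: power2_eq_square power3_eq_cube)
        have "sqrt (real (N n * (2 * Suc m))) = sqrt (2 * real (Suc m)) * sqrt (real (N n))"
          by (simp only: of_nat_mult of_nat_numeral real_sqrt_mult mult_ac)
        moreover have "sqrt (real (N n) * (c n)\<^sup>2) = sqrt (real (N n)) * c n"
          using c0 by (simp only: real_sqrt_mult real_sqrt_abs abs_of_nonneg)
        ultimately show ?thesis
          unfolding u_def by (simp only: gen)
      qed
      finally show ?case .
    qed
  qed simp
qed

text \<open>Truncation at lag \<open>J\<close> and replacement of \<open>G\<close> by a bounded
  cylinder function each cost an L2 error that does not depend on \<open>n\<close>; the remaining
  sum is covered by \<open>char_weighted_mdiff_lim\<close>.\<close>

theorem char_weighted_shift_sum_tendsto:
  assumes G: "sqint S G" "(\<integral>s. G s \<partial>S) = 0" and sm: "summable (\<lambda>j. norm_L2 S (mdiff G j))"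
    and b: "\<And>n p. p < n \<Longrightarrow> \<bar>b n p\<bar> \<le> C / sqrt (real n)"
  defines "\<Phi> \<equiv> \<lambda>n s. \<Sum>p<n. b n p * G ((tail ^^ p) s)"
  shows "(\<lambda>n. char_gap (\<Phi> n)) \<longlonglongrightarrow> 0"
proof (rule LIMSEQ_I)
  fix \<epsilon> :: real assume e: "\<epsilon> > 0"
  have C0: "0 \<le> C" using b[of 0 1] by simp
  define \<eta> where "\<eta> = \<epsilon> / (8 * (C + 1))"
  have eta: "\<eta> > 0" "C * \<eta> \<le> \<epsilon> / 8" using e C0 by (auto simp: \<eta>_def field_simps)
  obtain J where J: "norm (\<Sum>j. norm_L2 S (mdiff G (j + J))) < \<eta>"
    using suminf_exist_split[OF eta(1) sm] by blast
  \<comment> \<open>Chosen after \<open>J\<close>: the replacement affects \<open>J\<close>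
    differences, at a cost of at most \<open>C * (2 * \<delta>)\<close> each. The added ones keep
    the denominator positive.\<close>
  define \<delta> where "\<delta> = \<epsilon> / (16 * (real J + 1) * (C + 1))"
  have d: "\<delta> > 0" using e C0 by (simp add: \<delta>_def)
  have dle: "real J * (C * (2 * \<delta>)) \<le> \<epsilon> / 8"
  proof -
    have "real J * C \<le> (real J + 1) * (C + 1)" using C0 by (intro mult_mono) auto
    then have "real J * C * (2 * \<delta>) \<le> (real J + 1) * (C + 1) * (2 * \<delta>)" using d by (intro mult_right_mono) auto
    also have "\<dots> = \<epsilon> / 8"
    proof -
      have "(real J + 1) * (C + 1) \<noteq> 0" using C0 by simp
      then show ?thesis unfolding \<delta>_def mult.assoc[of 16] by (simp add: divide_simps)
    qed
    finally show ?thesis by (simp add: mult_ac)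
  qed
  obtain h B m where h: "h \<in> borel_measurable S" "\<forall>s. \<bar>h s\<bar> \<le> B" "depends_upto m h"
    "norm_L2 S (\<lambda>s. G s - h s) < \<delta>" by (rule cylinder_approxE[OF sqint_cylinder_approx[OF G(1)] d])
  note h = h(1) h(2)[rule_format] h(3,4)
  have sqh: "sqint S h" by (rule sqint_bounded[OF finite_measure_S h(1,2)])
  define \<Psi> where "\<Psi> n s = (\<Sum>j<J. \<Sum>p<n. b n p * mdiff h j ((tail ^^ (p + j)) s))" for n s
  define \<Psi>' where "\<Psi>' n s = (\<Sum>j<J. \<Sum>p<n. b n p * mdiff G j ((tail ^^ (p + j)) s))" for n s
  have sq: "sqint S (\<Phi> n)" "sqint S (\<Psi> n)" "sqint S (\<Psi>' n)" for n
    unfolding \<Phi>_def \<Psi>_def[abs_def] \<Psi>'_def[abs_def] by (intro sqint_sum sqint_scale sqint_funpow_tail sqint_mdiff G sqh)+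
  have diff: "norm_L2 S (\<lambda>s. \<Phi> n s - \<Psi> n s) \<le> \<epsilon> / 4" for n
  proof -
    have "norm_L2 S (\<lambda>s. \<Phi> n s - \<Psi>' n s) \<le> C * (\<Sum>j. norm_L2 S (mdiff G (j + J)))"
      unfolding \<Phi>_def \<Psi>'_def by (intro norm_L2_weighted_sum_truncate G sm b C0)
    also have "\<dots> \<le> C * \<eta>" using J C0 by (intro mult_left_mono) auto
    finally have 1: "norm_L2 S (\<lambda>s. \<Phi> n s - \<Psi>' n s) \<le> \<epsilon> / 8" using eta(2) by simp
    have mm: "mds (\<lambda>s. mdiff G j s - mdiff h j s)" for j by (intro mds_diff mds_mdiff G sqh)
    let ?d = "\<lambda>j s. \<Sum>p<n. b n p * (mdiff G j ((tail ^^ (p + j)) s) - mdiff h j ((tail ^^ (p + j)) s))"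
    have "norm_L2 S (\<lambda>s. \<Psi>' n s - \<Psi> n s) = norm_L2 S (\<lambda>s. \<Sum>j<J. ?d j s)"
      unfolding \<Psi>'_def \<Psi>_def by (simp add: sum_subtractf right_diff_distrib)
    also have "\<dots> \<le> (\<Sum>j<J. norm_L2 S (?d j))"
      by (intro norm_L2_sum_le sqint_sum sqint_scale sqint_diff sqint_funpow_tail sqint_mdiff G sqh)
    also have "\<dots> \<le> (\<Sum>j<J. C * (2 * \<delta>))"
    proof (rule sum_mono)
      fix j
      have "norm_L2 S (?d j)
          \<le> C * norm_L2 S (\<lambda>s. mdiff G j s - mdiff h j s)"
        by (rule norm_L2_weighted_mds_sum[OF mm b C0])
      also have "\<dots> \<le> C * (2 * \<delta>)"
        using norm_L2_mdiff_diff[OF G(1) sqh, of j] h(4) C0 by (intro mult_left_mono) auto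
      finally show "norm_L2 S (?d j) \<le> C * (2 * \<delta>)" .
    qed
    finally have 2: "norm_L2 S (\<lambda>s. \<Psi>' n s - \<Psi> n s) \<le> \<epsilon> / 8" using dle by simp
    show ?thesis
      using norm_L2_triangle[OF sqint_diff[OF sq(1,3)] sqint_diff[OF sq(3,2)], of n n n n] 1 2 by simp
  qed
  have "(\<lambda>n. cmod (char_gap (\<Psi> n))) \<longlonglongrightarrow> 0"
    unfolding \<Psi>_def by (rule char_weighted_mdiff_lim[OF h(1,2,3) b])
  then have "\<forall>\<^sub>F n in sequentially. cmod (char_gap (\<Psi> n)) < \<epsilon> / 2"
    using e by (intro order_tendstoD(2)) auto
  then obtain no where no: "\<And>n. n \<ge> no \<Longrightarrow> cmod (char_gap (\<Psi> n)) < \<epsilon> / 2"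
    by (auto simp: eventually_sequentially)
  \<comment> \<open>The gap of \<open>\<Psi> n\<close> contributes less than
    \<open>\<epsilon> / 2\<close>, and the L2 error of at most \<open>\<epsilon> / 4\<close> counts
    twice.\<close>
  have "cmod (char_gap (\<Phi> n) - 0) < \<epsilon>" if "n \<ge> no" for n
    using char_L2_perturbation[OF sq(1,2), of n n] no[OF that] diff[of n] by (simp only: diff_0_right)
  then show "\<exists>no. \<forall>n\<ge>no. cmod (char_gap (\<Phi> n) - 0) < \<epsilon>" by blast
qed

end

section \<open>Causal processes driven by i.i.d.\ noise\<close>

lemma (in prob_space) indep_vars_reindex:
  assumes ind: "indep_vars M' X (f ` I)" and inj: "inj_on f I"
  shows "indep_vars (\<lambda>i. M' (f i)) (\<lambda>i. X (f i)) I"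
  unfolding indep_vars_def2 indep_sets_def
proof (intro conjI ballI allI impI)
  let ?F = "\<lambda>k. {X k -` A \<inter> space M | A. A \<in> sets (M' k)}"
  have F: "indep_sets ?F (f ` I)" and rv: "\<And>i. i \<in> I \<Longrightarrow> random_variable (M' (f i)) (X (f i))"
    using ind by (auto simp: indep_vars_def2)
  show "random_variable (M' (f i)) (X (f i))" if "i \<in> I" for i using rv that .
  show "?F (f i) \<subseteq> events" if "i \<in> I" for i using rv[OF that] by (auto intro: measurable_sets)
  fix J A assume J: "J \<subseteq> I" "J \<noteq> {}" "finite J" and A: "A \<in> Pi J (\<lambda>i. ?F (f i))"
  have injJ: "inj_on f J" using inj J(1) by (rule inj_on_subset)
  define B where "B k = A (the_inv_into J f k)" for k
  have B: "B (f j) = A j" if "j \<in> J" for j using the_inv_into_f_f[OF injJ that] by (simp add: B_def)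
  have "prob (\<Inter>k\<in>f ` J. B k) = (\<Prod>k\<in>f ` J. prob (B k))"
  proof (rule indep_setsD[OF F])
    show "f ` J \<subseteq> f ` I" "f ` J \<noteq> {}" "finite (f ` J)" using J by auto
    show "\<forall>k\<in>f ` J. B k \<in> ?F k"
    proof
      fix k assume "k \<in> f ` J"
      then obtain j where j: "j \<in> J" "k = f j" by auto
      have "A j \<in> ?F (f j)" using A j(1) by (rule Pi_mem)
      then show "B k \<in> ?F k" using B[OF j(1)] j(2) by simp
    qed
  qed
  then show "prob (\<Inter>j\<in>J. A j) = (\<Prod>j\<in>J. prob (A j))"
    by (simp add: prod.reindex[OF injJ] B cong: INF_cong_simp prod.cong_simp)
qed

locale iid_noise = prob_space M for M :: "'a measure" +
  fixes \<epsilon> :: "int \<Rightarrow> 'a \<Rightarrow> real"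
  assumes iid: "iid M \<epsilon> UNIV"
begin

section \<open>The law of the past of the noise\<close>

definition law :: "real measure" where
  "law = distr M borel (\<epsilon> 0)"

lemma indep_noise: "indep_vars (\<lambda>_. borel) \<epsilon> UNIV"
  using iid by (simp add: iid_def)

lemma noise_measurable [measurable]: "\<epsilon> k \<in> borel_measurable M"
  using indep_noise by (auto simp: indep_vars_def)

lemma distr_noise: "distr M borel (\<epsilon> k) = law"
  using iid unfolding iid_def law_def by auto

lemma prob_space_law: "prob_space law"
  unfolding law_def by (rule prob_space_distr) measurable

lemma space_law [simp]: "space law = UNIV" and sets_law [simp, measurable_cong]: "sets law = sets borel"
  by (auto simp: law_def)

sublocale shift: one_sided_shift law
proof -
  interpret law: prob_space law by (rule prob_space_law)
  interpret product_prob_space "\<lambda>i. law" "UNIV :: nat set" by unfold_locales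
  show "one_sided_shift law" by unfold_locales simp
qed

lemma sets_shift [measurable_cong]: "sets shift.S = sets (PiM UNIV (\<lambda>_. borel))"
  by (rule sets_PiM_cong) auto

lemma past_measurable' [measurable]: "past \<epsilon> k \<in> M \<rightarrow>\<^sub>M PiM UNIV (\<lambda>_. borel)"
  unfolding past_def by (rule measurable_PiM_single') auto

lemma past_measurable [measurable]: "past \<epsilon> k \<in> M \<rightarrow>\<^sub>M shift.S"
  using past_measurable' measurable_cong_sets[OF refl sets_shift] by blast

text \<open>Independence and equality of laws of the noise are condensed here; afterwards
  expectations of functions of one past become integrals over the shift, the same for every
  \<open>k\<close>.\<close>

lemma distr_past: "distr M shift.S (past \<epsilon> k) = shift.S"
proof -
  have ind: "indep_vars (\<lambda>_::nat. borel) (\<lambda>j. \<epsilon> (k - int j)) UNIV"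
    by (rule indep_vars_reindex[where f="\<lambda>j. k - int j" and M'="\<lambda>_. borel"])
       (auto simp: inj_on_def intro: indep_vars_subset[OF indep_noise])
  have "distr M (PiM UNIV (\<lambda>_. borel)) (\<lambda>w. \<lambda>j\<in>UNIV. \<epsilon> (k - int j) w) = PiM UNIV (\<lambda>j. distr M borel (\<epsilon> (k - int j)))"
    using indep_vars_iff_distr_eq_PiM[where M'="\<lambda>_. borel" and X="\<lambda>j. \<epsilon> (k - int j)" and I="UNIV :: nat set"] ind by simp
  then have "distr M (PiM UNIV (\<lambda>_. borel)) (past \<epsilon> k) = shift.S"
    by (simp add: distr_noise past_def[abs_def] restrict_def)
  moreover have "distr M (PiM UNIV (\<lambda>_. borel)) (past \<epsilon> k) = distr M shift.S (past \<epsilon> k)"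
    by (rule distr_cong) (auto simp: sets_shift)
  ultimately show ?thesis by simp
qed

lemma integral_past:
  fixes g :: "(nat \<Rightarrow> real) \<Rightarrow> 'c::{banach, second_countable_topology}"
  assumes "g \<in> borel_measurable shift.S"
  shows "(\<integral>w. g (past \<epsilon> k w) \<partial>M) = (\<integral>s. g s \<partial>shift.S)"
  using integral_distr[OF past_measurable assms, of k] by (simp add: distr_past)

lemma integrable_past:
  fixes g :: "(nat \<Rightarrow> real) \<Rightarrow> 'c::{banach, second_countable_topology}"
  assumes "g \<in> borel_measurable shift.S"
  shows "integrable M (\<lambda>w. g (past \<epsilon> k w)) \<longleftrightarrow> integrable shift.S g"
  using integrable_distr_eq[OF past_measurable assms, of k] by (simp add: distr_past)

lemma past_shift: "past \<epsilon> (k - int d) w = (shift.tail ^^ d) (past \<epsilon> k w)"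
  by (simp add: shift.funpow_tail past_def fun_eq_iff algebra_simps)

section \<open>Conditional expectations and projections\<close>

lemma subalgebra_past: "subalgebra M (past_algebra M \<epsilon> k)"
  unfolding subalgebra_def past_algebra_def
  using measurable_sets[OF past_measurable'] by (auto simp: sets_vimage_algebra2 space_PiM)

lemma past_measurable_algebra: "past \<epsilon> k \<in> past_algebra M \<epsilon> k \<rightarrow>\<^sub>M shift.S"
proof -
  have "past \<epsilon> k \<in> past_algebra M \<epsilon> k \<rightarrow>\<^sub>M PiM UNIV (\<lambda>_. borel)"
    unfolding past_algebra_def by (rule measurable_vimage_algebra1) (auto simp: space_PiM)
  then show ?thesis using measurable_cong_sets[OF refl sets_shift] by blast
qed

lemma cond_exp_past:
  assumes g: "sqint shift.S g"
  shows "AE w in M. real_cond_exp M (past_algebra M \<epsilon> k) (\<lambda>w. g (past \<epsilon> (k + int j) w)) w = (shift.avg ^^ j) g (past \<epsilon> k w)"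
proof -
  have fin: "finite_measure_subalgebra M (past_algebra M \<epsilon> k)"
    by unfold_locales (rule subalgebra_past)
  interpret sigma_finite_subalgebra M "past_algebra M \<epsilon> k"
    by (rule finite_measure_subalgebra_is_sigma_finite[OF fin])
  have gm [measurable]: "g \<in> borel_measurable shift.S" using g by (simp add: sqint_def)
  have sqa: "sqint shift.S ((shift.avg ^^ j) g)" by (rule shift.sqint_funpow_avg[OF g])
  have gam [measurable]: "(shift.avg ^^ j) g \<in> borel_measurable shift.S" using sqa by (simp add: sqint_def)
  show ?thesis
  proof (rule real_cond_exp_charact)
    fix A assume "A \<in> sets (past_algebra M \<epsilon> k)"
    then obtain B where "B \<in> sets (PiM UNIV (\<lambda>_::nat. borel :: real measure))" and A: "A = past \<epsilon> k -` B \<inter> space M"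
      unfolding past_algebra_def by (auto simp: sets_vimage_algebra2 space_PiM)
    then have B [measurable]: "B \<in> sets shift.S" by (simp add: sets_shift)
    have sqB: "sqint shift.S (indicator B)" by (rule sqint_bounded[OF shift.finite_measure_S, of _ 1]) auto
    have ind: "indicator A w = (indicator B (past \<epsilon> k w) :: real)" if "w \<in> space M" for w
      using that by (auto simp: A split: split_indicator)
    have "(\<integral>w\<in>A. g (past \<epsilon> (k + int j) w) \<partial>M) = (\<integral>w. g (past \<epsilon> (k + int j) w) * indicator B ((shift.tail ^^ j) (past \<epsilon> (k + int j) w)) \<partial>M)"
      unfolding set_lebesgue_integral_def using past_shift[of "k + int j" j]
      by (intro Bochner_Integration.integral_cong) (simp_all add: ind)
    also have "\<dots> = (\<integral>s. g s * indicator B ((shift.tail ^^ j) s) \<partial>shift.S)"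
      by (rule integral_past[where g="\<lambda>s. g s * indicator B ((shift.tail ^^ j) s)"]) measurable
    also have "\<dots> = (\<integral>s. (shift.avg ^^ j) g s * indicator B s \<partial>shift.S)"
      by (rule shift.integral_mult_funpow_tail[OF g sqB])
    also have "\<dots> = (\<integral>w. (shift.avg ^^ j) g (past \<epsilon> k w) * indicator B (past \<epsilon> k w) \<partial>M)"
      by (rule integral_past[where g="\<lambda>s. (shift.avg ^^ j) g s * indicator B s", symmetric]) measurable
    also have "\<dots> = (\<integral>w\<in>A. (shift.avg ^^ j) g (past \<epsilon> k w) \<partial>M)"
      unfolding set_lebesgue_integral_def
      by (intro Bochner_Integration.integral_cong) (simp_all add: ind)
    finally show "(\<integral>w\<in>A. g (past \<epsilon> (k + int j) w) \<partial>M) = (\<integral>w\<in>A. (shift.avg ^^ j) g (past \<epsilon> k w) \<partial>M)" .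
  next
    show "integrable M (\<lambda>w. g (past \<epsilon> (k + int j) w))"
      unfolding integrable_past[OF gm] by (rule sqint_integrable[OF shift.finite_measure_S g])
    show "integrable M (\<lambda>w. (shift.avg ^^ j) g (past \<epsilon> k w))"
      unfolding integrable_past[OF gam] by (rule sqint_integrable[OF shift.finite_measure_S sqa])
    show "(\<lambda>w. (shift.avg ^^ j) g (past \<epsilon> k w)) \<in> borel_measurable (past_algebra M \<epsilon> k)"
      by (rule measurable_compose[OF past_measurable_algebra gam])
  qed
qed

lemma norm_L2_proj_op:
  assumes g: "sqint shift.S g"
  shows "norm_L2 M (proj_op M \<epsilon> 0 (\<lambda>w. g (past \<epsilon> (int j) w))) = norm_L2 shift.S (shift.mdiff g j)"
proof -
  have [measurable]: "shift.mdiff g j \<in> borel_measurable shift.S"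
    using shift.sqint_mdiff[OF g] by (simp add: sqint_def)
  have "AE w in M. proj_op M \<epsilon> 0 (\<lambda>w. g (past \<epsilon> (int j) w)) w = shift.mdiff g j (past \<epsilon> 0 w)"
    \<comment> \<open>Time \<open>j\<close> lies \<open>j\<close> steps after 0 and
      \<open>Suc j\<close> steps after -1, which are the two terms of \<open>mdiff\<close>.\<close>
    using cond_exp_past[OF g, of 0 j] cond_exp_past[OF g, of "-1" "Suc j"]
  proof eventually_elim
    case (elim w)
    have "past \<epsilon> (-1) w = shift.tail (past \<epsilon> 0 w)" using past_shift[of 0 1 w] by simp
    then show ?case using elim by (simp add: proj_op_def shift.mdiff_def)
  qed
  then have "(\<integral>w. \<bar>proj_op M \<epsilon> 0 (\<lambda>w. g (past \<epsilon> (int j) w)) w\<bar>\<^sup>2 \<partial>M) = (\<integral>w. \<bar>shift.mdiff g j (past \<epsilon> 0 w)\<bar>\<^sup>2 \<partial>M)"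
    by (intro integral_cong_AE) (auto simp: proj_op_def intro: measurable_from_subalg[OF subalgebra_past])
  also have "\<dots> = (\<integral>s. \<bar>shift.mdiff g j s\<bar>\<^sup>2 \<partial>shift.S)"
    by (rule integral_past[where g="\<lambda>s. \<bar>shift.mdiff g j s\<bar>\<^sup>2"]) measurable
  finally show ?thesis by (simp add: norm_L2_def)
qed

theorem char_weighted_sum_tendsto:
  fixes G :: "(nat \<Rightarrow> real) \<Rightarrow> real" and a :: "nat \<Rightarrow> int \<Rightarrow> real"
  assumes G: "G \<in> borel_measurable (PiM UNIV (\<lambda>_. borel))"
    and sq: "integrable M (\<lambda>w. \<bar>causal_process G \<epsilon> 0 w\<bar>\<^sup>2)" and mean: "(\<integral>w. causal_process G \<epsilon> 0 w \<partial>M) = 0"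
    and sm: "summable (\<lambda>j::nat. norm_L2 M (proj_op M \<epsilon> 0 (causal_process G \<epsilon> (int j))))"
    and a: "\<And>n k. \<bar>a n k\<bar> \<le> C / sqrt (real n)"
  defines "T \<equiv> \<lambda>n w. \<Sum>k=1..int n. a n k * causal_process G \<epsilon> k w"
  shows "(\<lambda>n. (\<integral>w. iexp (T n w) \<partial>M) - exp (- (\<integral>w. (T n w)\<^sup>2 \<partial>M) / 2)) \<longlonglongrightarrow> 0"
proof -
  have Gm [measurable]: "G \<in> borel_measurable shift.S"
    using G measurable_cong_sets[OF sets_shift refl] by blast
  have X: "causal_process G \<epsilon> k = (\<lambda>w. G (past \<epsilon> k w))" for k by (simp add: causal_process_def fun_eq_iff)
  have Gsq: "sqint shift.S G"
    using sq integrable_past[of "\<lambda>s. \<bar>G s\<bar>\<^sup>2" 0] by (simp add: X sqint_def)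
  have Gmean: "(\<integral>s. G s \<partial>shift.S) = 0"
    using mean integral_past[OF Gm, of 0] by (simp add: X)
  have Gsum: "summable (\<lambda>j. norm_L2 shift.S (shift.mdiff G j))"
    using sm by (simp add: X norm_L2_proj_op[OF Gsq])
  \<comment> \<open>The sum is read from its latest time \<open>n\<close> backwards,
    \<open>k = n - p\<close>, so that it becomes a function of a single past.\<close>
  define \<Phi> where "\<Phi> n s = (\<Sum>p<n. a n (int n - int p) * G ((shift.tail ^^ p) s))" for n s
  have [measurable]: "\<Phi> n \<in> borel_measurable shift.S" for n unfolding \<Phi>_def by measurable
  have T: "T n w = \<Phi> n (past \<epsilon> (int n) w)" for n w
    unfolding T_def \<Phi>_def X past_shift[symmetric]
    by (rule sum.reindex_bij_witness[of _ "\<lambda>p. int n - int p" "\<lambda>k. nat (int n - k)"]) auto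
  have 1: "(\<integral>w. iexp (T n w) \<partial>M) = (\<integral>s. iexp (\<Phi> n s) \<partial>shift.S)" for n
    unfolding T by (rule integral_past[where g="\<lambda>s. iexp (\<Phi> n s)"]) measurable
  have 2: "(\<integral>w. (T n w)\<^sup>2 \<partial>M) = (\<integral>s. (\<Phi> n s)\<^sup>2 \<partial>shift.S)" for n
    unfolding T by (rule integral_past[where g="\<lambda>s. (\<Phi> n s)\<^sup>2"]) measurable
  show ?thesis
    unfolding 1 2 \<Phi>_def by (rule shift.char_weighted_shift_sum_tendsto[OF Gsq Gmean Gsum]) (rule a)
qed

text \<open>Seen from the later of the two times, the product is a function of one past and of the
  lag alone, and the law of that past is the same at all times.\<close>

lemma covariance_causal_process:
  assumes G: "G \<in> borel_measurable (PiM UNIV (\<lambda>_. borel))"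
  shows "(\<integral>w. causal_process G \<epsilon> k w * causal_process G \<epsilon> k' w \<partial>M) = autocov M (causal_process G \<epsilon>) (k' - k)"
proof -
  have [measurable]: "G \<in> borel_measurable shift.S"
    using G measurable_cong_sets[OF sets_shift refl] by blast
  have *: "(\<integral>w. G (past \<epsilon> i w) * G (past \<epsilon> (i - int d) w) \<partial>M) = (\<integral>s. G s * G ((shift.tail ^^ d) s) \<partial>shift.S)" for i d
    unfolding past_shift by (rule integral_past[where g="\<lambda>s. G s * G ((shift.tail ^^ d) s)"]) measurable
  show ?thesis
  proof (cases "k' \<le> k")
    case True
    then show ?thesis using *[of k "nat (k - k')"] *[of 0 "nat (k - k')"]
      by (simp add: autocov_def causal_process_def)
  next
    case False
    then show ?thesis using *[of k' "nat (k' - k)"] *[of "k' - k" "nat (k' - k)"]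
      by (simp add: autocov_def causal_process_def mult.commute)
  qed
qed

end

section \<open>Trigonometric weights\<close>

text \<open>A geometric sum of an \<open>n\<close>-th root of unity, whose ratio is 1 exactly when
  \<open>n\<close> divides \<open>d\<close>.\<close>

lemma sum_cis_fourier:
  fixes d :: int
  assumes "n > 0"
  shows "(\<Sum>k=1..int n. cis (of_int k * (2 * pi * of_int d / real n))) = (if int n dvd d then of_nat n else 0)"
proof -
  define w where "w = cis (2 * pi * of_int d / real n)"
  have e: "cis (of_int k * (2 * pi * of_int d / real n)) = w ^ Suc (nat (k - 1))" if "1 \<le> k" for k
    using that unfolding w_def Complex.DeMoivre by simp
  have "(\<Sum>k=1..int n. cis (of_int k * (2 * pi * of_int d / real n))) = (\<Sum>k<n. w ^ Suc k)"
    by (rule sum.reindex_bij_witness[of _ "\<lambda>k. int k + 1" "\<lambda>k. nat (k - 1)"])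
       (auto simp: e simp del: times_divide_eq_right power_Suc)
  also have "\<dots> = w * (\<Sum>k<n. w ^ k)" by (simp add: sum_distrib_left)
  also have "\<dots> = (if int n dvd d then of_nat n else 0)"
  proof (cases "int n dvd d")
    case True
    then obtain e where "d = int n * e" by (auto simp: dvd_def)
    then have "2 * pi * of_int d / real n = 2 * pi * of_int e" using assms by simp
    then have "w = 1" unfolding w_def by (simp only: cis_multiple_2pi Ints_of_int)
    then show ?thesis using True by simp
  next
    case False
    have "w ^ n = cis (real n * (2 * pi * of_int d / real n))" by (simp only: w_def Complex.DeMoivre)
    also have "real n * (2 * pi * of_int d / real n) = 2 * pi * of_int d" using assms by simp
    finally have wn: "w ^ n = 1" by (simp only: cis_multiple_2pi Ints_of_int)
    have "w \<noteq> 1"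
    proof
      assume "w = 1"
      then have "cos (2 * pi * of_int d / real n) = 1" by (simp add: w_def complex_eq_iff)
      then obtain m where "2 * pi * of_int d / real n = of_int m * 2 * pi"
        unfolding cos_one_2pi_int by auto
      then have "real_of_int d = real_of_int (int n * m)" using assms by (simp add: field_simps)
      then have "d = int n * m" by linarith
      with False show False by simp
    qed
    then have "(\<Sum>k<n. w ^ k) = 0" using geometric_sum[of w n] wn by simp
    then show ?thesis using False by simp
  qed
  finally show ?thesis .
qed

lemma sum_rotate3: "(\<Sum>k\<in>A. \<Sum>i\<in>B. \<Sum>j\<in>C. f k i j) = (\<Sum>i\<in>B. \<Sum>j\<in>C. \<Sum>k\<in>A. f k i j)"
  by (subst sum.swap, intro sum.cong refl, rule sum.swap)

text \<open>As \<open>k + h\<close> is not cut off at \<open>n\<close>, every sum over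
  \<open>k\<close> covers a full period of an exponential. Sums of two frequencies never cancel
  modulo \<open>n\<close>, and differences do so only on the diagonal.\<close>

lemma circular_correlation:
  fixes l :: "nat \<Rightarrow> nat" and c :: "nat \<Rightarrow> complex" and h :: int
  assumes n: "n > 0" and fin: "finite I" and inj: "inj_on l I"
    and l: "\<And>j. j \<in> I \<Longrightarrow> 1 \<le> l j \<and> l j \<le> (n - 1) div 2"
  defines "a \<equiv> \<lambda>k::int. \<Sum>j\<in>I. Re (c j * cis (- (of_int k * fourier_freq n (l j))))"
  shows "(\<Sum>k=1..int n. a k * a (k + h)) = (\<Sum>j\<in>I. real n / 2 * (cmod (c j))\<^sup>2 * cos (of_int h * fourier_freq n (l j)))"
proof -
  let ?\<theta> = "\<lambda>j. fourier_freq n (l j)"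
  define z where "z k = (\<Sum>j\<in>I. c j * cis (- (of_int k * ?\<theta> j)))" for k :: int
  let ?e = "\<lambda>k d::int. cis (of_int k * (2 * pi * of_int d / real n))"
  let ?hh = "\<lambda>j. cis (- (of_int h * ?\<theta> j))"
  have a: "a k = Re (z k)" for k by (simp add: a_def z_def)
  \<comment> \<open>Separates the sums of frequencies, in \<open>z * z\<close>, from their
    differences, in \<open>cnj z * z\<close>.\<close>
  have prod: "a k * a k' = Re (z k * z k' + cnj (z k) * z k') / 2" for k k'
    by (simp add: a)
  have "(\<Sum>k=1..int n. z k * z (k + h)) = (\<Sum>k=1..int n. \<Sum>i\<in>I. \<Sum>j\<in>I. c i * c j * ?hh j * ?e k (- int (l i) - int (l j)))"
  proof (rule sum.cong[OF refl])
    fix k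
    have "cis (- (of_int k * ?\<theta> i)) * cis (- (of_int (k + h) * ?\<theta> j))
       = ?hh j * ?e k (- int (l i) - int (l j))" for i j
      unfolding cis_mult using n by (intro arg_cong[where f=cis]) (simp add: fourier_freq_def field_simps)
    then show "z k * z (k + h) = (\<Sum>i\<in>I. \<Sum>j\<in>I. c i * c j * ?hh j * ?e k (- int (l i) - int (l j)))"
      unfolding z_def sum_product by (intro sum.cong refl) (simp add: mult_ac)
  qed
  also have "\<dots> = (\<Sum>i\<in>I. \<Sum>j\<in>I. c i * c j * ?hh j * (\<Sum>k=1..int n. ?e k (- int (l i) - int (l j))))"
    unfolding sum_distrib_left by (rule sum_rotate3)
  also have "\<dots> = 0"
  proof (intro sum.neutral ballI)
    fix i j assume ij: "i \<in> I" "j \<in> I"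
    have "\<not> int n dvd - int (l i) - int (l j)"
    proof
      assume "int n dvd - int (l i) - int (l j)"
      then have "int n dvd int (l i + l j)" by (metis dvd_minus_iff minus_diff_eq diff_minus_eq_add of_nat_add add.commute)
      then have "n dvd l i + l j" by (simp only: int_dvd_int_iff)
      \<comment> \<open>The choice \<open>m = (n - 1) div 2\<close> is what keeps the sum of two
        indices strictly between 0 and \<open>n\<close>.\<close>
      moreover have "0 < l i + l j" "l i + l j < n" using l[OF ij(1)] l[OF ij(2)] n by linarith+
      ultimately show False by (auto dest: dvd_imp_le)
    qed
    then show "c i * c j * ?hh j * (\<Sum>k=1..int n. ?e k (- int (l i) - int (l j))) = 0"
      unfolding sum_cis_fourier[OF n] by simp
  qed
  finally have 1: "(\<Sum>k=1..int n. z k * z (k + h)) = 0" .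
  have "(\<Sum>k=1..int n. cnj (z k) * z (k + h)) = (\<Sum>k=1..int n. \<Sum>i\<in>I. \<Sum>j\<in>I. cnj (c i) * c j * ?hh j * ?e k (int (l i) - int (l j)))"
  proof (rule sum.cong[OF refl])
    fix k
    have "cnj (cis (- (of_int k * ?\<theta> i))) * cis (- (of_int (k + h) * ?\<theta> j))
       = ?hh j * ?e k (int (l i) - int (l j))" for i j
      unfolding cis_cnj cis_mult using n by (intro arg_cong[where f=cis]) (simp add: fourier_freq_def field_simps)
    then show "cnj (z k) * z (k + h) = (\<Sum>i\<in>I. \<Sum>j\<in>I. cnj (c i) * c j * ?hh j * ?e k (int (l i) - int (l j)))"
      unfolding z_def cnj_sum sum_product by (intro sum.cong refl) (simp add: mult_ac)
  qed
  also have "\<dots> = (\<Sum>i\<in>I. \<Sum>j\<in>I. cnj (c i) * c j * ?hh j * (\<Sum>k=1..int n. ?e k (int (l i) - int (l j))))"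
    unfolding sum_distrib_left by (rule sum_rotate3)
  also have "\<dots> = (\<Sum>i\<in>I. \<Sum>j\<in>I. if j = i then of_nat n * (cnj (c i) * c i) * ?hh i else 0)"
  proof (intro sum.cong refl)
    fix i j assume ij: "i \<in> I" "j \<in> I"
    have "int n dvd int (l i) - int (l j) \<longleftrightarrow> i = j"
    proof
      assume d: "int n dvd int (l i) - int (l j)"
      have "\<bar>int (l i) - int (l j)\<bar> < int n" using l[OF ij(1)] l[OF ij(2)] n by linarith
      then have "l i = l j" using d zdvd_imp_le[of "int n" "\<bar>int (l i) - int (l j)\<bar>"] by auto
      then show "i = j" using inj ij by (auto dest: inj_onD)
    qed simp
    then show "cnj (c i) * c j * ?hh j * (\<Sum>k=1..int n. ?e k (int (l i) - int (l j)))
      = (if j = i then of_nat n * (cnj (c i) * c i) * ?hh i else 0)"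
      unfolding sum_cis_fourier[OF n] by (auto simp: mult_ac)
  qed
  also have "\<dots> = (\<Sum>i\<in>I. of_nat n * (cnj (c i) * c i) * ?hh i)" using fin by simp
  finally have 2: "(\<Sum>k=1..int n. cnj (z k) * z (k + h)) = (\<Sum>i\<in>I. of_nat n * (cnj (c i) * c i) * ?hh i)" .
  have "(\<Sum>k=1..int n. a k * a (k + h)) = Re ((\<Sum>k=1..int n. z k * z (k + h)) + (\<Sum>k=1..int n. cnj (z k) * z (k + h))) / 2"
    unfolding prod by (simp add: sum_divide_distrib[symmetric] sum.distrib sum_subtractf)
  also have "\<dots> = (\<Sum>i\<in>I. Re (of_nat n * (cnj (c i) * c i) * ?hh i) / 2)"
    unfolding 1 2 by (simp add: sum_divide_distrib)
  also have "\<dots> = (\<Sum>j\<in>I. real n / 2 * (cmod (c j))\<^sup>2 * cos (of_int h * ?\<theta> j))"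
  proof (rule sum.cong[OF refl])
    fix j
    have "cnj (c j) * c j = complex_of_real ((cmod (c j))\<^sup>2)"
      using complex_norm_square[of "c j"] by (simp add: mult.commute)
    then show "Re (of_nat n * (cnj (c j) * c j) * ?hh j) / 2 = real n / 2 * (cmod (c j))\<^sup>2 * cos (of_int h * ?\<theta> j)"
      by simp
  qed
  finally show ?thesis .
qed

text \<open>Ordered by lag, the quadratic form pairs \<open>r\<close> with the correlation of the
  weights cut off at the window. The cyclic correlation is known exactly, differs from it negligibly
  at each lag, and dominated convergence sums over the lags.\<close>

theorem weighted_variance_tendsto:
  fixes r :: "int \<Rightarrow> real" and c :: "nat \<Rightarrow> nat \<Rightarrow> complex" and l :: "nat \<Rightarrow> nat \<Rightarrow> nat"
  assumes r: "integrable (count_space UNIV) r" and fin: "finite I"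
    and l: "\<forall>\<^sub>F n in sequentially. inj_on (l n) I \<and> (\<forall>j\<in>I. 1 \<le> l n j \<and> l n j \<le> (n - 1) div 2)"
  defines "a \<equiv> \<lambda>n (k::int). \<Sum>j\<in>I. Re (c n j * cis (- (of_int k * fourier_freq n (l n j))))"
  assumes bound: "\<And>n k. \<bar>a n k\<bar> \<le> C / sqrt (real n)"
  shows "(\<lambda>n. (\<Sum>k=1..int n. \<Sum>k'=1..int n. a n k * a n k' * r (k' - k))
     - (\<Sum>j\<in>I. real n / 2 * (cmod (c n j))\<^sup>2 * (\<integral>h. r h * cos (of_int h * fourier_freq n (l n j)) \<partial>count_space UNIV))) \<longlonglongrightarrow> 0"
proof -
  let ?V = "\<lambda>n. \<Sum>k=1..int n. \<Sum>k'=1..int n. a n k * a n k' * r (k' - k)"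
  let ?D = "\<lambda>n. \<Sum>j\<in>I. real n / 2 * (cmod (c n j))\<^sup>2 * (\<integral>h. r h * cos (of_int h * fourier_freq n (l n j)) \<partial>count_space UNIV)"
  \<comment> \<open>In \<open>cn\<close> both indices must lie in the window, as in the variance;
    \<open>cc\<close> is the cyclic version, where only \<open>k\<close> is restricted.\<close>
  define cn where "cn n h = (\<Sum>k\<in>{1..int n} \<inter> {k. k + h \<in> {1..int n}}. a n k * a n (k + h))" for n h
  define cc where "cc n h = (\<Sum>k=1..int n. a n k * a n (k + h))" for n h
  have C0: "0 \<le> C" using bound[of 1 0] by auto
  have aa: "\<bar>a n k * a n k'\<bar> \<le> C\<^sup>2 / real n" for n k k'
  proof -
    have "\<bar>a n k\<bar> * \<bar>a n k'\<bar> \<le> (C / sqrt (real n)) * (C / sqrt (real n))"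
      using C0 by (intro mult_mono bound) auto
    also have "\<dots> = C\<^sup>2 / real n" by (simp add: power2_eq_square)
    finally show ?thesis by (simp add: abs_mult)
  qed
  \<comment> \<open>The correlations differ in the indices whose partner \<open>k + h\<close> leaves
    the window, at most \<open>min n \<bar>h\<bar>\<close> of them. This gives decay at each fixed
    lag and the bound \<open>C^2\<close> over all lags.\<close>
  have diff: "\<bar>cn n h - cc n h\<bar> \<le> min (real n) \<bar>of_int h\<bar> * (C\<^sup>2 / real n)" for n h
  proof -
    let ?B = "{1..int n} - {k. k + h \<in> {1..int n}}"
    have "cc n h = cn n h + (\<Sum>k\<in>?B. a n k * a n (k + h))"
      unfolding cc_def cn_def by (subst sum.Int_Diff[of _ _ "{k. k + h \<in> {1..int n}}"]) auto
    then have "\<bar>cn n h - cc n h\<bar> = \<bar>\<Sum>k\<in>?B. a n k * a n (k + h)\<bar>" by simp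
    also have "\<dots> \<le> (\<Sum>k\<in>?B. \<bar>a n k * a n (k + h)\<bar>)" by (rule sum_abs)
    also have "\<dots> \<le> (\<Sum>k\<in>?B. C\<^sup>2 / real n)" by (intro sum_mono aa)
    also have "\<dots> = real (card ?B) * (C\<^sup>2 / real n)" by simp
    also have "\<dots> \<le> min (real n) \<bar>of_int h\<bar> * (C\<^sup>2 / real n)"
    proof (rule mult_right_mono)
      have "card ?B \<le> card {1..int n}" by (intro card_mono) auto
      then have "card ?B \<le> n" by simp
      moreover have "int (card ?B) \<le> \<bar>h\<bar>"
      proof (cases "h \<ge> 0")
        case True
        have "card ?B \<le> card {int n - h<..int n}" by (intro card_mono) (use True in auto)
        then show ?thesis using True by simp
      next
        case False
        have "card ?B \<le> card {1..- h}" by (intro card_mono) (use False in auto)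
        then show ?thesis using False by simp
      qed
      ultimately show "real (card ?B) \<le> min (real n) \<bar>of_int h\<bar>" by linarith
    qed simp
    finally show ?thesis .
  qed
  have diff2: "\<bar>cn n h - cc n h\<bar> \<le> C\<^sup>2" for n h
  proof -
    have "min (real n) \<bar>of_int h\<bar> * (C\<^sup>2 / real n) \<le> real n * (C\<^sup>2 / real n)" by (intro mult_right_mono) auto
    also have "\<dots> \<le> C\<^sup>2" by simp
    finally show ?thesis using diff[of n h] by simp
  qed
  have var: "?V n = (\<integral>h. r h * cn n h \<partial>count_space UNIV)" for n
  proof -
    have z: "cn n h = 0" if "h \<notin> {- int n..int n}" for h
      unfolding cn_def using that by (intro sum.neutral) auto
    have "(\<integral>h. r h * cn n h \<partial>count_space UNIV) = (\<Sum>h\<in>{- int n..int n}. r h * cn n h)"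
    proof -
      have fin: "finite {h. r h * cn n h \<noteq> 0}"
        by (rule finite_subset[of _ "{- int n..int n}"]) (use z in fastforce)+
      have "(\<integral>h. r h * cn n h \<partial>count_space UNIV) = (\<Sum>h | r h * cn n h \<noteq> 0. r h * cn n h)"
        using lebesgue_integral_count_space_finite_support[of UNIV "\<lambda>h. r h * cn n h"] fin by simp
      also have "\<dots> = (\<Sum>h\<in>{- int n..int n}. r h * cn n h)"
        by (rule sum.mono_neutral_left) (use z in fastforce)+
      finally show ?thesis .
    qed
    also have "\<dots> = (\<Sum>h\<in>{- int n..int n}. \<Sum>k=1..int n. if k + h \<in> {1..int n} then a n k * a n (k + h) * r h else 0)"
      unfolding cn_def sum_distrib_left by (subst sum.inter_restrict) (auto intro!: sum.cong)
    also have "\<dots> = (\<Sum>k=1..int n. \<Sum>h\<in>{- int n..int n}. if k + h \<in> {1..int n} then a n k * a n (k + h) * r h else 0)"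
      by (rule sum.swap)
    also have "\<dots> = ?V n"
    proof (rule sum.cong[OF refl])
      fix k assume k: "k \<in> {1..int n}"
      have "(\<Sum>h\<in>{- int n..int n}. if k + h \<in> {1..int n} then a n k * a n (k + h) * r h else 0)
         = (\<Sum>h\<in>{h\<in>{- int n..int n}. k + h \<in> {1..int n}}. a n k * a n (k + h) * r h)"
        by (subst sum.inter_filter) auto
      also have "\<dots> = (\<Sum>k'=1..int n. a n k * a n k' * r (k' - k))"
        by (rule sum.reindex_bij_witness[of _ "\<lambda>k'. k' - k" "\<lambda>h. k + h"]) (use k in auto)
      finally show "(\<Sum>h\<in>{- int n..int n}. if k + h \<in> {1..int n} then a n k * a n (k + h) * r h else 0)
        = (\<Sum>k'=1..int n. a n k * a n k' * r (k' - k))" .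
    qed
    finally show ?thesis by simp
  qed
  have intcos: "integrable (count_space UNIV) (\<lambda>h. r h * cos (of_int h * x))" for x
    by (rule Bochner_Integration.integrable_bound[OF r]) (auto simp: abs_mult mult_left_le)
  have main: "\<forall>\<^sub>F n in sequentially. ?D n
     = (\<integral>h. r h * cc n h \<partial>count_space UNIV)"
    using l eventually_gt_at_top[of 0]
  proof eventually_elim
    case (elim n)
    have cc: "r h * cc n h = (\<Sum>j\<in>I. real n / 2 * (cmod (c n j))\<^sup>2 * (r h * cos (of_int h * fourier_freq n (l n j))))" for h
      unfolding cc_def a_def using elim
      by (subst circular_correlation[of n I "l n" "c n" h, OF _ fin]) (auto simp: sum_distrib_left mult_ac)
    show ?case unfolding cc using intcos by simp
  qed
  have ccb: "\<bar>cc n h\<bar> \<le> C\<^sup>2" for n h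
  proof -
    have "\<bar>cc n h\<bar> \<le> (\<Sum>k=1..int n. \<bar>a n k * a n (k + h)\<bar>)" unfolding cc_def by (rule sum_abs)
    also have "\<dots> \<le> (\<Sum>k=1..int n. C\<^sup>2 / real n)" by (intro sum_mono aa)
    also have "\<dots> \<le> C\<^sup>2" by simp
    finally show ?thesis .
  qed
  have intb: "integrable (count_space UNIV) (\<lambda>h. r h * g h)" if "\<And>h. \<bar>g h\<bar> \<le> C\<^sup>2" for g :: "int \<Rightarrow> real"
  proof (rule Bochner_Integration.integrable_bound)
    show "integrable (count_space UNIV) (\<lambda>h. r h * C\<^sup>2)" using r by simp
    show "AE h in count_space UNIV. norm (r h * g h) \<le> norm (r h * C\<^sup>2)"
      using that by (intro AE_I2) (simp add: abs_mult mult_left_mono)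
  qed simp
  have intcc: "integrable (count_space UNIV) (\<lambda>h. r h * cc n h)" for n by (rule intb[OF ccb])
  have intdiff: "integrable (count_space UNIV) (\<lambda>h. r h * (cn n h - cc n h))" for n by (rule intb[OF diff2])
  have intcn: "integrable (count_space UNIV) (\<lambda>h. r h * cn n h)" for n
    using Bochner_Integration.integrable_add[OF intdiff[of n] intcc[of n]] by (simp add: algebra_simps)
  \<comment> \<open>The dominating function \<open>\<bar>r h\<bar> * C\<^sup>2\<close> is where
    absolute summability of \<open>r\<close> is used.\<close>
  have "(\<lambda>n. \<integral>h. r h * (cn n h - cc n h) \<partial>count_space UNIV) \<longlonglongrightarrow> (\<integral>h. 0 \<partial>count_space (UNIV::int set))"
  proof (rule integral_dominated_convergence[where w="\<lambda>h. \<bar>r h\<bar> * C\<^sup>2"])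
    show "integrable (count_space UNIV) (\<lambda>h. \<bar>r h\<bar> * C\<^sup>2)" using r by simp
    show "AE h in count_space UNIV. norm (r h * (cn n h - cc n h)) \<le> \<bar>r h\<bar> * C\<^sup>2" for n
      using diff2 by (intro AE_I2) (simp add: abs_mult mult_left_mono)
    show "AE h in count_space UNIV. (\<lambda>n. r h * (cn n h - cc n h)) \<longlonglongrightarrow> 0"
    proof (rule AE_I2)
      fix h
      have "(\<lambda>n. cn n h - cc n h) \<longlonglongrightarrow> 0"
      proof (rule Lim_null_comparison)
        show "\<forall>\<^sub>F n in sequentially. norm (cn n h - cc n h) \<le> (\<bar>of_int h\<bar> * C\<^sup>2) / real n"
        proof (rule always_eventually, rule allI)
          fix n
          have "min (real n) \<bar>of_int h\<bar> * (C\<^sup>2 / real n) \<le> \<bar>of_int h\<bar> * (C\<^sup>2 / real n)"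
            by (intro mult_right_mono) auto
          then show "norm (cn n h - cc n h) \<le> (\<bar>of_int h\<bar> * C\<^sup>2) / real n" using diff[of n h] by simp
        qed
      qed (rule lim_const_over_n)
      then show "(\<lambda>n. r h * (cn n h - cc n h)) \<longlonglongrightarrow> 0" by (rule tendsto_mult_right_zero)
    qed
  qed auto
  then have lim: "(\<lambda>n. \<integral>h. r h * (cn n h - cc n h) \<partial>count_space UNIV) \<longlonglongrightarrow> 0" by simp
  show ?thesis
  proof (rule Lim_transform_eventually[OF lim])
    show "\<forall>\<^sub>F n in sequentially. (\<integral>h. r h * (cn n h - cc n h) \<partial>count_space UNIV)
      = ?V n
       - ?D n"
      using main
    proof eventually_elim
      case (elim n)
      show ?case unfolding elim var using intcn[of n] intcc[of n] by (simp add: right_diff_distrib)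
    qed
  qed
qed

section \<open>Discrete Fourier transforms at the Fourier frequencies\<close>

text \<open>The infinite sum of a non-summable family is 0, so one nonzero value of the density
  forces summability, which for complex families is absolute. Taking moduli removes the phase, so it
  extends to every frequency.\<close>

lemma spectral_density_eq_integral:
  assumes pos: "spectral_density M X \<theta>\<^sub>0 \<noteq> 0"
  shows "integrable (count_space UNIV) (autocov M X)"
    and "spectral_density M X \<theta> = 1 / (2 * pi) * (\<integral>h. autocov M X h * cos (of_int h * \<theta>) \<partial>count_space UNIV)"
proof -
  define g where "g = (\<lambda>\<theta> k. of_real (autocov M X k) * cis (of_int k * \<theta>))"
  have "infsum (g \<theta>\<^sub>0) UNIV \<noteq> 0" using pos by (auto simp: spectral_density_def g_def)
  then have "g \<theta>\<^sub>0 summable_on UNIV" using infsum_not_exists by blast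
  then have "(\<lambda>k. norm (g \<theta>\<^sub>0 k)) summable_on UNIV" by (simp only: summable_on_iff_abs_summable_on_complex)
  then have abs: "(\<lambda>k. \<bar>autocov M X k\<bar>) summable_on UNIV" by (simp add: g_def norm_mult)
  then have "Infinite_Set_Sum.abs_summable_on (autocov M X) UNIV"
    unfolding abs_summable_equivalent[symmetric] by simp
  then show int: "integrable (count_space UNIV) (autocov M X)"
    by (simp add: Infinite_Set_Sum.abs_summable_on_def)
  have gi: "Infinite_Set_Sum.abs_summable_on (g \<theta>) UNIV"
    unfolding abs_summable_equivalent[symmetric] using abs by (simp add: g_def norm_mult)
  then have gint: "integrable (count_space UNIV) (g \<theta>)"
    by (simp add: Infinite_Set_Sum.abs_summable_on_def)
  have "infsum (g \<theta>) UNIV = (\<integral>k. g \<theta> k \<partial>count_space UNIV)"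
    using infsetsum_infsum[OF gi] by (simp add: infsetsum_def)
  then have "Re (infsum (g \<theta>) UNIV) = (\<integral>k. Re (g \<theta> k) \<partial>count_space UNIV)"
    using integral_Re[OF gint] by simp
  then show "spectral_density M X \<theta> = 1 / (2 * pi) * (\<integral>h. autocov M X h * cos (of_int h * \<theta>) \<partial>count_space UNIV)"
    by (simp add: spectral_density_def g_def)
qed

lemma sum_even_odd_pairs:
  fixes g :: "nat \<Rightarrow> 'c::comm_monoid_add"
  shows "(\<Sum>i=1..2 * q. g i) = (\<Sum>j=1..q. g (2 * j - 1) + g (2 * j))"
  by (induction q) (simp_all add: add.assoc)

context iid_noise begin

text \<open>The Cramer-Wold view: a real combination \<open>T\<close> of real and imaginary parts is
  a single weighted sum of the \<open>X k\<close>. Its weights are of size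
  \<open>1 / sqrt n\<close>, its variance comes from \<open>weighted_variance_tendsto\<close>, its
  normality from \<open>char_weighted_sum_tendsto\<close>.\<close>

theorem fourier_vector_tendsto:
  fixes G :: "(nat \<Rightarrow> real) \<Rightarrow> real" and l :: "nat \<Rightarrow> nat \<Rightarrow> nat" and t :: "nat \<Rightarrow> real"
  defines "X \<equiv> causal_process G \<epsilon>"
  defines "f \<equiv> spectral_density M X"
  assumes G: "G \<in> borel_measurable (PiM UNIV (\<lambda>_. borel))"
    and sq: "\<And>k. integrable M (\<lambda>w. \<bar>X k w\<bar>\<^sup>2)" and mean: "\<And>k. (\<integral>w. X k w \<partial>M) = 0"
    and sm: "summable (\<lambda>j::nat. norm_L2 M (proj_op M \<epsilon> 0 (X (int j))))"
    and min: "\<And>\<theta>. f \<theta>\<^sub>0 \<le> f \<theta>" and pos: "f \<theta>\<^sub>0 > 0"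
    and l: "\<forall>\<^sub>F n in sequentially. strict_mono_on {1..q} (l n) \<and> (\<forall>j\<in>{1..q}. 1 \<le> l n j \<and> l n j \<le> (n - 1) div 2)"
  defines "Z \<equiv> \<lambda>n j w. fourier_sum X n (fourier_freq n (l n j)) w /
      of_real (sqrt (real n * pi * f (fourier_freq n (l n j))))"
  defines "T \<equiv> \<lambda>n w. \<Sum>j=1..q. t (2 * j - 1) * Re (Z n j w) + t (2 * j) * Im (Z n j w)"
  shows "(\<lambda>n. \<integral>w. (T n w)\<^sup>2 \<partial>M) \<longlonglongrightarrow> (\<Sum>i=1..2 * q. (t i)\<^sup>2)"
    and "(\<lambda>n. \<integral>w. iexp (T n w) \<partial>M) \<longlonglongrightarrow> exp (- (\<Sum>i=1..2 * q. (t i)\<^sup>2) / 2)"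
proof -
  let ?\<theta> = "\<lambda>n j. fourier_freq n (l n j)"
  \<comment> \<open>Packing the coefficients gives
    \<open>u * Re z + v * Im z = Re (\<tau> * cnj z)\<close>; the conjugate is the minus sign inside
    \<open>cis\<close> in the weights.\<close>
  define \<tau> where "\<tau> j = Complex (t (2 * j - 1)) (t (2 * j))" for j
  define s where "s n j = sqrt (real n * pi * f (?\<theta> n j))" for n j
  define c where "c n j = \<tau> j / s n j" for n j
  define a where "a n k = (\<Sum>j\<in>{1..q}. Re (c n j * cis (- (of_int k * ?\<theta> n j))))" for n and k :: int
  \<comment> \<open>The minimum of \<open>f\<close> bounds every normalisation \<open>s n j\<close>
    below by \<open>sqrt (n * pi * f \<theta>\<^sub>0)\<close>.\<close>
  define C where "C = (\<Sum>j\<in>{1..q}. cmod (\<tau> j) / sqrt (pi * f \<theta>\<^sub>0))"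
  have fpos: "f \<theta> > 0" for \<theta> using min[of \<theta>] pos by simp
  have Gm: "G \<in> borel_measurable shift.S"
    using G measurable_cong_sets[OF sets_shift refl] by blast
  have Xm [measurable]: "X k \<in> borel_measurable M" for k
    unfolding X_def causal_process_def using measurable_compose[OF past_measurable Gm] .
  have sqX: "sqint M (X k)" for k using sq[of k] by (simp add: sqint_def)
  have T: "T n w = (\<Sum>k=1..int n. a n k * X k w)" for n w
  proof -
    have re: "u * Re (x * cis y / of_real s) + v * Im (x * cis y / of_real s) = x * Re (Complex u v / s * cis (- y))" for u v x y s :: real
    proof (cases "s = 0")
      case False
      then show ?thesis by (simp add: Re_divide_of_real Im_divide_of_real field_simps)
    qed simp
    have "T n w = (\<Sum>j=1..q. \<Sum>k=1..n. X (int k) w * Re (c n j * cis (- (real k * ?\<theta> n j))))"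
      unfolding T_def
    proof (rule sum.cong[OF refl])
      fix j
      have "Z n j w = (\<Sum>k=1..n. X (int k) w * cis (real k * ?\<theta> n j) / s n j)"
        by (simp add: Z_def s_def fourier_sum_def sum_divide_distrib)
      then have "t (2 * j - 1) * Re (Z n j w) + t (2 * j) * Im (Z n j w)
        = (\<Sum>k=1..n. t (2 * j - 1) * Re (X (int k) w * cis (real k * ?\<theta> n j) / s n j)
           + t (2 * j) * Im (X (int k) w * cis (real k * ?\<theta> n j) / s n j))"
        by (simp only: Re_sum Im_sum sum_distrib_left sum.distrib)
      then show "t (2 * j - 1) * Re (Z n j w) + t (2 * j) * Im (Z n j w) = (\<Sum>k=1..n. X (int k) w * Re (c n j * cis (- (real k * ?\<theta> n j))))"
        unfolding re c_def \<tau>_def .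
    qed
    also have "\<dots> = (\<Sum>k=1..n. a n (int k) * X (int k) w)"
      by (subst sum.swap) (simp add: a_def sum_distrib_left sum_distrib_right mult.commute)
    also have "\<dots> = (\<Sum>k=1..int n. a n k * X k w)"
      by (rule sum.reindex_bij_witness[of _ nat int]) auto
    finally show ?thesis .
  qed
  have a_bound: "\<bar>a n k\<bar> \<le> C / sqrt (real n)" for n k
  proof (cases "n = 0")
    case True
    \<comment> \<open>At \<open>n = 0\<close> the normalisation is 0 and division by it yields 0 on
      both sides of the bound.\<close>
    then have "a n k = 0" by (simp add: a_def c_def s_def)
    then show ?thesis using True by simp
  next
    case False
    have "\<bar>a n k\<bar> \<le> (\<Sum>j\<in>{1..q}. \<bar>Re (c n j * cis (- (of_int k * ?\<theta> n j)))\<bar>)"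
      unfolding a_def by (rule sum_abs)
    also have "\<dots> \<le> (\<Sum>j\<in>{1..q}. cmod (\<tau> j) / sqrt (pi * f \<theta>\<^sub>0) / sqrt (real n))"
    proof (rule sum_mono)
      fix j
      have "\<bar>Re (c n j * cis (- (of_int k * ?\<theta> n j)))\<bar> \<le> cmod (c n j)"
        using abs_Re_le_cmod[of "c n j * cis (- (of_int k * ?\<theta> n j))"] by (simp add: norm_mult)
      also have "\<dots> = cmod (\<tau> j) / s n j" using fpos by (simp add: c_def norm_divide s_def less_imp_le)
      also have "\<dots> \<le> cmod (\<tau> j) / sqrt (real n * (pi * f \<theta>\<^sub>0))"
        unfolding s_def using False pos fpos min by (intro divide_left_mono) (auto simp: mult.assoc intro!: mult_pos_pos mult_left_mono)
      also have "\<dots> = cmod (\<tau> j) / sqrt (pi * f \<theta>\<^sub>0) / sqrt (real n)" by (simp add: real_sqrt_mult)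
      finally show "\<bar>Re (c n j * cis (- (of_int k * ?\<theta> n j)))\<bar> \<le> cmod (\<tau> j) / sqrt (pi * f \<theta>\<^sub>0) / sqrt (real n)" .
    qed
    also have "\<dots> = C / sqrt (real n)" by (simp add: C_def sum_divide_distrib)
    finally show ?thesis .
  qed
  have var: "(\<integral>w. (T n w)\<^sup>2 \<partial>M) = (\<Sum>k=1..int n. \<Sum>k'=1..int n. a n k * a n k' * autocov M X (k' - k))" for n
  proof -
    have int: "integrable M (\<lambda>w. a n k * X k w * (a n k' * X k' w))" for k k'
      by (intro sqint_integrable_mult sqint_scale sqX)
    have "(\<integral>w. (T n w)\<^sup>2 \<partial>M) = (\<integral>w. (\<Sum>k=1..int n. \<Sum>k'=1..int n. a n k * X k w * (a n k' * X k' w)) \<partial>M)"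
      unfolding T by (simp add: power2_eq_square sum_product)
    also have "\<dots> = (\<Sum>k=1..int n. \<Sum>k'=1..int n. \<integral>w. a n k * X k w * (a n k' * X k' w) \<partial>M)"
      using int by simp
    also have "\<dots> = (\<Sum>k=1..int n. \<Sum>k'=1..int n. a n k * a n k' * autocov M X (k' - k))"
    proof (intro sum.cong refl)
      fix k k'
      have "(\<integral>w. a n k * X k w * (a n k' * X k' w) \<partial>M) = (\<integral>w. (a n k * a n k') * (X k w * X k' w) \<partial>M)"
        by (simp add: mult_ac)
      also have "\<dots> = a n k * a n k' * autocov M X (k' - k)"
        using covariance_causal_process[OF G, of k k'] by (simp add: X_def)
      finally show "(\<integral>w. a n k * X k w * (a n k' * X k' w) \<partial>M) = a n k * a n k' * autocov M X (k' - k)" .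
    qed
    finally show ?thesis .
  qed
  have f0: "spectral_density M X \<theta>\<^sub>0 \<noteq> 0" using pos by (simp add: f_def)
  have l': "\<forall>\<^sub>F n in sequentially. inj_on (l n) {1..q} \<and> (\<forall>j\<in>{1..q}. 1 \<le> l n j \<and> l n j \<le> (n - 1) div 2)"
    using l by eventually_elim (auto intro: strict_mono_on_imp_inj_on)
  let ?A = "\<lambda>n j. \<integral>h. autocov M X h * cos (of_int h * ?\<theta> n j) \<partial>count_space UNIV"
  let ?V = "\<lambda>n. \<Sum>k=1..int n. \<Sum>k'=1..int n. a n k * a n k' * autocov M X (k' - k)"
  have "(\<lambda>n. ?V n
     - (\<Sum>j\<in>{1..q}. real n / 2 * (cmod (c n j))\<^sup>2 * ?A n j)) \<longlonglongrightarrow> 0"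
    unfolding a_def
    by (rule weighted_variance_tendsto[OF spectral_density_eq_integral(1)[OF f0] _ l']) (use a_bound in \<open>simp_all add: a_def\<close>)
  moreover have "\<forall>\<^sub>F n in sequentially. (\<Sum>j\<in>{1..q}. real n / 2 * (cmod (c n j))\<^sup>2 * ?A n j)
      = (\<Sum>i=1..2 * q. (t i)\<^sup>2)"
    using eventually_gt_at_top[of 0]
  proof eventually_elim
    case (elim n)
    \<comment> \<open>The density cancels for each \<open>n > 0\<close>, whatever the frequency, so
      no regularity of \<open>f\<close> along moving frequencies is involved.\<close>
    have "real n / 2 * (cmod (c n j))\<^sup>2 * ?A n j = (cmod (\<tau> j))\<^sup>2" for j
    proof -
      let ?f = "f (?\<theta> n j)"
      have i: "?A n j = 2 * pi * ?f"
        using spectral_density_eq_integral(2)[OF f0, of "?\<theta> n j"] by (simp add: f_def)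
      have "(cmod (c n j))\<^sup>2 = (cmod (\<tau> j))\<^sup>2 / (real n * pi * ?f)"
        using fpos[of "?\<theta> n j"] by (simp add: c_def s_def norm_divide power_divide)
      then show ?thesis unfolding i using elim fpos[of "?\<theta> n j"] by simp
    qed
    moreover have "(cmod (\<tau> j))\<^sup>2 = (t (2 * j - 1))\<^sup>2 + (t (2 * j))\<^sup>2" for j
      by (simp add: \<tau>_def cmod_def)
    ultimately show "(\<Sum>j\<in>{1..q}. real n / 2 * (cmod (c n j))\<^sup>2 * ?A n j)
       = (\<Sum>i=1..2 * q. (t i)\<^sup>2)" by (simp only: sum_even_odd_pairs)
  qed
  ultimately have "(\<lambda>n. ?V n - (\<Sum>i=1..2 * q. (t i)\<^sup>2)) \<longlonglongrightarrow> 0"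
    by (rule Lim_transform_eventually[OF _ eventually_mono]) simp
  then show v: "(\<lambda>n. \<integral>w. (T n w)\<^sup>2 \<partial>M) \<longlonglongrightarrow> (\<Sum>i=1..2 * q. (t i)\<^sup>2)"
    unfolding var by (rule LIM_zero_cancel)
  have "(\<lambda>n. (\<integral>w. iexp (T n w) \<partial>M) - exp (- (\<integral>w. (T n w)\<^sup>2 \<partial>M) / 2)) \<longlonglongrightarrow> 0"
    unfolding T X_def
    by (rule char_weighted_sum_tendsto[OF G]) (use sq mean sm a_bound in \<open>simp_all add: X_def\<close>)
  moreover have "(\<lambda>n. complex_of_real (exp (- (\<integral>w. (T n w)\<^sup>2 \<partial>M) / 2))) \<longlonglongrightarrow> exp (- (\<Sum>i=1..2 * q. (t i)\<^sup>2) / 2)"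
    by (intro tendsto_intros v) simp
  ultimately show "(\<lambda>n. \<integral>w. iexp (T n w) \<partial>M) \<longlonglongrightarrow> exp (- (\<Sum>i=1..2 * q. (t i)\<^sup>2) / 2)"
    using tendsto_add by fastforce
qed

end

section \<open>Convergence of characteristic functions in finite dimensions\<close>

text \<open>The complex coefficient yields cosines and sines alike, and constants at
  \<open>t = 0\<close>. Expectations of these functions are linear in values of the characteristic
  function.\<close>

inductive_set trig_poly :: "nat set \<Rightarrow> ((nat \<Rightarrow> real) \<Rightarrow> real) set" for I where
  base: "(\<lambda>x. Re (c * iexp (\<Sum>i\<in>I. t i * x i))) \<in> trig_poly I"
| add: "f \<in> trig_poly I \<Longrightarrow> g \<in> trig_poly I \<Longrightarrow> (\<lambda>x. f x + g x) \<in> trig_poly I"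

lemma trig_poly_const: "(\<lambda>x. c) \<in> trig_poly I"
  using trig_poly.base[where c="of_real c" and t="\<lambda>_. 0" and I=I] by simp

lemma trig_poly_sin:
  assumes "finite I" "i \<in> I"
  shows "(\<lambda>x. sin (x i / L)) \<in> trig_poly I"
proof -
  have "(\<Sum>j\<in>I. (if j = i then 1 / L else 0) * x j) = x i / L" for x :: "nat \<Rightarrow> real"
  proof -
    have "(\<Sum>j\<in>I. (if j = i then 1 / L else 0) * x j) = (\<Sum>j\<in>I. if j = i then x j / L else 0)"
      by (intro sum.cong) auto
    then show ?thesis using assms by simp
  qed
  then show ?thesis
    using trig_poly.base[where c="- \<i>" and t="\<lambda>j. if j = i then 1 / L else 0" and I=I]
    by (simp add: Im_exp)
qed

text \<open>Product-to-sum formulas: \<open>Re a * Re b\<close> splits into terms with the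
  frequencies \<open>t + u\<close> and \<open>t - u\<close>.\<close>

lemma trig_poly_mult:
  assumes "f \<in> trig_poly I" "g \<in> trig_poly I"
  shows "(\<lambda>x. f x * g x) \<in> trig_poly I"
  using assms(1)
proof induction
  case (base c t)
  show ?case using assms(2)
  proof induction
    case b: (base d u)
    have prod: "Re a * Re b = Re (a * b / 2) + Re (a * cnj b / 2)" for a b :: complex
      by (simp add: field_simps)
    have e1: "c * iexp (\<Sum>i\<in>I. t i * x i) * (d * iexp (\<Sum>i\<in>I. u i * x i)) / 2
        = (c * d / 2) * iexp (\<Sum>i\<in>I. (t i + u i) * x i)" for x
      by (simp add: distrib_right distrib_left sum.distrib exp_add)
    have e2: "c * iexp (\<Sum>i\<in>I. t i * x i) * cnj (d * iexp (\<Sum>i\<in>I. u i * x i)) / 2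
        = (c * cnj d / 2) * iexp (\<Sum>i\<in>I. (t i - u i) * x i)" for x
      by (simp add: left_diff_distrib right_diff_distrib sum_subtractf exp_diff exp_cnj exp_minus field_simps)
    show ?case unfolding prod e1 e2 by (intro trig_poly.intros)
  next
    case (add g h)
    show ?case unfolding distrib_left by (rule trig_poly.add[OF add.IH])
  qed
next
  case (add f h)
  show ?case unfolding distrib_right by (rule trig_poly.add[OF add.IH])
qed

lemma trig_poly_measurable:
  assumes "f \<in> trig_poly I" "\<And>i. (\<lambda>w. X w i) \<in> borel_measurable M"
  shows "(\<lambda>w. f (X w)) \<in> borel_measurable M"
  using assms(1)
proof induction
  case (base c t)
  note [measurable] = assms(2)
  show ?case by measurable
next
  case (add f g)
  then show ?case by simp
qed

lemma trig_poly_bounded: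
  assumes "f \<in> trig_poly I"
  shows "\<exists>B. \<forall>x. \<bar>f x\<bar> \<le> B"
  using assms
proof induction
  case (base c t)
  have "\<bar>Re (c * iexp (\<Sum>i\<in>I. t i * x i))\<bar> \<le> cmod c" for x
    using abs_Re_le_cmod[of "c * iexp (\<Sum>i\<in>I. t i * x i)"] by (simp add: norm_mult)
  then show ?case by blast
next
  case (add f g)
  then obtain B C where "\<And>x. \<bar>f x\<bar> \<le> B" "\<And>x. \<bar>g x\<bar> \<le> C" by blast
  then have "\<bar>f x + g x\<bar> \<le> B + C" for x by (meson abs_triangle_ineq add_mono order_trans)
  then show ?case by blast
qed

lemma trig_poly_integrable:
  assumes "f \<in> trig_poly I" "\<And>i. (\<lambda>w. X w i) \<in> borel_measurable M" "finite_measure M"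
  shows "integrable M (\<lambda>w. f (X w))"
proof -
  interpret finite_measure M by fact
  obtain B where "\<And>x. \<bar>f x\<bar> \<le> B" using trig_poly_bounded[OF assms(1)] by blast
  then show ?thesis
    by (intro integrable_const_bound[where B=B] trig_poly_measurable[OF assms(1,2)]) simp_all
qed

lemma trig_poly_expectation_tendsto:
  assumes f: "f \<in> trig_poly I" and M: "finite_measure M" and N: "finite_measure N"
    and W: "\<And>n i. (\<lambda>w. W n w i) \<in> borel_measurable M" and Y: "\<And>i. (\<lambda>w. Y w i) \<in> borel_measurable N"
    and char: "\<And>t. (\<lambda>n. \<integral>w. iexp (\<Sum>i\<in>I. t i * W n w i) \<partial>M) \<longlonglongrightarrow> (\<integral>w. iexp (\<Sum>i\<in>I. t i * Y w i) \<partial>N)"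
  shows "(\<lambda>n. \<integral>w. f (W n w) \<partial>M) \<longlonglongrightarrow> (\<integral>w. f (Y w) \<partial>N)"
  using f
proof induction
  case (base c t)
  note [measurable] = W Y
  have i: "integrable M (\<lambda>w. iexp (\<Sum>i\<in>I. t i * W n w i))" for n
    by (rule finite_measure.integrable_const_bound[OF M, where B=1]) auto
  have j: "integrable N (\<lambda>w. iexp (\<Sum>i\<in>I. t i * Y w i))"
    by (rule finite_measure.integrable_const_bound[OF N, where B=1]) auto
  have 1: "(\<integral>w. Re (c * iexp (\<Sum>i\<in>I. t i * W n w i)) \<partial>M) = Re (c * (\<integral>w. iexp (\<Sum>i\<in>I. t i * W n w i) \<partial>M))" for n
    using integral_Re[of M "\<lambda>w. c * iexp (\<Sum>i\<in>I. t i * W n w i)"] i by simp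
  have 2: "(\<integral>w. Re (c * iexp (\<Sum>i\<in>I. t i * Y w i)) \<partial>N) = Re (c * (\<integral>w. iexp (\<Sum>i\<in>I. t i * Y w i) \<partial>N))"
    using integral_Re[of N "\<lambda>w. c * iexp (\<Sum>i\<in>I. t i * Y w i)"] j by simp
  show ?case unfolding 1 2 by (intro tendsto_intros char)
next
  case (add f g)
  have "integrable M (\<lambda>w. f (W n w))" "integrable M (\<lambda>w. g (W n w))" for n
    by (rule trig_poly_integrable[OF add(1) W M] trig_poly_integrable[OF add(2) W M])+
  moreover have "integrable N (\<lambda>w. f (Y w))" "integrable N (\<lambda>w. g (Y w))"
    by (rule trig_poly_integrable[OF add(1) Y N] trig_poly_integrable[OF add(2) Y N])+
  ultimately show ?case using tendsto_add[OF add.IH] by simp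
qed

text \<open>Points are total functions vanishing off \<open>I\<close>, so the finite-dimensional
  cube lives in a type with a topology, as Stone-Weierstrass requires; compactness is Tychonoff's
  theorem.\<close>

lemma compact_box_functions: "compact {s :: nat \<Rightarrow> real. (\<forall>i\<in>I. \<bar>s i\<bar> \<le> 1) \<and> (\<forall>i. i \<notin> I \<longrightarrow> s i = 0)}"
proof -
  have "compactin (product_topology (\<lambda>_. euclidean) (UNIV :: nat set)) (PiE UNIV (\<lambda>i. if i \<in> I then {-1..1::real} else {0}))"
    unfolding compactin_PiE by auto
  also have "PiE UNIV (\<lambda>i. if i \<in> I then {-1..1::real} else {0}) = {s. (\<forall>i\<in>I. \<bar>s i\<bar> \<le> 1) \<and> (\<forall>i. i \<notin> I \<longrightarrow> s i = 0)}"
    by (auto simp: PiE_UNIV_domain Pi_iff abs_le_iff split: if_splits)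
  finally show ?thesis by (simp add: euclidean_product_topology)
qed

text \<open>
  On the cube \<open>\<bar>x i\<bar> \<le> L\<close> the function \<open>H\<close> is a continuous function of the numbers \<open>sin (x i / L)\<close>, and a
  polynomial in these numbers is a trigonometric polynomial, hence bounded on the whole space.
\<close>

lemma trig_poly_approx:
  fixes H :: "(nat \<Rightarrow> real) \<Rightarrow> real"
  assumes H: "continuous_on UNIV H" and K: "\<And>x. \<bar>H x\<bar> \<le> K" and I: "finite I" and L: "L > 0" and \<epsilon>: "\<epsilon> > 0"
  shows "\<exists>P\<in>trig_poly I. \<forall>x. (\<forall>i. i \<notin> I \<longrightarrow> x i = 0) \<longrightarrow>
    \<bar>H x - P x\<bar> \<le> \<epsilon> + 2 * K * (\<Sum>i\<in>I. (x i)\<^sup>2) / L\<^sup>2"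
proof -
  let ?S = "{s :: nat \<Rightarrow> real. (\<forall>i\<in>I. \<bar>s i\<bar> \<le> 1) \<and> (\<forall>i. i \<notin> I \<longrightarrow> s i = 0)}"
  let ?sin = "\<lambda>x i. if i \<in> I then sin (x i / L) else 0"
  \<comment> \<open>The algebra consists of functions on the cube, but membership also records that
    inserting sines gives a trigonometric polynomial. The coordinates lie in it and separate
    points.\<close>
  define R where "R = {F. continuous_on ?S F \<and> (\<lambda>x. F (?sin x)) \<in> trig_poly I}"
  have K0: "0 \<le> K" using K[of undefined] abs_ge_zero order_trans by blast
  interpret function_ring_on R ?S
  proof
    show "compact ?S" by (rule compact_box_functions)
    show "continuous_on ?S f" if "f \<in> R" for f using that by (simp add: R_def)
    show "(\<lambda>x. f x + g x) \<in> R" if "f \<in> R" "g \<in> R" for f g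
      using that unfolding R_def mem_Collect_eq
      by (elim conjE) (rule conjI[OF continuous_on_add trig_poly.add])
    show "(\<lambda>x. f x * g x) \<in> R" if "f \<in> R" "g \<in> R" for f g
      using that unfolding R_def mem_Collect_eq
      by (elim conjE) (rule conjI[OF continuous_on_mult trig_poly_mult])
    show "(\<lambda>_. c) \<in> R" for c by (simp add: R_def trig_poly_const)
    show "\<exists>f\<in>R. f x \<noteq> f y" if xy: "x \<in> ?S" "y \<in> ?S" "x \<noteq> y" for x y
    proof -
      obtain i where i: "x i \<noteq> y i" using xy(3) by auto
      have iI: "i \<in> I"
      proof (rule ccontr)
        assume "i \<notin> I"
        then have "x i = 0" "y i = 0" using xy(1,2) by blast+
        with i show False by simp
      qed
      have "(\<lambda>s. s i) \<in> R"
        using iI trig_poly_sin[OF I iI, of L] continuous_on_subset[OF continuous_on_product_coordinates subset_UNIV] by (simp add: R_def)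
      then show ?thesis by (rule bexI[rotated]) (rule i)
    qed
  qed
  \<comment> \<open>If \<open>\<bar>x i\<bar> \<le> L\<close>, then \<open>x i / L\<close> lies
    within \<open>pi / 2\<close> and arcsin inverts the sine, so \<open>f\<close> at the sines
    recovers \<open>H x\<close>. Elsewhere \<open>f\<close> is still bounded by
    \<open>K\<close>.\<close>
  define f where "f s = H (\<lambda>i. L * arcsin (s i))" for s
  have bd: "\<bar>s i\<bar> \<le> 1" if "s \<in> ?S" for s i
  proof (cases "i \<in> I")
    case True
    then show ?thesis using that by simp
  next
    case False
    then have "s i = 0" using that by blast
    then show ?thesis by simp
  qed
  have c1: "continuous_on ?S (\<lambda>s. L * arcsin (s i))" for i
  proof (intro continuous_on_mult continuous_on_const continuous_on_arcsin ballI)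
    show "continuous_on ?S (\<lambda>s. s i)"
      by (rule continuous_on_subset[OF continuous_on_product_coordinates subset_UNIV])
    fix s assume "s \<in> ?S"
    from bd[OF this, of i] show "-1 \<le> s i \<and> s i \<le> 1" by linarith
  qed
  have c2: "continuous_on ?S (\<lambda>s i. L * arcsin (s i))"
    by (rule continuous_on_coordinatewise_then_product[OF c1])
  have cf: "continuous_on ?S f"
    unfolding f_def by (rule continuous_on_compose2[OF H c2 subset_UNIV])
  from Stone_Weierstrass_basic[OF cf \<epsilon>] obtain F where F: "F \<in> R" "\<forall>s\<in>?S. \<bar>f s - F s\<bar> < \<epsilon>"
    by (rule bexE)
  show ?thesis
  proof (rule bexI[of _ "\<lambda>x. F (?sin x)"], intro allI impI)
    show "(\<lambda>x. F (?sin x)) \<in> trig_poly I" using F(1) by (simp add: R_def)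
    fix x :: "nat \<Rightarrow> real" assume x: "\<forall>i. i \<notin> I \<longrightarrow> x i = 0"
    have s: "?sin x \<in> ?S" by auto
    have le: "\<bar>H x - F (?sin x)\<bar> \<le> \<bar>H x - f (?sin x)\<bar> + \<epsilon>" using bspec[OF F(2) s] by linarith
    have nn: "0 \<le> 2 * K * (\<Sum>i\<in>I. (x i)\<^sup>2) / L\<^sup>2" using K0 by (simp add: sum_nonneg)
    show "\<bar>H x - F (?sin x)\<bar> \<le> \<epsilon> + 2 * K * (\<Sum>i\<in>I. (x i)\<^sup>2) / L\<^sup>2"
    proof (cases "\<forall>i\<in>I. \<bar>x i\<bar> \<le> L")
      case True
      have "L * arcsin (?sin x i) = x i" for i
      proof (cases "i \<in> I")
        case iI: True
        have "\<bar>x i / L\<bar> \<le> 1" using True iI L by simp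
        then have "- (pi / 2) \<le> x i / L" "x i / L \<le> pi / 2" using pi_gt3 by linarith+
        then show ?thesis using iI L by (simp add: arcsin_sin)
      qed (simp add: x)
      then have "f (?sin x) = H x" by (simp add: f_def)
      then show ?thesis using le nn by simp
    next
      case False
      \<comment> \<open>Outside the cube one square already exceeds \<open>L\<^sup>2\<close>, so the
        second-moment term absorbs the trivial error \<open>2 * K\<close>.\<close>
      then obtain i where i: "i \<in> I" "L < \<bar>x i\<bar>" by auto
      then have "L\<^sup>2 \<le> (x i)\<^sup>2" using L by (simp flip: abs_le_square_iff)
      also have "\<dots> \<le> (\<Sum>i\<in>I. (x i)\<^sup>2)" using i I by (intro member_le_sum) auto
      finally have "1 \<le> (\<Sum>i\<in>I. (x i)\<^sup>2) / L\<^sup>2" using L by (simp add: field_simps)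
      then have "2 * K * 1 \<le> 2 * K * ((\<Sum>i\<in>I. (x i)\<^sup>2) / L\<^sup>2)" using K0 by (intro mult_left_mono) auto
      moreover have "\<bar>f (?sin x)\<bar> \<le> K" unfolding f_def by (rule K)
      ultimately show ?thesis using le K[of x] by simp
    qed
  qed
qed

text \<open>Integrating the pointwise error leaves only second moments, so a common bound
  \<open>B\<close> makes the estimate uniform over a sequence of laws.\<close>

lemma expectation_close:
  fixes H P :: "(nat \<Rightarrow> real) \<Rightarrow> real" and X :: "'a \<Rightarrow> nat \<Rightarrow> real"
  assumes Q: "prob_space Q" and H: "continuous_on UNIV H" and K: "\<And>x. \<bar>H x\<bar> \<le> K"
    and P: "P \<in> trig_poly I"
      "\<forall>x. (\<forall>i. i \<notin> I \<longrightarrow> x i = 0) \<longrightarrow> \<bar>H x - P x\<bar> \<le> \<epsilon> + 2 * K * (\<Sum>i\<in>I. (x i)\<^sup>2) / L\<^sup>2"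
    and X: "\<And>i. (\<lambda>w. X w i) \<in> borel_measurable Q" and X0: "\<And>w i. i \<notin> I \<Longrightarrow> X w i = 0"
    and X2: "\<And>i. i \<in> I \<Longrightarrow> integrable Q (\<lambda>w. (X w i)\<^sup>2)" and Xb: "\<And>i. i \<in> I \<Longrightarrow> (\<integral>w. (X w i)\<^sup>2 \<partial>Q) \<le> B"
  shows "\<bar>(\<integral>w. H (X w) \<partial>Q) - (\<integral>w. P (X w) \<partial>Q)\<bar> \<le> \<epsilon> + 2 * K * (real (card I) * B) / L\<^sup>2"
proof -
  interpret Q: prob_space Q by fact
  have K0: "0 \<le> K" using K[of undefined] abs_ge_zero order_trans by blast
  have "X \<in> borel_measurable Q" by (rule measurable_coordinatewise_then_product[OF X])
  then have HX: "(\<lambda>w. H (X w)) \<in> borel_measurable Q"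
    by (rule measurable_compose[OF _ borel_measurable_continuous_onI[OF H]])
  have iH: "integrable Q (\<lambda>w. H (X w))"
    by (rule Q.integrable_const_bound[where B=K]) (use K HX in auto)
  have iP: "integrable Q (\<lambda>w. P (X w))" by (rule trig_poly_integrable[OF P(1) X Q.finite_measure_axioms])
  have "\<bar>(\<integral>w. H (X w) \<partial>Q) - (\<integral>w. P (X w) \<partial>Q)\<bar> = \<bar>\<integral>w. H (X w) - P (X w) \<partial>Q\<bar>" using iH iP by simp
  also have "\<dots> \<le> (\<integral>w. \<bar>H (X w) - P (X w)\<bar> \<partial>Q)" by (rule integral_abs_bound)
  also have "\<dots> \<le> (\<integral>w. \<epsilon> + 2 * K * (\<Sum>i\<in>I. (X w i)\<^sup>2) / L\<^sup>2 \<partial>Q)"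
    using iH iP X2 P(2) X0 by (intro integral_mono) auto
  also have "\<dots> = \<epsilon> + 2 * K * (\<Sum>i\<in>I. \<integral>w. (X w i)\<^sup>2 \<partial>Q) / L\<^sup>2"
    using X2 by (simp add: Q.prob_space)
  also have "\<dots> \<le> \<epsilon> + 2 * K * (\<Sum>i\<in>I. B) / L\<^sup>2"
    using K0 by (intro add_left_mono divide_right_mono mult_left_mono sum_mono Xb) auto
  finally show ?thesis by simp
qed

text \<open>The bounds on second moments permit one trigonometric polynomial \<open>P\<close> to
  approximate \<open>H\<close> in mean under the limit and eventually under all \<open>W n\<close>;
  for \<open>P\<close> the claim is linear in characteristic functions.\<close>

theorem multivariate_Levy_continuity:
  fixes W :: "nat \<Rightarrow> 'a \<Rightarrow> nat \<Rightarrow> real" and Y :: "'b \<Rightarrow> nat \<Rightarrow> real"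
  assumes M: "prob_space M" and N: "prob_space N" and I: "finite I"
    and W: "\<And>n i. (\<lambda>w. W n w i) \<in> borel_measurable M" and Y: "\<And>i. (\<lambda>w. Y w i) \<in> borel_measurable N"
    and W0: "\<And>n w i. i \<notin> I \<Longrightarrow> W n w i = 0" and Y0: "\<And>w i. i \<notin> I \<Longrightarrow> Y w i = 0"
    and char: "\<And>t. (\<lambda>n. \<integral>w. iexp (\<Sum>i\<in>I. t i * W n w i) \<partial>M) \<longlonglongrightarrow> (\<integral>w. iexp (\<Sum>i\<in>I. t i * Y w i) \<partial>N)"
    and W2: "\<And>i n. i \<in> I \<Longrightarrow> integrable M (\<lambda>w. (W n w i)\<^sup>2)"
    and Wb: "\<And>i. i \<in> I \<Longrightarrow> \<forall>\<^sub>F n in sequentially. (\<integral>w. (W n w i)\<^sup>2 \<partial>M) \<le> B"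
    and Y2: "\<And>i. i \<in> I \<Longrightarrow> integrable N (\<lambda>w. (Y w i)\<^sup>2)"
    and Yb: "\<And>i. i \<in> I \<Longrightarrow> (\<integral>w. (Y w i)\<^sup>2 \<partial>N) \<le> B"
    and H: "continuous_on UNIV H" and K: "\<And>x. \<bar>H x\<bar> \<le> (K::real)"
  shows "(\<lambda>n. \<integral>w. H (W n w) \<partial>M) \<longlonglongrightarrow> (\<integral>w. H (Y w) \<partial>N)"
proof (rule LIMSEQ_I)
  fix e :: real assume e: "e > 0"
  interpret M: prob_space M by fact
  interpret N: prob_space N by fact
  define D where "D = 2 * K * (real (card I) * B)"
  have K0: "0 \<le> K" using K[of undefined] abs_ge_zero order_trans by blast
  have B0: "0 \<le> real (card I) * B"
  proof (cases "I = {}")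
    case False
    then obtain i where "i \<in> I" by auto
    have "0 \<le> (\<integral>w. (Y w i)\<^sup>2 \<partial>N)" by simp
    also have "\<dots> \<le> B" by (rule Yb[OF \<open>i \<in> I\<close>])
    finally show ?thesis by simp
  qed simp
  have D0: "0 \<le> D" unfolding D_def using K0 B0 by simp
  \<comment> \<open>Makes \<open>D / L^2\<close> at most \<open>e / 8\<close>, so the three errors
    add up to less than \<open>3 * e / 4\<close>; the added 1 keeps \<open>L\<close> positive when
    \<open>D\<close> is 0.\<close>
  define L where "L = sqrt ((8 * D + 1) / e)"
  have L: "L > 0" using e D0 by (simp add: L_def)
  have L2: "L\<^sup>2 = (8 * D + 1) / e" using e D0 by (simp add: L_def)
  have DL: "D / L\<^sup>2 \<le> e / 8" unfolding L2 using e D0 by (simp add: field_simps)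
  have e8: "e / 8 > 0" using e by simp
  from trig_poly_approx[OF H K I L e8] obtain P where P: "P \<in> trig_poly I"
    "\<forall>x. (\<forall>i. i \<notin> I \<longrightarrow> x i = 0) \<longrightarrow> \<bar>H x - P x\<bar> \<le> e / 8 + 2 * K * (\<Sum>i\<in>I. (x i)\<^sup>2) / L\<^sup>2"
    by (rule bexE)
  have "(\<lambda>n. \<integral>w. P (W n w) \<partial>M) \<longlonglongrightarrow> (\<integral>w. P (Y w) \<partial>N)"
    by (rule trig_poly_expectation_tendsto[OF P(1) M.finite_measure_axioms N.finite_measure_axioms W Y char])
  then have "\<forall>\<^sub>F n in sequentially. \<bar>(\<integral>w. P (W n w) \<partial>M) - (\<integral>w. P (Y w) \<partial>N)\<bar> < e / 4"
    using e by (auto dest!: tendstoD[where e="e / 4"] simp: dist_real_def)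
  moreover have "\<forall>\<^sub>F n in sequentially. \<forall>i\<in>I. (\<integral>w. (W n w i)\<^sup>2 \<partial>M) \<le> B"
    by (rule eventually_ball_finite[OF I]) (use Wb in auto)
  ultimately have "\<forall>\<^sub>F n in sequentially. norm ((\<integral>w. H (W n w) \<partial>M) - (\<integral>w. H (Y w) \<partial>N)) < e"
  proof eventually_elim
    case (elim n)
    have "\<bar>(\<integral>w. H (W n w) \<partial>M) - (\<integral>w. P (W n w) \<partial>M)\<bar> \<le> e / 8 + 2 * K * (real (card I) * B) / L\<^sup>2"
      by (rule expectation_close[OF M H K P]) (simp_all add: W W0 W2 elim)
    moreover have "\<bar>(\<integral>w. H (Y w) \<partial>N) - (\<integral>w. P (Y w) \<partial>N)\<bar> \<le> e / 8 + 2 * K * (real (card I) * B) / L\<^sup>2"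
      by (rule expectation_close[OF N H K P]) (simp_all add: Y Y0 Y2 Yb)
    ultimately show ?case using elim(1) DL unfolding real_norm_def D_def by linarith
  qed
  then show "\<exists>no. \<forall>n\<ge>no. norm ((\<integral>w. H (W n w) \<partial>M) - (\<integral>w. H (Y w) \<partial>N)) < e"
    by (simp add: eventually_sequentially)
qed

section \<open>Half the squared norm of a standard normal pair\<close>

text \<open>The inner integral in \<open>half_square_norm_std_normal\<close>, with
  \<open>c = 1 + s^2\<close>. The region is \<open>\<bar>y\<bar> \<le> b\<close> and each half has
  the antiderivative \<open>- exp (- (c * y^2 / 2)) / c\<close>.\<close>

lemma nn_integral_radial_Gauss:
  fixes c a :: real
  assumes c: "c > 0" and a: "a \<ge> 0"
  shows "(\<integral>\<^sup>+y. ennreal (\<bar>y\<bar> * exp (- (c * y\<^sup>2 / 2))) * indicator {..a} (c * y\<^sup>2 / 2) \<partial>lborel) = ennreal (2 * (1 - exp (- a)) / c)"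
proof -
  define b where "b = sqrt (2 * a / c)"
  define g where "g y = ennreal (y * exp (- (c * y\<^sup>2 / 2))) * indicator {0..b} y" for y
  have b: "0 \<le> b" "c * b\<^sup>2 / 2 = a" using c a by (auto simp: b_def)
  have gm [measurable]: "g \<in> borel_measurable borel" unfolding g_def by measurable
  have iff: "c * y\<^sup>2 / 2 \<le> a \<longleftrightarrow> \<bar>y\<bar> \<le> b" for y
  proof -
    have "c * y\<^sup>2 / 2 \<le> a \<longleftrightarrow> c * y\<^sup>2 \<le> c * b\<^sup>2" unfolding b(2)[symmetric] by simp
    also have "\<dots> \<longleftrightarrow> y\<^sup>2 \<le> b\<^sup>2" using c by simp
    also have "\<dots> \<longleftrightarrow> \<bar>y\<bar> \<le> \<bar>b\<bar>" by (simp only: abs_le_square_iff)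
    finally show ?thesis using b(1) by simp
  qed
  \<comment> \<open>Both terms vanish at \<open>y = 0\<close>, so the overlap of the two halves is
    not counted twice.\<close>
  have split: "ennreal (\<bar>y\<bar> * exp (- (c * y\<^sup>2 / 2))) * indicator {..a} (c * y\<^sup>2 / 2) = g y + g (- y)" for y
    unfolding g_def using iff[of y] b(1) by (cases "y > 0"; cases "y < 0") (auto split: split_indicator)
  have "(\<integral>\<^sup>+y. g y \<partial>lborel) = ennreal (- exp (- (c * b\<^sup>2 / 2)) / c - (- exp (- (c * 0\<^sup>2 / 2)) / c))"
    unfolding g_def
  proof (rule nn_integral_FTC_Icc)
    show "DERIV (\<lambda>y. - exp (- (c * y\<^sup>2 / 2)) / c) y :> y * exp (- (c * y\<^sup>2 / 2))" for y
      using c by (auto intro!: derivative_eq_intros)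
  qed (use b in auto)
  also have "\<dots> = ennreal ((1 - exp (- a)) / c)" using b(2) c by (simp add: diff_divide_distrib)
  finally have g: "(\<integral>\<^sup>+y. g y \<partial>lborel) = ennreal ((1 - exp (- a)) / c)" .
  have g': "(\<integral>\<^sup>+y. g (- y) \<partial>lborel) = ennreal ((1 - exp (- a)) / c)"
    using nn_integral_real_affine[of g "-1" 0] g by simp
  have "(\<integral>\<^sup>+y. g y + g (- y) \<partial>lborel) = (\<integral>\<^sup>+y. g y \<partial>lborel) + (\<integral>\<^sup>+y. g (- y) \<partial>lborel)"
    by (rule nn_integral_add) auto
  also have "\<dots> = ennreal (2 * (1 - exp (- a)) / c)"
    unfolding g g' using a c by (subst ennreal_plus[symmetric]) (auto intro!: divide_nonneg_pos)
  finally show ?thesis unfolding split .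
qed

lemma nn_integral_inverse_1_plus_square: "(\<integral>\<^sup>+s. ennreal (inverse (1 + s\<^sup>2)) \<partial>lborel) = ennreal pi"
proof -
  have i: "integrable lborel (\<lambda>s. inverse (1 + s\<^sup>2) :: real)"
    using integrable_inverse_1_plus_square by (simp add: set_integrable_def)
  have "(\<integral>s. inverse (1 + s\<^sup>2) \<partial>lborel) = (pi :: real)"
    using LBINT_inverse_1_plus_square by (simp add: interval_lebesgue_integral_def set_lebesgue_integral_def)
  then show ?thesis using nn_integral_eq_integral[OF i] by simp
qed

text \<open>The substitution \<open>x = y * s\<close> takes the place of polar coordinates: the
  joint density depends on \<open>(1 + s^2) * y^2 / 2\<close>, the Jacobian is
  \<open>\<bar>y\<bar>\<close>, and after the radial integral there remains the integral of
  \<open>1 / (1 + s^2)\<close>, which is \<open>pi\<close>.\<close>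

theorem (in prob_space) half_square_norm_std_normal:
  assumes ind: "indep_var borel A borel B"
    and A: "distributed M lborel A std_normal_density" and B: "distributed M lborel B std_normal_density"
  shows "distributed M lborel (\<lambda>w. ((A w)\<^sup>2 + (B w)\<^sup>2) / 2) (exponential_density 1)"
  unfolding exponential_distributed_iff[OF zero_less_one]
proof (intro conjI allI impI)
  let ?V = "\<lambda>w. ((A w)\<^sup>2 + (B w)\<^sup>2) / 2"
  have [measurable]: "A \<in> borel_measurable M" "B \<in> borel_measurable M"
    using A B by (auto dest: distributed_measurable)
  show "?V \<in> borel_measurable M" by measurable
  fix a :: real assume a: "0 \<le> a"
  let ?U = "\<lambda>p. ((fst p)\<^sup>2 + (snd p)\<^sup>2) / 2"
  let ?J = "\<lambda>(x, y). ennreal (std_normal_density x) * ennreal (std_normal_density y)"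
  let ?k = "\<lambda>v. ennreal (exp (- v) / (2 * pi)) * indicator {..a} v"
  have joint: "distributed M (lborel \<Otimes>\<^sub>M lborel) (\<lambda>w. (A w, B w)) ?J"
    by (rule distributed_joint_indep[OF lborel.sigma_finite_measure_axioms lborel.sigma_finite_measure_axioms A B])
       (use ind in \<open>simp add: indep_var_eq\<close>)
  have "emeasure M {w \<in> space M. ?V w \<le> a} = (\<integral>\<^sup>+w. indicator {..a} (?V w) \<partial>M)"
  proof -
    have "{w \<in> space M. ?V w \<le> a} \<in> sets M" by measurable
    from nn_integral_indicator[OF this, symmetric] show ?thesis
      by (rule trans) (intro nn_integral_cong, simp add: indicator_def)
  qed
  also have "\<dots> = (\<integral>\<^sup>+p. ?J p * indicator {..a} (?U p) \<partial>(lborel \<Otimes>\<^sub>M lborel))"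
    by (subst distributed_nn_integral[OF joint]) auto
  also have "\<dots> = (\<integral>\<^sup>+p. ?k (?U p) \<partial>(lborel \<Otimes>\<^sub>M lborel))"
  proof (rule nn_integral_cong)
    fix p :: "real \<times> real"
    obtain x y where p: "p = (x, y)" by (cases p)
    have "std_normal_density x * std_normal_density y = exp (- ((x\<^sup>2 + y\<^sup>2) / 2)) / (2 * pi)"
    proof -
      have "std_normal_density x * std_normal_density y
          = 1 / (sqrt (2 * pi) * sqrt (2 * pi)) * (exp (- x\<^sup>2 / 2) * exp (- y\<^sup>2 / 2))"
        by (simp add: std_normal_density_def)
      also have "sqrt (2 * pi) * sqrt (2 * pi) = 2 * pi" by simp
      also have "exp (- x\<^sup>2 / 2) * exp (- y\<^sup>2 / 2) = exp (- ((x\<^sup>2 + y\<^sup>2) / 2))"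
        unfolding exp_add[symmetric] by (simp add: add_divide_distrib)
      finally show ?thesis by simp
    qed
    then show "?J p * indicator {..a} (?U p) = ?k (?U p)"
      unfolding p by (simp add: ennreal_mult[symmetric])
  qed
  also have "\<dots> = (\<integral>\<^sup>+y. \<integral>\<^sup>+x. ?k ((x\<^sup>2 + y\<^sup>2) / 2) \<partial>lborel \<partial>lborel)"
    by (subst lborel_pair.nn_integral_snd[symmetric]) (auto simp: case_prod_beta)
  also have "\<dots> = (\<integral>\<^sup>+y. \<integral>\<^sup>+s. ennreal \<bar>y\<bar> * ?k ((1 + s\<^sup>2) * y\<^sup>2 / 2) \<partial>lborel \<partial>lborel)"
  proof (rule nn_integral_cong_AE)
    \<comment> \<open>The change of variable needs a nonzero \<open>y\<close>; the excluded point is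
      null.\<close>
    have "AE y in lborel. y \<noteq> (0::real)" by (rule AE_lborel_singleton)
    then show "AE y in lborel. (\<integral>\<^sup>+x. ?k ((x\<^sup>2 + y\<^sup>2) / 2) \<partial>lborel) = (\<integral>\<^sup>+s. ennreal \<bar>y\<bar> * ?k ((1 + s\<^sup>2) * y\<^sup>2 / 2) \<partial>lborel)"
    proof eventually_elim
      case (elim y)
      have "(\<integral>\<^sup>+x. ?k ((x\<^sup>2 + y\<^sup>2) / 2) \<partial>lborel) = ennreal \<bar>y\<bar> * (\<integral>\<^sup>+s. ?k (((0 + y * s)\<^sup>2 + y\<^sup>2) / 2) \<partial>lborel)"
        by (rule nn_integral_real_affine[OF _ elim]) measurable
      also have "\<dots> = (\<integral>\<^sup>+s. ennreal \<bar>y\<bar> * ?k ((1 + s\<^sup>2) * y\<^sup>2 / 2) \<partial>lborel)"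
        by (subst nn_integral_cmult[symmetric]) (auto intro!: nn_integral_cong simp: power_mult_distrib algebra_simps)
      finally show ?case .
    qed
  qed
  also have "\<dots> = (\<integral>\<^sup>+s. \<integral>\<^sup>+y. ennreal \<bar>y\<bar> * ?k ((1 + s\<^sup>2) * y\<^sup>2 / 2) \<partial>lborel \<partial>lborel)"
    by (rule lborel_pair.Fubini') measurable
  also have "\<dots> = (\<integral>\<^sup>+s. ennreal ((1 - exp (- a)) / pi) * ennreal (inverse (1 + s\<^sup>2)) \<partial>lborel)"
  proof (rule nn_integral_cong)
    fix s :: real
    have c: "1 + s\<^sup>2 > 0" by (simp add: add_pos_nonneg)
    have "(\<integral>\<^sup>+y. ennreal \<bar>y\<bar> * ?k ((1 + s\<^sup>2) * y\<^sup>2 / 2) \<partial>lborel)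
      = (\<integral>\<^sup>+y. ennreal (1 / (2 * pi)) * (ennreal (\<bar>y\<bar> * exp (- ((1 + s\<^sup>2) * y\<^sup>2 / 2))) * indicator {..a} ((1 + s\<^sup>2) * y\<^sup>2 / 2)) \<partial>lborel)"
      by (intro nn_integral_cong) (auto simp: ennreal_mult[symmetric] field_simps split: split_indicator)
    also have "\<dots> = ennreal (1 / (2 * pi)) * ennreal (2 * (1 - exp (- a)) / (1 + s\<^sup>2))"
      by (subst nn_integral_cmult) (auto simp: nn_integral_radial_Gauss[OF c a])
    also have "\<dots> = ennreal ((1 - exp (- a)) / pi) * ennreal (inverse (1 + s\<^sup>2))"
    proof -
      have "1 / (2 * pi) * (2 * (1 - exp (- a)) / (1 + s\<^sup>2)) = (1 - exp (- a)) / pi * inverse (1 + s\<^sup>2)"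
        using c pi_gt_zero by (simp add: divide_simps) (simp add: algebra_simps)
      then show ?thesis using a c by (subst (1 2) ennreal_mult[symmetric]) auto
    qed
    finally show "(\<integral>\<^sup>+y. ennreal \<bar>y\<bar> * ?k ((1 + s\<^sup>2) * y\<^sup>2 / 2) \<partial>lborel) = ennreal ((1 - exp (- a)) / pi) * ennreal (inverse (1 + s\<^sup>2))" .
  qed
  also have "\<dots> = ennreal ((1 - exp (- a)) / pi) * ennreal pi"
    by (subst nn_integral_cmult) (auto simp: nn_integral_inverse_1_plus_square)
  also have "\<dots> = ennreal (1 - exp (- a * 1))"
    using a by (subst ennreal_mult[symmetric]) auto
  finally show "\<P>(w in M. ?V w \<le> a) = 1 - exp (- a * 1)"
    using a by (intro measure_eq_emeasure_eq_ennreal) auto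
qed

section \<open>The limit law\<close>

lemma (in prob_space) distr_std_normal:
  assumes "distributed M lborel X std_normal_density"
  shows "distr M borel X = std_normal_distribution"
proof -
  have "distr M lborel X = distr M borel X" by (rule distr_cong) auto
  then show ?thesis using distributed_distr_eq_density[OF assms] by simp
qed

lemma (in prob_space) char_indep_std_normal:
  assumes ind: "indep_vars (\<lambda>_. borel) Y I"
    and Y: "\<And>i. i \<in> I \<Longrightarrow> distributed M lborel (Y i) std_normal_density"
  shows "(\<integral>w. iexp (\<Sum>i\<in>I. t i * Y i w) \<partial>M) = exp (- (\<Sum>i\<in>I. (t i)\<^sup>2) / 2)"
\<comment> \<open>For infinite \<open>I\<close> both sums are 0 by convention and both sides equal
  1.\<close>
proof (cases "finite I")
  case True
  have ind': "indep_vars (\<lambda>_. borel) (\<lambda>i w. t i * Y i w) I"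
    by (rule indep_vars_compose2[OF ind]) auto
  have Ym [measurable]: "Y i \<in> borel_measurable M" if "i \<in> I" for i
    using distributed_measurable[OF Y[OF that]] by simp
  have c1: "char (distr M borel (\<lambda>w. t i * Y i w)) 1 = complex_of_real (exp (- (t i)\<^sup>2 / 2))" if i: "i \<in> I" for i
  proof -
    note [measurable] = Ym[OF i]
    have "char (distr M borel (\<lambda>w. t i * Y i w)) 1 = (\<integral>w. iexp (t i * Y i w) \<partial>M)"
      unfolding char_def by (subst integral_distr) auto
    also have "\<dots> = char (distr M borel (Y i)) (t i)"
      unfolding char_def by (subst integral_distr) auto
    finally show ?thesis unfolding distr_std_normal[OF Y[OF i]] char_std_normal_distribution by simp
  qed
  have "(\<integral>w. iexp (\<Sum>i\<in>I. t i * Y i w) \<partial>M) = char (distr M borel (\<lambda>w. \<Sum>i\<in>I. t i * Y i w)) 1"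
    unfolding char_def by (subst integral_distr) auto
  also have "\<dots> = (\<Prod>i\<in>I. complex_of_real (exp (- (t i)\<^sup>2 / 2)))"
    unfolding char_distr_sum[OF ind'] by (rule prod.cong[OF refl c1])
  also have "\<dots> = exp (\<Sum>i\<in>I. - (t i)\<^sup>2 / 2)"
    unfolding exp_sum[OF True] by simp
  also have "(\<Sum>i\<in>I. - (t i)\<^sup>2 / 2) = - (\<Sum>i\<in>I. (t i)\<^sup>2) / 2"
    by (simp add: sum_divide_distrib sum_negf)
  finally show ?thesis .
qed (simp add: prob_space)

lemma (in prob_space) std_normal_second_moment:
  assumes "distributed M lborel X std_normal_density"
  shows "integrable M (\<lambda>w. (X w)\<^sup>2)" and "(\<integral>w. (X w)\<^sup>2 \<partial>M) = 1"
proof -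
  show "integrable M (\<lambda>w. (X w)\<^sup>2)"
    using distributed_integrable[OF assms, of "\<lambda>x. x\<^sup>2"] integrable_std_normal_moment[of 2] by simp
  show "(\<integral>w. (X w)\<^sup>2 \<partial>M) = 1"
    using distributed_integral[OF assms, of "\<lambda>x. x\<^sup>2"] integral_std_normal_moment_even[of 1] by simp
qed

lemma (in prob_space) integral_indep_vars_PiM:
  fixes h :: "('i \<Rightarrow> real) \<Rightarrow> real"
  assumes ind: "indep_vars (\<lambda>_. borel) W I" and ne: "I \<noteq> {}" and h: "h \<in> borel_measurable (PiM I (\<lambda>_. borel))"
  shows "(\<integral>w. h (\<lambda>i\<in>I. W i w) \<partial>M) = (\<integral>z. h z \<partial>PiM I (\<lambda>i. distr M borel (W i)))"
proof -
  have rv: "W i \<in> borel_measurable M" if "i \<in> I" for i using ind that by (auto simp: indep_vars_def)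
  have "(\<integral>z. h z \<partial>distr M (PiM I (\<lambda>_. borel)) (\<lambda>w. \<lambda>i\<in>I. W i w)) = (\<integral>w. h (\<lambda>i\<in>I. W i w) \<partial>M)"
    by (rule integral_distr[OF measurable_restrict h]) (rule rv)
  then show ?thesis using indep_vars_iff_distr_eq_PiM'[OF ne rv] ind by simp
qed

text \<open>The joint law of an independent family is the product of its marginals, so the two
  families may live on different probability spaces.\<close>

lemma integral_indep_vars_cong:
  fixes h :: "('i \<Rightarrow> real) \<Rightarrow> real"
  assumes N: "prob_space N" "prob_space.indep_vars N (\<lambda>_. borel) V I"
    and N': "prob_space N'" "prob_space.indep_vars N' (\<lambda>_. borel) E I"
    and eq: "\<And>i. i \<in> I \<Longrightarrow> distr N borel (V i) = distr N' borel (E i)"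
    and ne: "I \<noteq> {}" and h: "h \<in> borel_measurable (PiM I (\<lambda>_. borel))"
  shows "(\<integral>w. h (\<lambda>i\<in>I. V i w) \<partial>N) = (\<integral>w. h (\<lambda>i\<in>I. E i w) \<partial>N')"
  unfolding prob_space.integral_indep_vars_PiM[OF N ne h] prob_space.integral_indep_vars_PiM[OF N' ne h]
  using eq by (simp cong: PiM_cong)

text \<open>Composition with the restriction \<open>r\<close> extends \<open>h\<close> continuously
  to all functions, hence Borel measurably. Second countability then reduces measurability of the
  inclusion to single coordinates.\<close>

lemma continuous_map_vec_space_measurable:
  fixes h :: "(nat \<Rightarrow> 'b::{second_countable_topology, topological_space}) \<Rightarrow> real"
  assumes "continuous_map (vec_space q) euclideanreal h"
  shows "h \<in> borel_measurable (PiM {1..q} (\<lambda>_. borel))"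
proof -
  let ?P = "PiM {1..q} (\<lambda>_. borel :: 'b measure)"
  define r where "r x = (\<lambda>j\<in>{1..q}. x j)" for x :: "nat \<Rightarrow> 'b"
  have "continuous_map euclidean (vec_space q) r"
    unfolding continuous_map_componentwise r_def by (auto simp: continuous_on_product_coordinates)
  from continuous_map_compose[OF this assms] have "continuous_on UNIV (\<lambda>x. h (r x))"
    by (simp add: comp_def)
  then have m: "(\<lambda>x. h (r x)) \<in> borel_measurable borel" by (rule borel_measurable_continuous_onI)
  \<comment> \<open>Coordinates outside \<open>{1..q}\<close> are constantly
    \<open>undefined\<close> on this space.\<close>
  have "(\<lambda>z. z) \<in> borel_measurable ?P"
  proof (rule measurable_coordinatewise_then_product)
    fix i
    show "(\<lambda>z. z i) \<in> borel_measurable ?P"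
    proof (cases "i \<in> {1..q}")
      case False
      then have *: "z i = undefined" if "z \<in> space ?P" for z
        using that by (auto simp: space_PiM PiE_def extensional_def)
      show ?thesis by (subst measurable_cong[OF *]) simp_all
    qed (rule measurable_component_singleton)
  qed
  from measurable_compose[OF this m] have "(\<lambda>z. h (r z)) \<in> borel_measurable ?P" .
  moreover have "h (r z) = h z" if "z \<in> space ?P" for z
    using that by (auto simp: r_def space_PiM PiE_def extensional_restrict)
  ultimately show ?thesis by (subst measurable_cong[of _ h "\<lambda>z. h (r z)"]) simp_all
qed

lemma continuous_on_complex_pairs:
  assumes "continuous_map (vec_space q) euclideanreal h"
  shows "continuous_on UNIV (\<lambda>x :: nat \<Rightarrow> real. h (\<lambda>j\<in>{1..q}. Complex (x (2 * j - 1)) (x (2 * j))))"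
proof -
  have "continuous_map euclidean (vec_space q) (\<lambda>x :: nat \<Rightarrow> real. \<lambda>j\<in>{1..q}. Complex (x (2 * j - 1)) (x (2 * j)))"
    unfolding continuous_map_componentwise
    by (auto simp: Complex_eq intro!: continuous_intros)
  from continuous_map_compose[OF this assms] show ?thesis by (simp add: comp_def)
qed

lemma continuous_map_half_square_norm:
  "continuous_map (vec_space q) (vec_space q) (\<lambda>z. \<lambda>j\<in>{1..q}. (cmod (z j))\<^sup>2 / 2)"
  unfolding continuous_map_componentwise
proof (intro conjI ballI)
  fix j assume j: "j \<in> {1..q}"
  have "continuous_map (vec_space q) euclidean (\<lambda>z :: nat \<Rightarrow> complex. z j)"
    by (rule continuous_map_product_projection[OF j])
  moreover have "continuous_map euclidean euclideanreal (\<lambda>w. (cmod w)\<^sup>2 / 2)"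
    by (auto intro!: continuous_intros)
  ultimately have "continuous_map (vec_space q) euclideanreal ((\<lambda>w. (cmod w)\<^sup>2 / 2) \<circ> (\<lambda>z. z j))"
    by (rule continuous_map_compose)
  then show "continuous_map (vec_space q) euclideanreal (\<lambda>z. (\<lambda>j\<in>{1..q}. (cmod (z j))\<^sup>2 / 2) j)"
    using j by (simp add: comp_def)
qed auto

theorem corollary2p1:
  fixes M :: "'a measure" and \<epsilon> :: "int \<Rightarrow> 'a \<Rightarrow> real" and G :: "(nat \<Rightarrow> real) \<Rightarrow> real"
    and X :: "int \<Rightarrow> 'a \<Rightarrow> real" and f :: "real \<Rightarrow> real"
    and q :: nat and l :: "nat \<Rightarrow> nat \<Rightarrow> nat"
    and N :: "'b measure" and Y :: "nat \<Rightarrow> 'b \<Rightarrow> real"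
    and N' :: "'c measure" and E :: "nat \<Rightarrow> 'c \<Rightarrow> real"
  defines "X \<equiv> causal_process G \<epsilon>" and "f \<equiv> spectral_density M X"
  assumes "prob_space M" and "iid M \<epsilon> UNIV"
    and "G \<in> borel_measurable (PiM UNIV (\<lambda>_. borel))"
    and "\<And>k. integrable M (\<lambda>\<omega>. \<bar>X k \<omega>\<bar>\<^sup>2)"
    and "\<And>k. (\<integral>\<omega>. X k \<omega> \<partial>M) = 0"
    and "summable (\<lambda>k::nat. norm_L2 M (proj_op M \<epsilon> 0 (X (int k))))"
    and "\<exists>\<theta>\<^sub>0. (\<forall>\<theta>. f \<theta>\<^sub>0 \<le> f \<theta>) \<and> f \<theta>\<^sub>0 > 0"
    and "q \<ge> 1"
    and "\<forall>\<^sub>F n in sequentially. strict_mono_on {1..q} (l n) \<and>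
           (\<forall>j\<in>{1..q}. 1 \<le> l n j \<and> l n j \<le> (n - 1) div 2)"
    and "prob_space N" and "prob_space.indep_vars N (\<lambda>_. borel) Y {1..2 * q}"
    and "\<And>k. k \<in> {1..2 * q} \<Longrightarrow> distributed N lborel (Y k) std_normal_density"
    and "prob_space N'" and "prob_space.indep_vars N' (\<lambda>_. borel) E {1..q}"
    and "\<And>j. j \<in> {1..q} \<Longrightarrow> distributed N' lborel (E j) (exponential_density 1)"
  shows "conv_in_distribution (vec_space q)
           M (\<lambda>n \<omega>. \<lambda>j\<in>{1..q}. fourier_sum X n (fourier_freq n (l n j)) \<omega> /
                complex_of_real (sqrt (real n * pi * f (fourier_freq n (l n j)))))
           N (\<lambda>\<omega>. \<lambda>j\<in>{1..q}. complex_of_real (Y (2 * j - 1) \<omega>) + \<i> * complex_of_real (Y (2 * j) \<omega>))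
       \<and> conv_in_distribution (vec_space q)
           M (\<lambda>n \<omega>. \<lambda>j\<in>{1..q}. periodogram X n (fourier_freq n (l n j)) \<omega> /
                f (fourier_freq n (l n j)))
           N' (\<lambda>\<omega>. \<lambda>j\<in>{1..q}. E j \<omega>)"
proof -
  interpret M: prob_space M by fact
  interpret noise: iid_noise M \<epsilon> by unfold_locales fact
  interpret N: prob_space N by fact
  obtain \<theta>\<^sub>0 where \<theta>\<^sub>0: "\<And>\<theta>. f \<theta>\<^sub>0 \<le> f \<theta>" "f \<theta>\<^sub>0 > 0" using assms(9) by auto
  have fpos: "f \<theta> > 0" for \<theta> using \<theta>\<^sub>0(1)[of \<theta>] \<theta>\<^sub>0(2) by simp
  let ?\<theta> = "\<lambda>n j. fourier_freq n (l n j)"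
  define Z where "Z n j w = fourier_sum X n (?\<theta> n j) w /
      complex_of_real (sqrt (real n * pi * f (?\<theta> n j)))" for n j w
  define V where "V j w = complex_of_real (Y (2 * j - 1) w) + \<i> * complex_of_real (Y (2 * j) w)" for j w
  have Gm: "G \<in> borel_measurable noise.shift.S"
    using assms(5) measurable_cong_sets[OF noise.sets_shift refl] by blast
  have Xm [measurable]: "X k \<in> borel_measurable M" for k
    unfolding X_def causal_process_def using measurable_compose[OF noise.past_measurable Gm] .
  have Zm [measurable]: "Z n j \<in> borel_measurable M" for n j
    unfolding Z_def fourier_sum_def by measurable
  let ?I = "{1..2 * q}"
  \<comment> \<open>The real vector behind \<open>Z\<close>: odd index \<open>2 * j - 1\<close>
    holds the real part and even index \<open>2 * j\<close> the imaginary part of entry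
    \<open>j\<close>. It vanishes off the index set, as \<open>multivariate_Levy_continuity\<close>
    asks.\<close>
  define W where "W n w i = (if i \<in> ?I then if odd i then Re (Z n ((i + 1) div 2) w) else Im (Z n (i div 2) w) else 0)" for n w i
  define U where "U w i = (if i \<in> ?I then Y i w else 0)" for w i
  have Wm: "(\<lambda>w. W n w i) \<in> borel_measurable M" for n i
    unfolding W_def by (cases "i \<in> ?I"; cases "odd i") simp_all
  have Ym: "Y i \<in> borel_measurable N" if "i \<in> ?I" for i
    using distributed_measurable[OF assms(14)[OF that]] by simp
  have Um: "(\<lambda>w. U w i) \<in> borel_measurable N" for i
    unfolding U_def using Ym[of i] by (cases "i \<in> ?I") (simp_all only: if_True if_False borel_measurable_const)
  have W_pair: "W n w (2 * j - 1) = Re (Z n j w)" "W n w (2 * j) = Im (Z n j w)" if "j \<in> {1..q}" for n w j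
    using that by (auto simp: W_def)
  have WT: "(\<Sum>i\<in>?I. t i * W n w i) = (\<Sum>j=1..q. t (2 * j - 1) * Re (Z n j w) + t (2 * j) * Im (Z n j w))" for t n w
    unfolding sum_even_odd_pairs by (intro sum.cong refl) (simp only: W_pair)
  have lim2: "(\<lambda>n. \<integral>w. (\<Sum>i\<in>?I. t i * W n w i)\<^sup>2 \<partial>M) \<longlonglongrightarrow> (\<Sum>i\<in>?I. (t i)\<^sup>2)" for t
    unfolding WT Z_def f_def X_def
    by (rule noise.fourier_vector_tendsto(1)[OF assms(5), where \<theta>\<^sub>0=\<theta>\<^sub>0])
       (use assms(6-8,11) \<theta>\<^sub>0 in \<open>simp_all add: f_def X_def\<close>)
  have limc: "(\<lambda>n. \<integral>w. iexp (\<Sum>i\<in>?I. t i * W n w i) \<partial>M) \<longlonglongrightarrow> exp (- (\<Sum>i\<in>?I. (t i)\<^sup>2) / 2)" for t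
    unfolding WT Z_def f_def X_def
    by (rule noise.fourier_vector_tendsto(2)[OF assms(5), where \<theta>\<^sub>0=\<theta>\<^sub>0])
       (use assms(6-8,11) \<theta>\<^sub>0 in \<open>simp_all add: f_def X_def\<close>)
  have charU: "(\<integral>w. iexp (\<Sum>i\<in>?I. t i * U w i) \<partial>N) = exp (- (\<Sum>i\<in>?I. (t i)\<^sup>2) / 2)" for t
    using N.char_indep_std_normal[OF assms(13,14), of t] by (simp add: U_def cong: sum.cong_simp)
  have single: "(\<Sum>k\<in>?I. (if k = i then 1 else 0) * x k) = x i" if "i \<in> ?I" for i and x :: "nat \<Rightarrow> real"
    using that by (simp add: if_distrib[of "\<lambda>u. u * _"] cong: if_cong)
  \<comment> \<open>Testing \<open>lim2\<close> with a unit vector gives the limit 1 for each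
    coordinate, so any number above 1 is an eventual bound.\<close>
  have W2b: "\<forall>\<^sub>F n in sequentially. (\<integral>w. (W n w i)\<^sup>2 \<partial>M) \<le> 2" if i: "i \<in> ?I" for i
  proof -
    have "(\<Sum>k\<in>?I. (if k = i then 1 else 0)\<^sup>2) = (1::real)" using i by (simp add: if_distrib[of "\<lambda>u. u\<^sup>2"] cong: if_cong)
    then have "(\<lambda>n. \<integral>w. (W n w i)\<^sup>2 \<partial>M) \<longlonglongrightarrow> 1"
      using lim2[of "\<lambda>k. if k = i then 1 else 0"] unfolding single[OF i] by simp
    then have "\<forall>\<^sub>F n in sequentially. (\<integral>w. (W n w i)\<^sup>2 \<partial>M) < 2" by (rule order_tendstoD(2)) simp
    then show ?thesis by eventually_elim simp
  qed
  have sqX: "sqint M (X k)" for k using assms(6)[of k] by (simp add: sqint_def)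
  have sqZ: "sqint M (\<lambda>w. Re (Z n j w))" "sqint M (\<lambda>w. Im (Z n j w))" for n j
  proof -
    let ?x = "\<lambda>k. real k * ?\<theta> n j" and ?s = "sqrt (real n * pi * f (?\<theta> n j))"
    have "Re (Z n j w) = (\<Sum>k=1..n. (cos (?x k) / ?s) * X (int k) w)" "Im (Z n j w) = (\<Sum>k=1..n. (sin (?x k) / ?s) * X (int k) w)" for w
      by (simp_all add: Z_def fourier_sum_def Re_divide_of_real Im_divide_of_real sum_divide_distrib mult.commute)
    then show "sqint M (\<lambda>w. Re (Z n j w))" "sqint M (\<lambda>w. Im (Z n j w))"
      by (simp_all only:) (intro sqint_sum sqint_scale sqX)+
  qed
  have W2: "integrable M (\<lambda>w. (W n w i)\<^sup>2)" if "i \<in> ?I" for n i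
    using that sqZ unfolding W_def sqint_def by (cases "odd i") auto
  have part1: "(\<lambda>n. \<integral>w. h (\<lambda>j\<in>{1..q}. Z n j w) \<partial>M) \<longlonglongrightarrow> (\<integral>w. h (\<lambda>j\<in>{1..q}. V j w) \<partial>N)"
    if h: "continuous_map (vec_space q) euclideanreal h" "bounded (h ` topspace (vec_space q))" for h :: "(nat \<Rightarrow> complex) \<Rightarrow> real"
  proof -
    define H where "H x = h (\<lambda>j\<in>{1..q}. Complex (x (2 * j - 1)) (x (2 * j)))" for x :: "nat \<Rightarrow> real"
    obtain K where K: "\<And>z. z \<in> topspace (vec_space q) \<Longrightarrow> \<bar>h z\<bar> \<le> K"
      using h(2) unfolding bounded_iff by auto
    have HK: "\<bar>H x\<bar> \<le> K" for x unfolding H_def by (rule K) auto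
    have Hc: "continuous_on UNIV H" unfolding H_def by (rule continuous_on_complex_pairs[OF h(1)])
    have "(\<lambda>n. \<integral>w. H (W n w) \<partial>M) \<longlonglongrightarrow> (\<integral>w. H (U w) \<partial>N)"
    proof (rule multivariate_Levy_continuity[OF M.prob_space_axioms N.prob_space_axioms _ Wm Um _ _ _ W2 W2b _ _ Hc HK])
      show "(\<lambda>n. \<integral>w. iexp (\<Sum>i\<in>?I. t i * W n w i) \<partial>M) \<longlonglongrightarrow> (\<integral>w. iexp (\<Sum>i\<in>?I. t i * U w i) \<partial>N)" for t
        unfolding charU by (rule limc)
      show "integrable N (\<lambda>w. (U w i)\<^sup>2)" "(\<integral>w. (U w i)\<^sup>2 \<partial>N) \<le> 2" if "i \<in> ?I" for i
        using N.std_normal_second_moment[OF assms(14)[OF that]] that by (simp_all add: U_def)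
    qed (auto simp: W_def U_def)
    moreover have "H (W n w) = h (\<lambda>j\<in>{1..q}. Z n j w)" for n w
      unfolding H_def by (intro arg_cong[where f=h] restrict_ext) (simp only: W_pair complex_surj)
    moreover have "H (U w) = h (\<lambda>j\<in>{1..q}. V j w)" for w
      unfolding H_def by (intro arg_cong[where f=h] restrict_ext) (auto simp: U_def V_def Complex_eq)
    ultimately show ?thesis by simp
  qed
  let ?R = "\<lambda>j w. ((Y (2 * j - 1) w)\<^sup>2 + (Y (2 * j) w)\<^sup>2) / 2"
  have part2: "(\<lambda>n. \<integral>w. h (\<lambda>j\<in>{1..q}. periodogram X n (?\<theta> n j) w / f (?\<theta> n j)) \<partial>M)
      \<longlonglongrightarrow> (\<integral>w. h (\<lambda>j\<in>{1..q}. E j w) \<partial>N')"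
    if h: "continuous_map (vec_space q) euclideanreal h" "bounded (h ` topspace (vec_space q))" for h :: "(nat \<Rightarrow> real) \<Rightarrow> real"
  proof -
    \<comment> \<open>Half the squared modulus carries the normalised transform exactly to the
      normalised periodogram, so the second claim is the first one tested against
      \<open>h \<circ> sqn\<close>.\<close>
    define sqn where "sqn z = (\<lambda>j\<in>{1..q}. (cmod (z j))\<^sup>2 / 2)" for z :: "nat \<Rightarrow> complex"
    have c: "continuous_map (vec_space q) euclideanreal (\<lambda>z. h (sqn z))"
      using continuous_map_compose[OF continuous_map_half_square_norm h(1)] by (simp add: comp_def sqn_def)
    have b: "bounded ((\<lambda>z. h (sqn z)) ` topspace (vec_space q))"
      by (rule bounded_subset[OF h(2)]) (auto simp: sqn_def)
    have Z2: "sqn (\<lambda>j\<in>{1..q}. Z n j w) = (\<lambda>j\<in>{1..q}. periodogram X n (?\<theta> n j) w / f (?\<theta> n j))" for n w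
      unfolding sqn_def
    proof (rule restrict_ext)
      fix j assume "j \<in> {1..q}"
      then show "(cmod ((\<lambda>j\<in>{1..q}. Z n j w) j))\<^sup>2 / 2 = periodogram X n (?\<theta> n j) w / f (?\<theta> n j)"
        using fpos[of "?\<theta> n j"]
        by (simp add: Z_def periodogram_def norm_divide power_divide less_imp_le)
    qed
    have V2: "sqn (\<lambda>j\<in>{1..q}. V j w) = (\<lambda>j\<in>{1..q}. ?R j w)" for w
      unfolding sqn_def by (rule restrict_ext) (simp add: V_def cmod_def)
    \<comment> \<open>The entries \<open>?R j\<close> use disjoint pairs of the \<open>Y k\<close>,
      so they are independent; each is exponential, hence jointly distributed as the
      \<open>E j\<close>.\<close>
    have "(\<integral>w. h (\<lambda>j\<in>{1..q}. ?R j w) \<partial>N) = (\<integral>w. h (\<lambda>j\<in>{1..q}. E j w) \<partial>N')"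
    proof (rule integral_indep_vars_cong[OF assms(12) _ assms(15,16)])
      have "N.indep_vars (\<lambda>j. PiM {2 * j - 1, 2 * j} (\<lambda>_. borel)) (\<lambda>j w. restrict (\<lambda>i. Y i w) {2 * j - 1, 2 * j}) {1..q}"
      proof (rule N.indep_vars_restrict[OF assms(13)])
        show "disjoint_family_on (\<lambda>j. {2 * j - 1, 2 * j}) {1..q}"
          unfolding disjoint_family_on_def
        proof (intro ballI impI)
          fix i j assume "i \<in> {1..q}" "j \<in> {1..q}" "i \<noteq> j"
          then have "2 * i - 1 \<noteq> 2 * j - 1" "2 * i - 1 \<noteq> 2 * j" "2 * i \<noteq> 2 * j - 1" "2 * i \<noteq> 2 * j"
            unfolding atLeastAtMost_iff by presburger+
          then show "{2 * i - 1, 2 * i} \<inter> {2 * j - 1, 2 * j} = {}" by simp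
        qed
      qed auto
      from N.indep_vars_compose2[OF this, of "\<lambda>j y. ((y (2 * j - 1))\<^sup>2 + (y (2 * j))\<^sup>2) / 2" "\<lambda>_. borel"]
      show "N.indep_vars (\<lambda>_. borel) ?R {1..q}"
        by simp
    next
      fix j assume j: "j \<in> {1..q}"
      then have jI: "2 * j - 1 \<in> ?I" "2 * j \<in> ?I" by auto
      have "N.indep_var (PiM {2 * j - 1} (\<lambda>_. borel)) (\<lambda>w. restrict (\<lambda>i. Y i w) {2 * j - 1}) (PiM {2 * j} (\<lambda>_. borel)) (\<lambda>w. restrict (\<lambda>i. Y i w) {2 * j})"
        by (rule N.indep_var_restrict[OF assms(13)]) (use jI j in \<open>auto, presburger?\<close>)
      from N.indep_var_compose[OF this, of "\<lambda>y. y (2 * j - 1)" borel "\<lambda>y. y (2 * j)" borel]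
      have "N.indep_var borel (Y (2 * j - 1)) borel (Y (2 * j))" by (simp add: comp_def)
      from N.half_square_norm_std_normal[OF this assms(14)[OF jI(1)] assms(14)[OF jI(2)]]
      have 1: "distr N lborel (?R j) = density lborel (exponential_density 1)"
        by (rule distributed_distr_eq_density)
      have 2: "distr N' lborel (E j) = density lborel (exponential_density 1)"
        by (rule distributed_distr_eq_density[OF assms(17)[OF j]])
      \<comment> \<open>\<open>distributed\<close> refers to \<open>lborel\<close> and the
        independence statement to \<open>borel\<close>; their measurable sets coincide.\<close>
      have 3: "distr N borel Q = distr N lborel Q" "distr N' borel Q' = distr N' lborel Q'" for Q Q'
        by (rule distr_cong; simp)+
      show "distr N borel (?R j) = distr N' borel (E j)"
        unfolding 3 1 2 ..
    qed (use assms(10) continuous_map_vec_space_measurable[OF h(1)] in auto)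
    then show ?thesis using part1[OF c b] unfolding Z2 V2 by simp
  qed
  show ?thesis
    unfolding conv_in_distribution_def using part1 part2 unfolding Z_def V_def by blast
qed

end
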